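(* Let $\varphi$ be a state on $C(S_N^+)$ that is genuinely quantum, i.e. $\omega_{\varphi}(p_Q)>0$, and let $h_{S_N}:=h_{C(S_N)}\circ \pi_{\text{ab}}$. Let $$\phi_\varphi:=w^*\text{-}\lim_{n\to\infty}\frac1n\sum_{k=1}^n\varphi^{\star k}$$ be the idempotent state obtained as the weak-* limit of the Ces\`{a}ro means of $\varphi$, and define the idempotent state $$\phi:=w^*\text{-}\lim_{n\to\infty}\frac{1}{n}\sum_{k=1}^n(h_{S_N}\star \phi_\varphi)^{\star k}.$$ Then the quasi-subgroup $\mathbb{S}_\phi=\{\rho:\rho\star\phi=\phi=\phi\star\rho\}$ generated by $\phi$ satisfies $$S_N\subsetneq \mathbb{S}_{\phi}\subseteq S_N^+,$$ where $S_N$ denotes the set of states $\{\rho_0\circ\pi_{\text{ab}}:\rho_0\text{ a state on }C(S_N)\}$ (the random permutations) and $S_N^+$ denotes the set of all states on $C(S_N^+)$.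
   Context: $C(S_N^+)$ is the universal unital $\mathrm{C}^*$-algebra generated by the entries of an $N\times N$ magic unitary $u=(u_{ij})$ (all $u_{ij}$ are projections and each row and column sums to $\mathds{1}$), with comultiplication $\Delta(u_{ij})=\sum_k u_{ik}\otimes u_{kj}$ (minimal tensor product). Convolution of states is $\varphi_1\star\varphi_2:=(\varphi_1\otimes\varphi_2)\Delta$; a state $\phi$ is idempotent if $\phi\star\phi=\phi$. $\pi_{\text{ab}}:C(S_N^+)\to C(S_N)$ is the abelianisation, $u_{ij}\mapsto \mathds{1}_{\{\sigma:\sigma(j)=i\}}$, and $h_{C(S_N)}$ is the state on $C(S_N)$ given by the uniform probability on $S_N$. $C(S_N^+)^{**}$ is the bidual von Neumann algebra; each state $\varphi$ has a unique normal extension $\omega_\varphi$ to it, and the support projection of $\varphi$ is the smallest projection $p$ with $\omega_\varphi(p)=1$. For $\sigma\in S_N$, $\operatorname{ev}_\sigma(f):=\pi_{\text{ab}}(f)(\sigma)$ is a character with support projection $p_\sigma$. Put $p_C:=\sum_{\sigma\in S_N}p_\sigma$ and $p_Q:=\mathds{1}-p_C$. A state $\varphi$ is a random permutation iff $\omega_\varphi(p_Q)=0$, equivalently iff it is of the form $\rho_0\circ\pi_{\text{ab}}$ with $\rho_0$ a state on $C(S_N)$. *)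

theory Defs
  imports
    "HOL-Analysis.Analysis"
    "HOL-Library.Poly_Mapping"
    "HOL-Library.Nonpos_Ints"
    "HOL-Combinatorics.Perm"
begin

section \<open>Unital C*-algebras\<close>

text \<open>
  The library has real Banach algebras only. The class adds complex scalars and the involution.
  As \<open>norm 1 = 1\<close> belongs to \<^class>\<open>real_normed_algebra_1\<close>, the zero algebra is excluded.
\<close>

class cstar_algebra = real_normed_algebra_1 + complete_space +
  fixes scaleC :: "complex \<Rightarrow> 'a \<Rightarrow> 'a"
    and star :: "'a \<Rightarrow> 'a"
  assumes scaleC_add_right: "scaleC c (x + y) = scaleC c x + scaleC c y"
    and scaleC_add_left: "scaleC (c + d) x = scaleC c x + scaleC d x"
    and scaleC_scaleC: "scaleC c (scaleC d x) = scaleC (c * d) x"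
    and scaleC_of_real: "scaleC (of_real r) x = r *\<^sub>R x"
    and scaleC_mult_left: "scaleC c x * y = scaleC c (x * y)"
    and scaleC_mult_right: "x * scaleC c y = scaleC c (x * y)"
    and norm_scaleC: "norm (scaleC c x) = cmod c * norm x"
    and star_star: "star (star x) = x"
    and star_add: "star (x + y) = star x + star y"
    and star_scaleC: "star (scaleC c x) = scaleC (cnj c) (star x)"
    and star_mult: "star (x * y) = star y * star x"
    and cstar_identity: "norm (star x * x) = (norm x)\<^sup>2"

lemma norm_star: "norm (star x) = norm (x :: 'a::cstar_algebra)"
proof -
  have le: "norm y \<le> norm (star y)" for y :: 'a
  proof (cases "norm y = 0")
    case False
    have "(norm y)\<^sup>2 \<le> norm (star y) * norm y"
      using norm_mult_ineq[of "star y" y] by (simp add: cstar_identity)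
    with False show ?thesis by (simp add: power2_eq_square)
  qed simp
  show ?thesis using le[of x] le[of "star x"] by (simp add: star_star)
qed

lemma bounded_linear_star: "bounded_linear (star :: 'a::cstar_algebra \<Rightarrow> 'a)"
proof
  show "star (x + y) = star x + star y" for x y :: 'a by (rule star_add)
  show "star (r *\<^sub>R x) = r *\<^sub>R star x" for r and x :: 'a
    using star_scaleC[of "of_real r" x] by (simp add: scaleC_of_real)
  show "\<exists>K. \<forall>x::'a. norm (star x) \<le> norm x * K"
    by (rule exI[of _ 1]) (simp add: norm_star)
qed

lemma bounded_linear_scaleC: "bounded_linear (scaleC c :: 'a::cstar_algebra \<Rightarrow> 'a)"
proof
  show "scaleC c (x + y) = scaleC c x + scaleC c y" for x y :: 'a by (rule scaleC_add_right)
  show "scaleC c (r *\<^sub>R x) = r *\<^sub>R scaleC c x" for r and x :: 'a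
    by (simp add: scaleC_scaleC mult.commute flip: scaleC_of_real)
  show "\<exists>K. \<forall>x::'a. norm (scaleC c x) \<le> norm x * K"
    by (rule exI[of _ "cmod c"]) (simp add: norm_scaleC)
qed

instantiation complex :: cstar_algebra
begin

definition scaleC_complex :: "complex \<Rightarrow> complex \<Rightarrow> complex"
  where "scaleC_complex = (*)"

definition star_complex :: "complex \<Rightarrow> complex"
  where "star_complex = cnj"

instance
  by standard
    (auto simp: scaleC_complex_def star_complex_def algebra_simps scaleR_conv_of_real
      norm_mult power2_eq_square)

end

definition clinear :: "('a::cstar_algebra \<Rightarrow> complex) \<Rightarrow> bool"
  where "clinear f \<longleftrightarrow>
    (\<forall>x y. f (x + y) = f x + f y) \<and> (\<forall>c x. f (scaleC c x) = c * f x)"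

definition star_hom :: "('a::cstar_algebra \<Rightarrow> 'b::cstar_algebra) \<Rightarrow> bool"
  where "star_hom h \<longleftrightarrow>
    (\<forall>x y. h (x + y) = h x + h y) \<and> (\<forall>c x. h (scaleC c x) = scaleC c (h x)) \<and>
    (\<forall>x y. h (x * y) = h x * h y) \<and> (\<forall>x. h (star x) = star (h x)) \<and> h 1 = 1"

definition state :: "('a::cstar_algebra \<Rightarrow> complex) \<Rightarrow> bool"
  where "state f \<longleftrightarrow> clinear f \<and> (\<forall>x. f (star x * x) \<in> \<real>\<^sub>\<ge>\<^sub>0) \<and> f 1 = 1"


section \<open>The C*-algebra of continuous functions, and the group of permutations\<close>

text \<open>Pointwise operations make the library's Banach space of bounded continuous functions
  into a C*-algebra.\<close>

setup_lifting type_definition_bcontfun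

instantiation bcontfun :: (metric_space, cstar_algebra) cstar_algebra
begin

lift_definition one_bcontfun :: "'a \<Rightarrow>\<^sub>C 'b" is "\<lambda>_. 1"
  by (rule const_bcontfun)

lift_definition times_bcontfun :: "('a \<Rightarrow>\<^sub>C 'b) \<Rightarrow> ('a \<Rightarrow>\<^sub>C 'b) \<Rightarrow> 'a \<Rightarrow>\<^sub>C 'b"
  is "\<lambda>f g x. f x * g x"
proof -
  fix f g :: "'a \<Rightarrow> 'b"
  assume fg: "f \<in> bcontfun" "g \<in> bcontfun"
  obtain a where a: "\<And>x. norm (f x) \<le> a"
    using fg(1) by (auto simp: bcontfun_def bounded_iff)
  obtain b where b: "\<And>x. norm (g x) \<le> b"
    using fg(2) by (auto simp: bcontfun_def bounded_iff)
  have "norm (f x * g x) \<le> a * b" for x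
    by (rule order_trans[OF norm_mult_ineq])
      (rule mult_mono[OF a b order_trans[OF norm_ge_zero a] norm_ge_zero])
  then have "bounded (range (\<lambda>x. f x * g x))"
    by (auto simp: bounded_iff)
  with fg show "(\<lambda>x. f x * g x) \<in> bcontfun"
    by (auto simp: bcontfun_def intro!: continuous_intros)
qed

lemma bounded_linear_comp_bcontfun:
  fixes h :: "'b \<Rightarrow> 'b"
  assumes h: "bounded_linear h" and f: "f \<in> bcontfun"
  shows "(\<lambda>x. h (f x)) \<in> bcontfun"
proof -
  have "bounded (h ` range f)"
    using f by (intro bounded_linear_image h) (simp add: bcontfun_def)
  then have "bounded (range (\<lambda>x. h (f x)))"
    by (simp add: image_image)
  moreover have "continuous_on UNIV (\<lambda>x. h (f x))"
    using f by (intro bounded_linear.continuous_on[OF h]) (simp add: bcontfun_def)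
  ultimately show ?thesis by (simp add: bcontfun_def)
qed

lift_definition scaleC_bcontfun :: "complex \<Rightarrow> ('a \<Rightarrow>\<^sub>C 'b) \<Rightarrow> 'a \<Rightarrow>\<^sub>C 'b"
  is "\<lambda>c f x. scaleC c (f x)"
  by (rule bounded_linear_comp_bcontfun[OF bounded_linear_scaleC])

lift_definition star_bcontfun :: "('a \<Rightarrow>\<^sub>C 'b) \<Rightarrow> 'a \<Rightarrow>\<^sub>C 'b"
  is "\<lambda>f x. star (f x)"
  by (rule bounded_linear_comp_bcontfun[OF bounded_linear_star])

instance
proof
  fix f g h :: "'a \<Rightarrow>\<^sub>C 'b" and c d :: complex and r :: real
  note app = times_bcontfun.rep_eq one_bcontfun.rep_eq scaleC_bcontfun.rep_eq star_bcontfun.rep_eq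
  note eqI = bcontfun_eqI
  show "f * g * h = f * (g * h)"
    by (rule eqI) (simp add: app mult.assoc)
  show "(f + g) * h = f * h + g * h"
    by (rule eqI) (simp add: app algebra_simps)
  show "f * (g + h) = f * g + f * h"
    by (rule eqI) (simp add: app algebra_simps)
  show "r *\<^sub>R f * g = r *\<^sub>R (f * g)"
    by (rule eqI) (simp add: app)
  show "f * r *\<^sub>R g = r *\<^sub>R (f * g)"
    by (rule eqI) (simp add: app)
  show "1 * f = f"
    by (rule eqI) (simp add: app)
  show "f * 1 = f"
    by (rule eqI) (simp add: app)
  show "(0 :: 'a \<Rightarrow>\<^sub>C 'b) \<noteq> 1"
  proof
    assume "(0 :: 'a \<Rightarrow>\<^sub>C 'b) = 1"
    then have "apply_bcontfun (0 :: 'a \<Rightarrow>\<^sub>C 'b) undefined = apply_bcontfun 1 undefined"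
      by simp
    then show False by (simp add: app)
  qed
  show "norm (f * g) \<le> norm f * norm g"
  proof (rule norm_bound)
    fix x
    have "norm (apply_bcontfun (f * g) x) \<le> norm (apply_bcontfun f x) * norm (apply_bcontfun g x)"
      by (simp add: app norm_mult_ineq)
    also have "\<dots> \<le> norm f * norm g"
      by (intro mult_mono norm_bounded) auto
    finally show "norm (apply_bcontfun (f * g) x) \<le> norm f * norm g" .
  qed
  show "norm (1 :: 'a \<Rightarrow>\<^sub>C 'b) = 1"
  proof (rule antisym)
    show "norm (1 :: 'a \<Rightarrow>\<^sub>C 'b) \<le> 1"
      by (rule norm_bound) (simp add: app)
    show "1 \<le> norm (1 :: 'a \<Rightarrow>\<^sub>C 'b)"
      using norm_bounded[of "1 :: 'a \<Rightarrow>\<^sub>C 'b" undefined] by (simp add: app)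
  qed
  show "scaleC c (f + g) = scaleC c f + scaleC c g"
    by (rule eqI) (simp add: app scaleC_add_right)
  show "scaleC (c + d) f = scaleC c f + scaleC d f"
    by (rule eqI) (simp add: app scaleC_add_left)
  show "scaleC c (scaleC d f) = scaleC (c * d) f"
    by (rule eqI) (simp add: app scaleC_scaleC)
  show "scaleC (of_real r) f = r *\<^sub>R f"
    by (rule eqI) (simp add: app scaleC_of_real)
  show "scaleC c f * g = scaleC c (f * g)"
    by (rule eqI) (simp add: app scaleC_mult_left)
  show "f * scaleC c g = scaleC c (f * g)"
    by (rule eqI) (simp add: app scaleC_mult_right)
  show "norm (scaleC c f) = cmod c * norm f"
  proof (rule antisym)
    have le: "norm (scaleC c f) \<le> cmod c * norm f" for c and f :: "'a \<Rightarrow>\<^sub>C 'b"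
      by (rule norm_bound) (simp add: app norm_scaleC mult_left_mono norm_bounded)
    show "norm (scaleC c f) \<le> cmod c * norm f" by (rule le)
    show "cmod c * norm f \<le> norm (scaleC c f)"
    proof (cases "c = 0")
      case False
      have "scaleC (inverse c) (scaleC c f) = f"
        using False scaleC_of_real[of 1]
        by (intro eqI) (simp add: app scaleC_scaleC)
      then have "norm f \<le> cmod (inverse c) * norm (scaleC c f)"
        using le[of "inverse c" "scaleC c f"] by simp
      then show ?thesis
        using False by (simp add: norm_divide field_simps)
    qed simp
  qed
  show "star (star f) = f"
    by (rule eqI) (simp add: app star_star)
  show "star (f + g) = star f + star g"
    by (rule eqI) (simp add: app star_add)
  show "star (scaleC c f) = scaleC (cnj c) (star f)"
    by (rule eqI) (simp add: app star_scaleC)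
  show "star (f * g) = star g * star f"
    by (rule eqI) (simp add: app star_mult)
  show "norm (star f * f) = (norm f)\<^sup>2"
  proof (rule antisym)
    show "norm (star f * f) \<le> (norm f)\<^sup>2"
      by (rule norm_bound) (simp add: app cstar_identity norm_bounded power_mono)
    have "norm f \<le> sqrt (norm (star f * f))"
    proof (rule norm_bound)
      fix x
      have "(norm (apply_bcontfun f x))\<^sup>2 \<le> norm (star f * f)"
        using norm_bounded[of "star f * f" x] by (simp add: app cstar_identity)
      then show "norm (apply_bcontfun f x) \<le> sqrt (norm (star f * f))"
        by (rule real_le_rsqrt)
    qed
    then show "(norm f)\<^sup>2 \<le> norm (star f * f)"
      by (metis norm_ge_zero power_mono real_sqrt_pow2)
  qed
qed

end

text \<open>For a finite type \<open>'n\<close>, \<open>'n perm\<close> is the full symmetric group; it carries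
  the discrete metric, so that every function on it is continuous.\<close>

instantiation perm :: (type) metric_space
begin

definition dist_perm :: "'a perm \<Rightarrow> 'a perm \<Rightarrow> real"
  where "dist_perm \<sigma> \<tau> = (if \<sigma> = \<tau> then 0 else 1)"

definition uniformity_perm :: "('a perm \<times> 'a perm) filter"
  where "uniformity_perm = (INF e\<in>{0 <..}. principal {(\<sigma>, \<tau>). dist \<sigma> \<tau> < e})"

definition open_perm :: "'a perm set \<Rightarrow> bool"
  where "open_perm S = (\<forall>\<sigma>\<in>S. \<forall>\<^sub>F (\<sigma>', \<tau>) in uniformity. \<sigma>' = \<sigma> \<longrightarrow> \<tau> \<in> S)"

instance
  by standard (auto simp: dist_perm_def uniformity_perm_def open_perm_def)

end

type_synonym 'n C_perm = "'n perm \<Rightarrow>\<^sub>C complex"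

definition uniform_state :: "'n::finite C_perm \<Rightarrow> complex"
  where "uniform_state f = (\<Sum>\<sigma>\<in>UNIV. apply_bcontfun f \<sigma>) / of_nat (fact CARD('n))"


section \<open>The universal C*-algebra generated by a magic unitary\<close>

text \<open>The free unital *-algebra on self-adjoint generators indexed by \<open>'i\<close>: the
  monoid algebra of the monoid of words.\<close>

datatype 'i wrd = Word (letters: "'i list")

instantiation wrd :: (type) monoid_add
begin

definition zero_wrd :: "'a wrd"
  where "zero_wrd = Word []"

definition plus_wrd :: "'a wrd \<Rightarrow> 'a wrd \<Rightarrow> 'a wrd"
  where "plus_wrd v w = Word (letters v @ letters w)"

instance
  by standard (auto simp: zero_wrd_def plus_wrd_def)

end

type_synonym 'i free_alg = "'i wrd \<Rightarrow>\<^sub>0 complex"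

definition gen :: "'i \<Rightarrow> 'i free_alg"
  where "gen i = Poly_Mapping.single (Word [i]) 1"

definition free_scale :: "complex \<Rightarrow> 'i free_alg \<Rightarrow> 'i free_alg"
  where "free_scale c f = Poly_Mapping.map ((*) c) f"

definition free_star :: "'i free_alg \<Rightarrow> 'i free_alg"
  where "free_star f = Poly_Mapping.map cnj (Poly_Mapping.map_key (\<lambda>w. Word (rev (letters w))) f)"

definition free_eval :: "('i \<Rightarrow> 'a::cstar_algebra) \<Rightarrow> 'i free_alg \<Rightarrow> 'a"
  where "free_eval v f =
    (\<Sum>w\<in>Poly_Mapping.keys f. scaleC (Poly_Mapping.lookup f w) (prod_list (map v (letters w))))"

definition cstar_seminorm :: "('i free_alg \<Rightarrow> real) \<Rightarrow> bool"
  where "cstar_seminorm p \<longleftrightarrow>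
    (\<forall>f g. p (f + g) \<le> p f + p g) \<and> (\<forall>c f. p (free_scale c f) = cmod c * p f) \<and>
    (\<forall>f g. p (f * g) \<le> p f * p g) \<and> (\<forall>f. p (free_star f * f) = (p f)\<^sup>2)"

definition magic_unitary :: "('n::finite \<Rightarrow> 'n \<Rightarrow> 'a::cstar_algebra) \<Rightarrow> bool"
  where "magic_unitary u \<longleftrightarrow>
    (\<forall>i j. u i j * u i j = u i j \<and> star (u i j) = u i j) \<and>
    (\<forall>i. (\<Sum>j\<in>UNIV. u i j) = 1) \<and> (\<forall>j. (\<Sum>i\<in>UNIV. u i j) = 1)"

definition magic_seminorm :: "(('n::finite \<times> 'n) free_alg \<Rightarrow> real) \<Rightarrow> bool"
  where "magic_seminorm p \<longleftrightarrow> cstar_seminorm p \<and>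
    (\<forall>i j. p (gen (i, j) * gen (i, j) - gen (i, j)) = 0) \<and>
    (\<forall>i. p ((\<Sum>j\<in>UNIV. gen (i, j)) - 1) = 0) \<and>
    (\<forall>j. p ((\<Sum>i\<in>UNIV. gen (i, j)) - 1) = 0)"

text \<open>
  The universal C*-algebra of the magic unitary relations is the completion of the free
  *-algebra with respect to the largest C*-seminorm in which the relations hold. Each such
  seminorm comes from a magic unitary in some C*-algebra and conversely, so quantifying over
  seminorms is quantifying over all C*-algebras containing a magic unitary, which HOL cannot do
  directly. The algebra is a type \<open>'a\<close>, given with its generating matrix \<open>u\<close>.
\<close>

definition universal_magic_unitary :: "('n::finite \<Rightarrow> 'n \<Rightarrow> 'a::cstar_algebra) \<Rightarrow> bool"
  where "universal_magic_unitary u \<longleftrightarrow>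
    magic_unitary u \<and>
    closure (range (free_eval (\<lambda>(i, j). u i j))) = UNIV \<and>
    (\<forall>p f. magic_seminorm p \<longrightarrow> p f \<le> norm (free_eval (\<lambda>(i, j). u i j) f))"


section \<open>The minimal tensor product\<close>

text \<open>A list of pairs \<open>(a, b)\<close> stands for the element \<open>\<Sum> a \<otimes> b\<close> of the algebraic
  tensor product.\<close>

definition fmult :: "('a::cstar_algebra \<times> 'b::cstar_algebra) list \<Rightarrow> ('a \<times> 'b) list \<Rightarrow> ('a \<times> 'b) list"
  where "fmult xs ys = [(a * c, b * d). (a, b) \<leftarrow> xs, (c, d) \<leftarrow> ys]"

definition fstar :: "('a::cstar_algebra \<times> 'b::cstar_algebra) list \<Rightarrow> ('a \<times> 'b) list"
  where "fstar xs = [(star a, star b). (a, b) \<leftarrow> xs]"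

definition ffun :: "('a::cstar_algebra \<Rightarrow> complex) \<Rightarrow> ('b::cstar_algebra \<Rightarrow> complex) \<Rightarrow>
    ('a \<times> 'b) list \<Rightarrow> complex"
  where "ffun \<phi> \<psi> xs = (\<Sum>(a, b)\<leftarrow>xs. \<phi> a * \<psi> b)"

text \<open>
  The spatial norm of \<open>x\<close> is the supremum of \<open>\<parallel>(\<pi>\<^sub>\<phi> \<otimes> \<pi>\<^sub>\<psi>)(x)\<parallel>\<close> over the GNS representations
  of all states \<open>\<phi>\<close>, \<open>\<psi>\<close>; below, \<open>y\<close> runs through the unit vectors of the algebraic
  tensor product inside the GNS space of \<open>\<phi> \<otimes> \<psi>\<close>, a dense subspace.
\<close>

definition spatial_norm :: "('a::cstar_algebra \<times> 'b::cstar_algebra) list \<Rightarrow> real"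
  where "spatial_norm x =
    sqrt (Sup {Re (ffun \<phi> \<psi> (fmult (fstar (fmult x y)) (fmult x y))) | \<phi> \<psi> y.
                 state \<phi> \<and> state \<psi> \<and> ffun \<phi> \<psi> (fmult (fstar y) y) = 1})"

definition min_tensor_product ::
    "('a::cstar_algebra \<Rightarrow> 'b::cstar_algebra \<Rightarrow> 'c::cstar_algebra) \<Rightarrow> bool"
  where "min_tensor_product t \<longleftrightarrow>
    (\<forall>a a' b. t (a + a') b = t a b + t a' b) \<and> (\<forall>a b b'. t a (b + b') = t a b + t a b') \<and>
    (\<forall>c a b. t (scaleC c a) b = scaleC c (t a b)) \<and>
    (\<forall>c a b. t a (scaleC c b) = scaleC c (t a b)) \<and>
    (\<forall>a a' b b'. t a b * t a' b' = t (a * a') (b * b')) \<and>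
    (\<forall>a b. star (t a b) = t (star a) (star b)) \<and> t 1 1 = 1 \<and>
    closure (range (\<lambda>x. \<Sum>(a, b)\<leftarrow>x. t a b)) = UNIV \<and>
    (\<forall>x. norm (\<Sum>(a, b)\<leftarrow>x. t a b) = spatial_norm x)"

definition tensor_state :: "('a::cstar_algebra \<Rightarrow> 'b::cstar_algebra \<Rightarrow> 'c::cstar_algebra) \<Rightarrow>
    ('a \<Rightarrow> complex) \<Rightarrow> ('b \<Rightarrow> complex) \<Rightarrow> 'c \<Rightarrow> complex"
  where "tensor_state t \<phi> \<psi> = (THE \<omega>. state \<omega> \<and> (\<forall>a b. \<omega> (t a b) = \<phi> a * \<psi> b))"


section \<open>Convolution, abelianisation, idempotent states\<close>

text \<open>From here on \<open>u\<close> is the universal magic unitary and \<open>t\<close> the tensor map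
  \<open>(a, b) \<mapsto> a \<otimes> b\<close> into the minimal tensor square.\<close>

definition comult :: "('n::finite \<Rightarrow> 'n \<Rightarrow> 'a::cstar_algebra) \<Rightarrow> ('a \<Rightarrow> 'a \<Rightarrow> 'b::cstar_algebra) \<Rightarrow> 'a \<Rightarrow> 'b"
  where "comult u t =
    (THE \<Delta>. star_hom \<Delta> \<and> (\<forall>i j. \<Delta> (u i j) = (\<Sum>k\<in>UNIV. t (u i k) (u k j))))"

definition conv :: "('n::finite \<Rightarrow> 'n \<Rightarrow> 'a::cstar_algebra) \<Rightarrow> ('a \<Rightarrow> 'a \<Rightarrow> 'b::cstar_algebra) \<Rightarrow>
    ('a \<Rightarrow> complex) \<Rightarrow> ('a \<Rightarrow> complex) \<Rightarrow> 'a \<Rightarrow> complex"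
  where "conv u t \<phi> \<psi> = tensor_state t \<phi> \<psi> \<circ> comult u t"

text \<open>The convolution power \<open>\<phi>\<^sup>\<star>\<^sup>k\<close>, for \<open>k \<ge> 1\<close>.\<close>

definition conv_pow :: "('n::finite \<Rightarrow> 'n \<Rightarrow> 'a::cstar_algebra) \<Rightarrow> ('a \<Rightarrow> 'a \<Rightarrow> 'b::cstar_algebra) \<Rightarrow>
    ('a \<Rightarrow> complex) \<Rightarrow> nat \<Rightarrow> 'a \<Rightarrow> complex"
  where "conv_pow u t \<phi> k = (conv u t \<phi> ^^ (k - 1)) \<phi>"

definition weak_star_lim :: "(nat \<Rightarrow> 'a \<Rightarrow> complex) \<Rightarrow> 'a \<Rightarrow> complex"
  where "weak_star_lim X = (THE \<psi>. \<forall>a. (\<lambda>n. X n a) \<longlonglongrightarrow> \<psi> a)"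

definition cesaro_limit :: "('n::finite \<Rightarrow> 'n \<Rightarrow> 'a::cstar_algebra) \<Rightarrow> ('a \<Rightarrow> 'a \<Rightarrow> 'b::cstar_algebra) \<Rightarrow>
    ('a \<Rightarrow> complex) \<Rightarrow> 'a \<Rightarrow> complex"
  where "cesaro_limit u t \<phi> =
    weak_star_lim (\<lambda>n a. (1 / of_nat n) * (\<Sum>k=1..n. conv_pow u t \<phi> k a))"

definition quasi_subgroup :: "('n::finite \<Rightarrow> 'n \<Rightarrow> 'a::cstar_algebra) \<Rightarrow> ('a \<Rightarrow> 'a \<Rightarrow> 'b::cstar_algebra) \<Rightarrow>
    ('a \<Rightarrow> complex) \<Rightarrow> ('a \<Rightarrow> complex) set"
  where "quasi_subgroup u t \<phi> = {\<rho>. state \<rho> \<and> conv u t \<rho> \<phi> = \<phi> \<and> conv u t \<phi> \<rho> = \<phi>}"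

definition abelianisation :: "('n::finite \<Rightarrow> 'n \<Rightarrow> 'a::cstar_algebra) \<Rightarrow> 'a \<Rightarrow> 'n C_perm"
  where "abelianisation u = (THE \<pi>. star_hom \<pi> \<and>
    (\<forall>i j \<sigma>. apply_bcontfun (\<pi> (u i j)) \<sigma> = (if Perm.apply \<sigma> j = i then 1 else 0)))"

definition haar_classical :: "('n::finite \<Rightarrow> 'n \<Rightarrow> 'a::cstar_algebra) \<Rightarrow> 'a \<Rightarrow> complex"
  where "haar_classical u = uniform_state \<circ> abelianisation u"

definition random_permutations :: "('n::finite \<Rightarrow> 'n \<Rightarrow> 'a::cstar_algebra) \<Rightarrow> ('a \<Rightarrow> complex) set"
  where "random_permutations u = {\<rho>\<^sub>0 \<circ> abelianisation u | \<rho>\<^sub>0. state \<rho>\<^sub>0}"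

definition perm_eval :: "('n::finite \<Rightarrow> 'n \<Rightarrow> 'a::cstar_algebra) \<Rightarrow> 'n perm \<Rightarrow> 'a \<Rightarrow> complex"
  where "perm_eval u \<sigma> a = apply_bcontfun (abelianisation u a) \<sigma>"


section \<open>The bidual von Neumann algebra and support projections\<close>

definition dual :: "('a::cstar_algebra \<Rightarrow> complex) set"
  where "dual = {f. clinear f \<and> (\<exists>C. \<forall>a. cmod (f a) \<le> C * norm a)}"

text \<open>\<open>onorm f\<close> is the norm of \<open>f\<close> as a functional. Elements of the bidual are
  extended by \<open>0\<close> outside the dual, so that they are determined by their values on it.\<close>

definition bidual :: "(('a::cstar_algebra \<Rightarrow> complex) \<Rightarrow> complex) set"
  where "bidual = {F.
    (\<forall>f\<in>dual. \<forall>g\<in>dual. F (\<lambda>a. f a + g a) = F f + F g) \<and>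
    (\<forall>c. \<forall>f\<in>dual. F (\<lambda>a. c * f a) = c * F f) \<and>
    (\<exists>C. \<forall>f\<in>dual. cmod (F f) \<le> C * onorm f) \<and> (\<forall>f. f \<notin> dual \<longrightarrow> F f = 0)}"

text \<open>
  The product of the enveloping von Neumann algebra is the Arens product on the bidual (the two
  Arens products of a C*-algebra agree): \<open>(F G)(f) = F (G \<cdot> f)\<close>, where
  \<open>(G \<cdot> f)(a) = G (f \<cdot> a)\<close> and \<open>(f \<cdot> a)(b) = f (a b)\<close>.
\<close>

definition bidual_mult :: "(('a::cstar_algebra \<Rightarrow> complex) \<Rightarrow> complex) \<Rightarrow>
    (('a \<Rightarrow> complex) \<Rightarrow> complex) \<Rightarrow> ('a \<Rightarrow> complex) \<Rightarrow> complex"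
  where "bidual_mult F G f = (if f \<in> dual then F (\<lambda>a. G (\<lambda>b. f (a * b))) else 0)"

definition bidual_star :: "(('a::cstar_algebra \<Rightarrow> complex) \<Rightarrow> complex) \<Rightarrow> ('a \<Rightarrow> complex) \<Rightarrow> complex"
  where "bidual_star F f = (if f \<in> dual then cnj (F (\<lambda>a. cnj (f (star a)))) else 0)"

definition bidual_one :: "('a::cstar_algebra \<Rightarrow> complex) \<Rightarrow> complex"
  where "bidual_one f = (if f \<in> dual then f 1 else 0)"

definition bidual_projection :: "(('a::cstar_algebra \<Rightarrow> complex) \<Rightarrow> complex) \<Rightarrow> bool"
  where "bidual_projection p \<longleftrightarrow> p \<in> bidual \<and> bidual_mult p p = p \<and> bidual_star p = p"

definition projection_le :: "(('a::cstar_algebra \<Rightarrow> complex) \<Rightarrow> complex) \<Rightarrow>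
    (('a \<Rightarrow> complex) \<Rightarrow> complex) \<Rightarrow> bool"
  where "projection_le p q \<longleftrightarrow> bidual_mult p q = p \<and> bidual_mult q p = p"

text \<open>The predual of the bidual is the dual, so the normal (that is, weak-* continuous)
  extension of \<open>\<phi>\<close> is evaluation at \<open>\<phi>\<close>.\<close>

definition normal_extension :: "('a::cstar_algebra \<Rightarrow> complex) \<Rightarrow>
    (('a \<Rightarrow> complex) \<Rightarrow> complex) \<Rightarrow> complex"
  where "normal_extension \<phi> F = F \<phi>"

definition support_projection :: "('a::cstar_algebra \<Rightarrow> complex) \<Rightarrow> ('a \<Rightarrow> complex) \<Rightarrow> complex"
  where "support_projection \<phi> = (THE p.
    bidual_projection p \<and> normal_extension \<phi> p = 1 \<and>
    (\<forall>q. bidual_projection q \<and> normal_extension \<phi> q = 1 \<longrightarrow> projection_le p q))"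

definition classical_projection :: "('n::finite \<Rightarrow> 'n \<Rightarrow> 'a::cstar_algebra) \<Rightarrow> ('a \<Rightarrow> complex) \<Rightarrow> complex"
  where "classical_projection u f = (\<Sum>\<sigma>\<in>UNIV. support_projection (perm_eval u \<sigma>) f)"

definition quantum_projection :: "('n::finite \<Rightarrow> 'n \<Rightarrow> 'a::cstar_algebra) \<Rightarrow> ('a \<Rightarrow> complex) \<Rightarrow> complex"
  where "quantum_projection u f = bidual_one f - classical_projection u f"

definition genuinely_quantum :: "('n::finite \<Rightarrow> 'n \<Rightarrow> 'a::cstar_algebra) \<Rightarrow> ('a \<Rightarrow> complex) \<Rightarrow> bool"
  where "genuinely_quantum u \<phi> \<longleftrightarrow> 0 < Re (normal_extension \<phi> (quantum_projection u))"

end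

theory Submission
  imports Defs
begin

text \<open>
  A state is determined by its values on the words \<open>u i\<^sub>1 j\<^sub>1 \<cdots> u i\<^sub>m j\<^sub>m\<close>. For fixed length \<open>m\<close> these values form a
  matrix which is a contraction, and convolution of states is multiplication of these matrices. So
  the Cesaro means converge, and an idempotent state is given by orthogonal projections; hence
  for idempotent states absorption on one side implies absorption on the other. With
  \<open>\<psi> = lim (h \<star> \<phi>\<^sub>\<phi>)\<^sup>k\<close> in the mean this yields \<open>h \<star> \<psi> = \<psi> = \<psi> \<star> h\<close> and then
  \<open>\<phi> \<star> \<psi> = \<psi> = \<psi> \<star> \<phi>\<close>: the quasi-subgroup of \<open>\<psi>\<close> contains the random permutations, which absorb
  into \<open>h\<close>, and also \<open>\<phi>\<close> itself. A random permutation is a convex combination of the characters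
  \<open>ev\<^sub>\<sigma>\<close> and therefore gives mass \<open>1\<close> to \<open>p\<^sub>C\<close>; so \<open>\<phi>\<close>, being genuinely quantum, is not one.
\<close>

section \<open>Positive elements of a C*-algebra\<close>

text \<open>The comultiplication, product states, weak-* limits, the abelianisation and support
  projections are all definite descriptions, so existence and uniqueness come before any
  computation. For the algebraic ones this rests on automatic continuity: states and homomorphisms
  have to be shown contractive, and for that \<open>star x * x\<close> must be positive in an
  abstract C*-algebra. Positivity is therefore developed from norm inequalities and square roots
  alone. Support projections are the second obstacle: in the Arens bidual the two factors of a
  product are treated differently, so the candidate for \<open>ev_sigma\<close> must be a limit
  strong enough to be exchanged with an arbitrary bidual element. It is obtained from means of
  powers of the average of the projections \<open>u (sigma j) j\<close>. Finally,
  \<open>h \<star> phi_phi\<close> begins with \<open>h\<close> and ends with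
  \<open>phi_phi\<close>, so each factor is absorbed on one side only; exchanging the sides is what
  the projection property of the word matrices is for.\<close>

instance cstar_algebra \<subseteq> banach ..

lemma scaleC_zero_right [simp]: "scaleC c (0::'a::cstar_algebra) = 0"
  using scaleC_add_right[of c "0::'a" 0] by simp

lemma scaleC_zero_left [simp]: "scaleC 0 (x::'a::cstar_algebra) = 0"
  using scaleC_add_left[of 0 0 x] by simp

lemma scaleC_one [simp]: "scaleC 1 (x::'a::cstar_algebra) = x"
  using scaleC_of_real[of 1 x] by simp

lemma scaleC_minus_right: "scaleC c (- x) = - scaleC c (x::'a::cstar_algebra)"
  by (metis add.inverse_unique add.right_inverse scaleC_add_right scaleC_zero_right)

lemma scaleC_minus_left: "scaleC (- c) x = - scaleC c (x::'a::cstar_algebra)"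
  by (metis add.inverse_unique add.right_inverse scaleC_add_left scaleC_zero_left)

lemma scaleC_minus_one [simp]: "scaleC (-1) (x::'a::cstar_algebra) = - x"
  by (simp add: scaleC_minus_left)

lemma scaleC_diff_right: "scaleC c (x - y) = scaleC c x - scaleC c (y::'a::cstar_algebra)"
  by (metis diff_conv_add_uminus scaleC_add_right scaleC_minus_right)

lemma scaleC_sum: "scaleC c (\<Sum>i\<in>I. f i) = (\<Sum>i\<in>I. scaleC c (f i :: 'a::cstar_algebra))"
  by (induction I rule: infinite_finite_induct) (simp_all add: scaleC_add_right)

lemma scaleC_sum_left: "scaleC (\<Sum>i\<in>I. f i) x = (\<Sum>i\<in>I. scaleC (f i) (x :: 'a::cstar_algebra))"
  by (induction I rule: infinite_finite_induct) (simp_all add: scaleC_add_left)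

lemma star_zero [simp]: "star (0::'a::cstar_algebra) = 0"
  using star_add[of "0::'a" 0] by simp

lemma star_one [simp]: "star (1::'a::cstar_algebra) = 1"
  by (metis mult.left_neutral mult.right_neutral star_mult star_star)

lemma star_minus: "star (- x) = - star (x::'a::cstar_algebra)"
  by (metis scaleC_minus_one star_scaleC complex_cnj_minus complex_cnj_one)

lemma star_diff: "star (x - y) = star x - star (y::'a::cstar_algebra)"
  by (metis diff_conv_add_uminus star_add star_minus)

lemma star_scaleR: "star (r *\<^sub>R x) = r *\<^sub>R star (x::'a::cstar_algebra)"
  using star_scaleC[of "of_real r" x] by (simp add: scaleC_of_real)

lemma star_sum: "star (\<Sum>i\<in>I. f i) = (\<Sum>i\<in>I. star (f i :: 'a::cstar_algebra))"
  by (induction I rule: infinite_finite_induct) (simp_all add: star_add)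

lemma star_power: "star (x ^ n) = star (x::'a::cstar_algebra) ^ n"
  by (induction n) (simp_all add: star_mult power_commutes)

lemmas star_simps = star_star star_add star_minus star_diff star_scaleR star_scaleC star_mult star_sum star_power

lemma tendsto_star [tendsto_intros]:
  "(f \<longlongrightarrow> a) F \<Longrightarrow> ((\<lambda>x. star (f x :: 'a::cstar_algebra)) \<longlongrightarrow> star a) F"
  by (rule bounded_linear.tendsto[OF bounded_linear_star])

lemma tendsto_scaleC [tendsto_intros]:
  "(f \<longlongrightarrow> a) F \<Longrightarrow> ((\<lambda>x. scaleC c (f x :: 'a::cstar_algebra)) \<longlongrightarrow> scaleC c a) F"
  by (rule bounded_linear.tendsto[OF bounded_linear_scaleC])

lemma norm_square_selfadjoint: "star x = x \<Longrightarrow> norm (x * x) = (norm (x::'a::cstar_algebra))\<^sup>2"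
  using cstar_identity[of x] by simp

lemma cartesian_decomposition:
  fixes x :: "'a::cstar_algebra"
  obtains s t where "star s = s" "star t = t" "x = s + scaleC \<i> t"
proof
  let ?s = "scaleC (1/2) (x + star x)" and ?t = "scaleC (- \<i> / 2) (x - star x)"
  show "star ?s = ?s"
    by (simp add: star_simps add.commute)
  have "star ?t = scaleC (\<i> / 2) (star x - x)"
    by (simp add: star_simps)
  also have "\<dots> = scaleC (- (\<i> / 2)) (- (star x - x))"
    unfolding scaleC_minus_left scaleC_minus_right by simp
  also have "\<dots> = ?t" by simp
  finally show "star ?t = ?t" .
  have "?s + scaleC \<i> ?t = scaleC (1/2) ((x + star x) + (x - star x))"
    by (simp only: scaleC_scaleC scaleC_add_right[of "1/2" "x + star x"]) simp
  also have "\<dots> = scaleC (1/2 + 1/2) x"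
    unfolding scaleC_add_left scaleC_add_right[symmetric] by simp
  finally show "x = ?s + scaleC \<i> ?t" by simp
qed

text \<open>The increments of \<open>y \<mapsto> (s + y\<^sup>2) / 2\<close> are dominated by those of the scalar iteration with
  \<open>s = 1\<close>, which increases to \<open>1\<close>; so the iteration converges even if \<open>\<parallel>s\<parallel> = 1\<close>.\<close>

lemma sqrt_one_minus_exists:
  fixes s :: "'a::cstar_algebra"
  assumes s: "norm s \<le> 1" and sa: "star s = s"
  obtains z where "star z = z" "z * z = 1 - s" "norm (1 - z) \<le> 1" "\<And>x. x * s = s * x \<Longrightarrow> x * z = z * x"
proof -
  define t where "t n = ((\<lambda>t. (1 + t * t) / 2) ^^ n) (0::real)" for n
  define y where "y n = ((\<lambda>y. (1/2) *\<^sub>R (s + y * y)) ^^ n) 0" for n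
  have t0: "t 0 = 0" and tS: "t (Suc n) = (1 + t n * t n) / 2" for n by (simp_all add: t_def)
  have y0: "y 0 = 0" and yS: "y (Suc n) = (1/2) *\<^sub>R (s + y n * y n)" for n by (simp_all add: y_def)
  have t_bounds: "0 \<le> t n \<and> t n \<le> 1" for n
    by (induction n) (auto simp: t0 tS mult_le_one)
  have t_mono: "t n \<le> t (Suc n)" for n
    using zero_le_square[of "t n - 1"] by (simp add: tS algebra_simps)
  \<comment> \<open>Every \<open>y n\<close> is a polynomial in \<open>s\<close>; commutation lets
    the difference of squares factor below and passes to the limit \<open>l\<close>.\<close>
  have y_comm: "x * y n = y n * x" if "x * s = s * x" for x n
  proof (induction n)
    case (Suc n)
    have "x * (y n * y n) = y n * y n * x" by (metis Suc mult.assoc)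
    with that show ?case by (simp add: yS algebra_simps)
  qed (simp add: y0)
  have y_s: "y m * s = s * y m" for m using y_comm[of s m] by simp
  have yy: "y m * y n = y n * y m" for m n by (rule y_comm[OF y_s])
  have y_sa: "star (y n) = y n" for n
    by (induction n) (simp_all add: y0 yS star_simps sa)
  have y_norm: "norm (y n) \<le> t n" for n
  proof (induction n)
    case (Suc n)
    have "norm (s + y n * y n) \<le> 1 + t n * t n"
      by (intro norm_triangle_le add_mono s order_trans[OF norm_mult_ineq] mult_mono Suc)
         (use t_bounds in auto)
    then show ?case by (simp add: yS tS)
  qed (simp add: y0 t0)
  have y_incr: "norm (y (Suc n) - y n) \<le> t (Suc n) - t n" for n
  proof (induction n)
    case 0
    then show ?case using s by (simp add: y0 t0 yS tS)
  next
    case (Suc n)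
    have "y (Suc (Suc n)) - y (Suc n) = (1/2) *\<^sub>R (y (Suc n) * y (Suc n) - y n * y n)"
      unfolding yS[of "Suc n"] yS[of n] by (simp add: algebra_simps)
    also have "y (Suc n) * y (Suc n) - y n * y n = (y (Suc n) - y n) * (y (Suc n) + y n)"
      by (simp add: algebra_simps yy)
    finally have "norm (y (Suc (Suc n)) - y (Suc n)) \<le> (1/2) * (norm (y (Suc n) - y n) * norm (y (Suc n) + y n))"
      by (simp add: norm_mult_ineq)
    also have "\<dots> \<le> (1/2) * ((t (Suc n) - t n) * (t (Suc n) + t n))"
      using t_mono t_bounds
      by (intro mult_left_mono mult_mono Suc norm_triangle_le add_mono y_norm) auto
    also have "\<dots> = t (Suc (Suc n)) - t (Suc n)"
      unfolding tS[of "Suc n"] tS[of n] by (simp add: field_simps)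
    finally show ?case .
  qed
  have "convergent t"
    using t_bounds t_mono by (intro Bseq_mono_convergent BseqI'[of _ 1]) (auto intro: lift_Suc_mono_le)
  then have "summable (\<lambda>n. t (Suc n) - t n)"
    by (auto simp: convergent_def intro: telescope_summable)
  then have "summable (\<lambda>n. y (Suc n) - y n)"
    by (rule summable_comparison_test[rotated]) (use y_incr in auto)
  then obtain l where l: "(\<lambda>n. \<Sum>k<n. y (Suc k) - y k) \<longlonglongrightarrow> l"
    unfolding summable_def sums_def by blast
  then have l: "y \<longlonglongrightarrow> l" by (simp add: sum_lessThan_telescope y0)
  have "(\<lambda>n. y (Suc n)) \<longlonglongrightarrow> (1/2) *\<^sub>R (s + l * l)"
    unfolding yS by (intro tendsto_intros l)
  then have fix_l: "(1/2) *\<^sub>R (s + l * l) = l"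
    using LIMSEQ_unique LIMSEQ_Suc[OF l] by blast
  \<comment> \<open>The fixed point equation \<open>2 l = s + l\<^sup>2\<close> says
    \<open>(1 - l)\<^sup>2 = 1 - s\<close>, so the root is \<open>z = 1 - l\<close>.\<close>
  have "s + l * l = l + l"
    using arg_cong[OF fix_l, of "\<lambda>x. 2 *\<^sub>R x"] by (simp add: scaleR_2)
  then have l_sq: "(1 - l) * (1 - l) = 1 - s" by (simp add: algebra_simps)
  have l_sa: "star (1 - l) = 1 - l"
  proof -
    have "y \<longlonglongrightarrow> star l" using tendsto_star[OF l] by (simp add: y_sa)
    then show ?thesis using l LIMSEQ_unique by (auto simp: star_simps)
  qed
  have l_norm: "norm (1 - (1 - l)) \<le> 1"
    using Lim_bounded[OF tendsto_norm[OF l], of 0 1] order_trans[OF y_norm] t_bounds by simp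
  have l_comm: "x * (1 - l) = (1 - l) * x" if "x * s = s * x" for x
  proof -
    have "(\<lambda>n. x * y n) \<longlonglongrightarrow> x * l" "(\<lambda>n. y n * x) \<longlonglongrightarrow> l * x" by (intro tendsto_intros l)+
    then have "x * l = l * x" using y_comm[OF that] LIMSEQ_unique by auto
    then show ?thesis by (simp add: algebra_simps)
  qed
  from l_sa l_sq l_norm l_comm show ?thesis by (rule that)
qed

text \<open>For commuting self-adjoint \<open>x\<close>, \<open>w\<close> both
  \<open>x + \<i> w\<close> and \<open>x - \<i> w\<close> have norm square
  \<open>norm (x * x + w * w)\<close>, and \<open>x\<close> is half their sum. This gives
  monotonicity of the norm before any order is available.\<close>

lemma norm_square_le_sum_squares:
  fixes x w :: "'a::cstar_algebra"
  assumes "star x = x" "star w = w" "x * w = w * x"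
  shows "(norm x)\<^sup>2 \<le> norm (x * x + w * w)"
proof -
  have *: "(norm (x + scaleC c w))\<^sup>2 = norm (x * x + w * w)" if "c = \<i> \<or> c = - \<i>" for c
  proof -
    have c: "cnj c = - c" "- c * c = 1" using that by auto
    have "star (x + scaleC c w) * (x + scaleC c w) = (x + scaleC (- c) w) * (x + scaleC c w)"
      by (simp add: star_add star_scaleC assms c)
    also have "\<dots> = x * x + scaleC c (w * x) + scaleC (- c) (w * x) + scaleC (- c * c) (w * w)"
      by (simp add: distrib_left distrib_right scaleC_mult_left scaleC_mult_right scaleC_scaleC
          scaleC_add_right assms add.assoc)
    also have "\<dots> = x * x + w * w" unfolding c by (simp add: scaleC_minus_left)
    finally have E: "star (x + scaleC c w) * (x + scaleC c w) = x * x + w * w" .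
    show ?thesis by (rule trans[OF cstar_identity[symmetric] arg_cong[OF E, of norm]])
  qed
  have "2 *\<^sub>R x = (x + scaleC \<i> w) + (x + scaleC (- \<i>) w)"
    by (simp add: scaleR_2 scaleC_minus_left)
  then have "norm (2 *\<^sub>R x) \<le> norm (x + scaleC \<i> w) + norm (x + scaleC (- \<i>) w)"
    by (simp only: norm_triangle_ineq)
  then have "norm x \<le> sqrt (norm (x * x + w * w))"
    using real_sqrt_unique[OF *[of "\<i>"]] real_sqrt_unique[OF *[of "- \<i>"]]
    by (simp only: norm_scaleR norm_ge_zero simp_thms)
  then have "(norm x)\<^sup>2 \<le> (sqrt (norm (x * x + w * w)))\<^sup>2"
    by (rule power_mono) simp
  then show ?thesis by simp
qed

text \<open>The norm form of "spectrum in \<open>[0, 2 r]\<close>" for a self-adjoint element: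
  witnesses \<open>r\<close> add under sums, and \<open>1 - a / r\<close> is a contraction to which
  the square root iteration applies.\<close>

definition pos :: "'a::cstar_algebra \<Rightarrow> bool"
  where "pos a \<longleftrightarrow> star a = a \<and> (\<exists>r. norm (r *\<^sub>R 1 - a) \<le> r)"

lemma posI: "star a = a \<Longrightarrow> norm (r *\<^sub>R 1 - a) \<le> r \<Longrightarrow> pos a"
  by (auto simp: pos_def)

lemma pos_selfadjoint: "pos a \<Longrightarrow> star a = a"
  by (simp add: pos_def)

lemma pos_zero [simp]: "pos 0"
  by (rule posI[of _ 0]) auto

lemma pos_add: "pos a \<Longrightarrow> pos b \<Longrightarrow> pos (a + b)"
proof -
  assume "pos a" "pos b"
  then obtain r r' where *: "norm (r *\<^sub>R 1 - a) \<le> r" "norm (r' *\<^sub>R 1 - b) \<le> r'" "star a = a" "star b = b"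
    by (auto simp: pos_def)
  have "(r + r') *\<^sub>R 1 - (a + b) = (r *\<^sub>R 1 - a) + (r' *\<^sub>R 1 - b)" by (simp add: algebra_simps)
  then have "norm ((r + r') *\<^sub>R 1 - (a + b)) \<le> r + r'"
    using * by (metis add_mono norm_triangle_le)
  then show ?thesis using * by (intro posI) (auto simp: star_simps)
qed

lemma pos_sum: "(\<And>i. i \<in> I \<Longrightarrow> pos (f i)) \<Longrightarrow> pos (\<Sum>i\<in>I. f i)"
  by (induction I rule: infinite_finite_induct) (auto intro: pos_add)

lemma pos_scaleR: "pos a \<Longrightarrow> 0 \<le> c \<Longrightarrow> pos (c *\<^sub>R a)"
proof -
  assume "pos a" and c: "0 \<le> c"
  then obtain r where r: "norm (r *\<^sub>R 1 - a) \<le> r" "star a = a" by (auto simp: pos_def)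
  have "(c * r) *\<^sub>R 1 - c *\<^sub>R a = c *\<^sub>R (r *\<^sub>R 1 - a)" by (simp add: scaleR_diff_right)
  then have "norm ((c * r) *\<^sub>R 1 - c *\<^sub>R a) = c * norm (r *\<^sub>R 1 - a)" using c by simp
  then show ?thesis using r c by (intro posI[of _ "c * r"]) (auto simp: star_simps mult_left_mono)
qed

lemma pos_diff_of_norm_le: "star a = a \<Longrightarrow> norm a \<le> r \<Longrightarrow> pos (r *\<^sub>R 1 - a)"
  by (rule posI[of _ r]) (auto simp: star_simps)

text \<open>For a witness \<open>r > 0\<close>, \<open>s = 1 - a / r\<close> is a contraction, and a
  root \<open>z\<close> of \<open>1 - s = a / r\<close> is rescaled by \<open>sqrt r\<close>;
  \<open>norm (1 - z) \<le> 1\<close> makes it positive. The commutation clause ensures that roots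
  of commuting elements commute.\<close>

lemma pos_sqrt:
  fixes a :: "'a::cstar_algebra"
  assumes "pos a"
  obtains h where "star h = h" "h * h = a" "pos h" "\<And>x. x * a = a * x \<Longrightarrow> x * h = h * x"
proof -
  obtain r where r: "norm (r *\<^sub>R 1 - a) \<le> r" "star a = a" using assms by (auto simp: pos_def)
  have "r \<ge> 0" using r(1) by (meson norm_ge_zero order_trans)
  show ?thesis
  proof (cases "r = 0")
    case True
    then have "a = 0" using r by simp
    then show ?thesis using that[of 0] by simp
  next
    case False
    with \<open>r \<ge> 0\<close> have r0: "r > 0" by simp
    define s where "s = 1 - (1/r) *\<^sub>R a"
    have s_eq: "s = (1/r) *\<^sub>R (r *\<^sub>R 1 - a)" using r0 by (simp add: s_def algebra_simps)
    have "norm s \<le> 1" unfolding s_eq using r r0 by simp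
    moreover have "star s = s" by (simp add: s_def star_simps r)
    ultimately obtain z where z: "star z = z" "z * z = 1 - s" "norm (1 - z) \<le> 1" "\<And>x. x * s = s * x \<Longrightarrow> x * z = z * x"
      using sqrt_one_minus_exists by metis
    show ?thesis
    proof (rule that[of "sqrt r *\<^sub>R z"])
      show "star (sqrt r *\<^sub>R z) = sqrt r *\<^sub>R z" by (simp add: star_simps z(1))
      show "(sqrt r *\<^sub>R z) * (sqrt r *\<^sub>R z) = a"
        using r0 z(2) by (simp add: s_def)
      show "pos (sqrt r *\<^sub>R z)"
        using r0 z(1,3) by (intro pos_scaleR posI[of z 1]) auto
      show "x * (sqrt r *\<^sub>R z) = sqrt r *\<^sub>R z * x" if "x * a = a * x" for x
        using z(4)[of x] that by (simp add: s_def algebra_simps)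
    qed
  qed
qed

text \<open>After scaling to \<open>norm y \<le> 1\<close>, take \<open>z\<close> with
  \<open>z * z = 1 - y * y\<close>. Then
  \<open>(norm z)\<^sup>2 \<le> norm (z * z + y * y) = 1\<close>, so
  \<open>1 - y * y = z * z\<close> has norm at most 1 and \<open>r = 1\<close> is a witness.\<close>

lemma pos_square:
  fixes x :: "'a::cstar_algebra"
  assumes sa: "star x = x"
  shows "pos (x * x)"
proof -
  define r where "r = norm x + 1"
  have r: "r > 0" "norm x < r" by (auto simp: r_def add_nonneg_pos)
  define y where "y = (1/r) *\<^sub>R x"
  have y: "star y = y" using sa by (simp add: y_def star_simps)
  have "norm y \<le> 1" using r by (simp add: y_def field_simps)
  then have "norm (y * y) \<le> 1" using y by (simp add: norm_square_selfadjoint power_le_one)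
  then obtain z where z: "star z = z" "z * z = 1 - y * y" "\<And>x. x * (y * y) = y * y * x \<Longrightarrow> x * z = z * x"
    using sqrt_one_minus_exists[of "y * y"] y by (metis star_mult)
  have "z * y = y * z" using z(3)[of y] by (simp add: mult.assoc)
  then have "(norm z)\<^sup>2 \<le> norm (z * z + y * y)" by (rule norm_square_le_sum_squares[OF z(1) y])
  moreover have "z * z + y * y = 1" using z(2) by simp
  ultimately have "norm (z * z) \<le> 1" using norm_square_selfadjoint[OF z(1)] by simp
  then have "norm (1 *\<^sub>R 1 - y * y) \<le> 1" using z(2) by simp
  then have "pos (y * y)" by (intro posI[of _ 1]) (auto simp: star_simps y)
  then have "pos ((r * r) *\<^sub>R (y * y))" using r by (intro pos_scaleR) auto
  then show ?thesis using r by (simp add: y_def)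
qed

text \<open>The commutation clause of \<open>pos_sqrt\<close>, used twice, makes the roots
  \<open>h\<close>, \<open>k\<close> of \<open>a\<close>, \<open>b\<close> commute, and
  \<open>norm_square_le_sum_squares\<close> applies to them.\<close>

lemma norm_le_add_commuting:
  fixes a b :: "'a::cstar_algebra"
  assumes "pos a" "pos b" "a * b = b * a"
  shows "norm a \<le> norm (a + b)"
proof -
  obtain h where h: "star h = h" "h * h = a" "pos h" "\<And>x. x * a = a * x \<Longrightarrow> x * h = h * x"
    using pos_sqrt[OF assms(1)] by blast
  obtain k where k: "star k = k" "k * k = b" "pos k" "\<And>x. x * b = b * x \<Longrightarrow> x * k = k * x"
    using pos_sqrt[OF assms(2)] by blast
  have "h * b = b * h" using h(4)[of b] assms(3) by simp
  then have "h * k = k * h" by (rule k(4))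
  then have "(norm h)\<^sup>2 \<le> norm (h * h + k * k)" by (rule norm_square_le_sum_squares[OF h(1) k(1)])
  then show ?thesis using norm_square_selfadjoint[OF h(1)] h(2) k(2) by simp
qed

lemma norm_le_of_pos_diff:
  fixes a :: "'a::cstar_algebra"
  assumes "pos a" "pos (r *\<^sub>R 1 - a)" "0 \<le> r"
  shows "norm a \<le> r"
  using norm_le_add_commuting[OF assms(1,2)] assms(3) by (simp add: algebra_simps)

text \<open>The comparison goes through the scalar \<open>norm (a + b)\<close>, which commutes with
  everything: \<open>norm (a + b) - a\<close> is the sum of the positive elements
  \<open>norm (a + b) - (a + b)\<close> and \<open>b\<close>.\<close>

lemma norm_pos_mono:
  fixes a b :: "'a::cstar_algebra"
  assumes "pos a" "pos b"
  shows "norm a \<le> norm (a + b)"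
proof (rule norm_le_of_pos_diff[OF assms(1)])
  have "pos (norm (a + b) *\<^sub>R 1 - (a + b))"
    using assms by (intro pos_diff_of_norm_le) (auto simp: star_simps pos_selfadjoint)
  then have "pos (norm (a + b) *\<^sub>R 1 - (a + b) + b)" by (rule pos_add[OF _ assms(2)])
  then show "pos (norm (a + b) *\<^sub>R 1 - a)" by (simp add: algebra_simps)
qed simp

text \<open>The exact value is required because the completed square in the next lemma is estimated
  from below.\<close>

lemma norm_add_scalar_pos:
  fixes a :: "'a::cstar_algebra"
  assumes "pos a" "0 \<le> r"
  shows "norm (a + r *\<^sub>R 1) = norm a + r"
proof (rule antisym)
  show "norm (a + r *\<^sub>R 1) \<le> norm a + r"
    using assms norm_triangle_ineq[of a "r *\<^sub>R 1"] by simp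
  let ?m = "norm (a + r *\<^sub>R 1)"
  have "pos (r *\<^sub>R (1::'a))" using assms by (intro posI[of _ r]) (auto simp: star_simps)
  then have "r \<le> ?m" using norm_pos_mono[of "r *\<^sub>R (1::'a)" a] assms by (simp add: add.commute)
  have "pos (?m *\<^sub>R 1 - (a + r *\<^sub>R 1))"
    using assms by (intro pos_diff_of_norm_le) (auto simp: star_simps pos_selfadjoint)
  then have "pos ((?m - r) *\<^sub>R 1 - a)" by (simp add: algebra_simps)
  then show "norm a + r \<le> ?m"
    using norm_le_of_pos_diff[OF assms(1), of "?m - r"] \<open>r \<le> ?m\<close> by simp
qed

text \<open>With \<open>y = s + i t\<close> one has \<open>y y\<^sup>* = 2 s\<^sup>2 + 2 t\<^sup>2 + g\<^sup>2\<close>, so \<open>y y\<^sup>*\<close> is positive; then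
  \<open>(r - y y\<^sup>*) y = y (r + g\<^sup>2)\<close> contradicts \<open>\<parallel>r - y y\<^sup>*\<parallel> \<le> r\<close> unless \<open>g = 0\<close>.\<close>

lemma star_mult_self_not_negative:
  fixes y g :: "'a::cstar_algebra"
  assumes g: "star g = g" and y: "star y * y = - (g * g)"
  shows "y = 0"
proof -
  obtain s t where st: "star s = s" "star t = t" "y = s + scaleC \<i> t"
    by (rule cartesian_decomposition)
  define G P where "G = g * g" and "P = y * star y"
  have "star y * y + y * star y = 2 *\<^sub>R (s * s) + 2 *\<^sub>R (t * t)"
    unfolding st(3) by (simp add: star_add star_scaleC st(1,2) algebra_simps scaleC_mult_left
        scaleC_mult_right scaleC_scaleC scaleC_minus_left scaleC_add_right scaleC_diff_right scaleR_2)
  then have "P = 2 *\<^sub>R (s * s) + 2 *\<^sub>R (t * t) + g * g"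
    unfolding y P_def by (simp add: algebra_simps)
  then have "pos P" using st(1,2) g by (simp add: pos_add pos_scaleR pos_square)
  then obtain r0 where r0: "norm (r0 *\<^sub>R 1 - P) \<le> r0" by (auto simp: pos_def)
  \<comment> \<open>Raising a witness keeps it a witness; the summand 1 makes \<open>r\<close>
    strictly positive, so that \<open>2 * r\<close> can be divided out.\<close>
  define r where "r = r0 + 1"
  have r: "r > 0" unfolding r_def using r0 norm_ge_zero[of "r0 *\<^sub>R 1 - P"] by linarith
  have r_shift: "r *\<^sub>R 1 - P = (r0 *\<^sub>R 1 - P) + 1" by (simp add: r_def algebra_simps)
  have rP: "norm (r *\<^sub>R 1 - P) \<le> r"
    unfolding r_shift using r0 by (intro norm_triangle_le) (simp add: r_def)
  have G: "star G = G" "pos G" using g by (auto simp: G_def star_simps pos_square)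
  have yG: "(norm y)\<^sup>2 = norm G" using cstar_identity[of y] y by (simp add: G_def)
  \<comment> \<open>\<open>- W\<close> is \<open>star v * v\<close> for
    \<open>v = y * (r + G)\<close>. The cubic term in \<open>G\<close> is written as the square of
    \<open>g * G\<close> so that \<open>pos_square\<close> applies to it.\<close>
  define W where "W = r\<^sup>2 *\<^sub>R G + (2 * r) *\<^sub>R (G * G) + (g * G) * (g * G)"
  have gG: "star (g * G) = g * G" by (simp add: G_def star_simps g mult.assoc)
  have "star y * (y * z) = - (G * z)" for z using y by (simp add: G_def flip: mult.assoc)
  then have "star (y * (r *\<^sub>R 1 + G)) * (y * (r *\<^sub>R 1 + G)) = - W"
    by (simp add: W_def star_simps G y algebra_simps power2_eq_square scaleR_2 flip: scaleR_scaleR)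
      (simp add: G_def algebra_simps)
  then have W_norm: "norm W = (norm (y * (r *\<^sub>R 1 + G)))\<^sup>2"
    using cstar_identity[of "y * (r *\<^sub>R 1 + G)"] by simp
  have "y * (r *\<^sub>R 1 + G) = (r *\<^sub>R 1 - P) * y"
    by (simp add: P_def algebra_simps y G_def)
  then have "norm (y * (r *\<^sub>R 1 + G)) \<le> r * norm y"
    using order_trans[OF norm_mult_ineq mult_right_mono[OF rP norm_ge_zero], of y] by simp
  then have "norm W \<le> (r * norm y)\<^sup>2" unfolding W_norm by (rule power_mono) simp
  then have W_le: "norm W \<le> r\<^sup>2 * norm G" by (simp add: power_mult_distrib yG)
  have "star W = W" by (simp add: W_def star_simps G gG[unfolded star_mult g G] g mult.assoc)
  then have "pos ((r\<^sup>2 * norm G) *\<^sub>R 1 - W)" using W_le by (rule pos_diff_of_norm_le)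
  then have "pos ((r\<^sup>2 * norm G) *\<^sub>R 1 - W + (g * G) * (g * G))"
    by (rule pos_add) (rule pos_square[OF gG])
  then have "pos ((1 / (2 * r)) *\<^sub>R ((r\<^sup>2 * norm G) *\<^sub>R 1 - W + (g * G) * (g * G)))"
    using r by (intro pos_scaleR) auto
  also have "(1 / (2 * r)) *\<^sub>R ((r\<^sup>2 * norm G) *\<^sub>R 1 - W + (g * G) * (g * G))
      = (r * norm G / 2) *\<^sub>R 1 - (r / 2) *\<^sub>R G - G * G"
    using r by (simp add: W_def algebra_simps power2_eq_square)
  \<comment> \<open>Completing the square with \<open>r / 4\<close> leads to \<open>(norm G + r /
    4)\<^sup>2 \<le> r * norm G / 2 + (r / 4)\<^sup>2\<close>, where everything but
    \<open>(norm G)\<^sup>2 \<le> 0\<close> cancels.\<close>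
  also have "\<dots> = (r * norm G / 2 + (r / 4)\<^sup>2) *\<^sub>R 1 - (G + (r/4) *\<^sub>R 1) * (G + (r/4) *\<^sub>R 1)"
    by (simp add: algebra_simps power2_eq_square flip: scaleR_2[of "(r/4) *\<^sub>R G"])
  finally have "norm ((G + (r/4) *\<^sub>R 1) * (G + (r/4) *\<^sub>R 1)) \<le> r * norm G / 2 + (r / 4)\<^sup>2"
    using r G by (intro norm_le_of_pos_diff pos_square) (auto simp: star_simps)
  also have "norm ((G + (r/4) *\<^sub>R 1) * (G + (r/4) *\<^sub>R 1)) = (norm G + r / 4)\<^sup>2"
    using r G by (simp add: norm_square_selfadjoint norm_add_scalar_pos star_simps)
  finally have "(norm G)\<^sup>2 \<le> 0" by (simp add: power2_eq_square algebra_simps)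
  then show ?thesis using yG by simp
qed

text \<open>Let \<open>b\<close>, the root of \<open>a * a\<close>, be the absolute value of
  \<open>a = star x * x\<close>, and \<open>c = b - a\<close> twice the negative part. From
  \<open>(a + b) * c = 0\<close> one gets \<open>star (x * c) * (x * c) = - b * c * c\<close>, minus
  the square of a self-adjoint element. The preceding lemma forces \<open>x * c = 0\<close>, hence
  \<open>c = 0\<close> and \<open>a = b\<close>.\<close>

theorem pos_star_mult_self: "pos (star x * (x::'a::cstar_algebra))"
proof -
  define a where "a = star x * x"
  have a: "star a = a" by (simp add: a_def star_simps)
  obtain b where b: "star b = b" "b * b = a * a" "pos b" "\<And>x. x * (a * a) = (a * a) * x \<Longrightarrow> x * b = b * x"
    using pos_sqrt[OF pos_square[OF a]] by metis
  have ab: "a * b = b * a" by (rule b(4)) (simp add: mult.assoc)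
  obtain k where k: "star k = k" "k * k = b" "\<And>x. x * b = b * x \<Longrightarrow> x * k = k * x"
    using pos_sqrt[OF b(3)] by metis
  have ak: "a * k = k * a" by (rule k(3)[OF ab])
  have bk: "b * k = k * b" by (rule k(3)) simp
  define c where "c = b - a"
  have c: "star c = c" by (simp add: c_def star_simps a b(1))
  have ck: "c * k = k * c" by (simp add: c_def ak bk algebra_simps)
  have cc: "c * c = 2 *\<^sub>R (b * b - b * a)"
    by (simp add: c_def algebra_simps ab b(2) scaleR_2)
  have ac: "a * c = c * a" by (simp add: c_def algebra_simps ab)
  have aba: "a * (b * a) = b * (b * b)" by (metis ab b(2) mult.assoc)
  have bba: "b * (b * a) = a * (b * b)" by (metis ab mult.assoc)
  have "star (x * c) * (x * c) = c * a * c" by (simp add: star_simps c a_def mult.assoc)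
  also have "\<dots> = a * (c * c)" by (metis ac mult.assoc)
  also have "\<dots> = 2 *\<^sub>R (a * (b * b) - b * (b * b))"
    by (simp add: cc right_diff_distrib aba)
  also have "\<dots> = - (b * (c * c))"
    by (simp add: cc right_diff_distrib bba flip: scaleR_minus_right)
  also have "b * (c * c) = (k * c) * (k * c)"
    by (metis ck k(2) mult.assoc)
  finally have "x * c = 0"
    by (rule star_mult_self_not_negative[rotated]) (simp add: star_simps c k(1) ck)
  then have "a * c = 0" by (simp add: a_def mult.assoc)
  then have "b * a = b * b" by (simp add: c_def algebra_simps ab b(2))
  then have "c * c = 0" by (simp add: cc)
  then have "c = 0" using norm_square_selfadjoint[OF c] by simp
  then have "b = a" by (simp add: c_def)
  with b(3) show ?thesis by (simp add: a_def)
qed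

lemma norm_star_mult_le_sum:
  fixes x :: "'i \<Rightarrow> 'a::cstar_algebra"
  assumes "finite I" "i \<in> I"
  shows "(norm (x i))\<^sup>2 \<le> norm (\<Sum>i\<in>I. star (x i) * x i)"
proof -
  have "norm (star (x i) * x i) \<le> norm (star (x i) * x i + (\<Sum>j\<in>I - {i}. star (x j) * x j))"
    by (intro norm_pos_mono pos_sum pos_star_mult_self)
  then show ?thesis using assms by (simp add: cstar_identity sum.remove)
qed

lemma sum_star_mult_eq_zero:
  fixes x :: "'i \<Rightarrow> 'a::cstar_algebra"
  assumes "finite I" "(\<Sum>i\<in>I. star (x i) * x i) = 0" "i \<in> I"
  shows "x i = 0"
  using norm_star_mult_le_sum[of I i x] assms by simp

text \<open>The form in which norm bounds enter below: whatever is nonnegative on elements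
  \<open>star d * d\<close> is bounded on \<open>star x * x\<close> by
  \<open>(norm x)\<^sup>2\<close> times its value at 1. States, homomorphisms and tensor forms are
  estimated this way.\<close>

lemma star_mult_complement:
  fixes x :: "'a::cstar_algebra"
  obtains d where "star d * d = (norm x)\<^sup>2 *\<^sub>R 1 - star x * x"
proof -
  have "pos ((norm x)\<^sup>2 *\<^sub>R 1 - star x * x)"
    by (rule pos_diff_of_norm_le) (auto simp: star_simps cstar_identity)
  then obtain h where "star h = h" "h * h = (norm x)\<^sup>2 *\<^sub>R 1 - star x * x"
    using pos_sqrt by metis
  then show ?thesis using that[of h] by simp
qed

section \<open>States and *-homomorphisms\<close>

lemma
  assumes "state f"
  shows state_nonneg: "f (star x * x) \<in> \<real>\<^sub>\<ge>\<^sub>0"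
    and state_one: "f 1 = 1"
  using assms by (auto simp: state_def clinear_def)

lemma
  assumes "clinear f"
  shows clinear_add: "f (x + y) = f x + f y"
    and clinear_scaleC: "f (scaleC c x) = c * f x"
    and clinear_zero: "f 0 = 0"
    and clinear_minus: "f (- x) = - f x"
    and clinear_diff: "f (x - y) = f x - f y"
    and clinear_scaleR: "f (r *\<^sub>R x) = of_real r * f x"
    and clinear_sum: "f (\<Sum>i\<in>I. g i) = (\<Sum>i\<in>I. f (g i))"
proof -
  show add: "f (x + y) = f x + f y" for x y using assms by (simp add: clinear_def)
  show sc: "f (scaleC c x) = c * f x" for c x using assms by (simp add: clinear_def)
  show zero: "f 0 = 0" using sc[of 0 0] by simp
  show minus: "f (- x) = - f x" for x using sc[of "-1" x] by simp
  show "f (x - y) = f x - f y" using add[of x "- y"] minus by simp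
  show "f (r *\<^sub>R x) = of_real r * f x" using sc[of "of_real r" x] by (simp add: scaleC_of_real)
  show "f (\<Sum>i\<in>I. g i) = (\<Sum>i\<in>I. f (g i))"
    by (induction I rule: infinite_finite_induct) (simp_all add: zero add)
qed

lemma state_clinear: "state f \<Longrightarrow> clinear f"
  by (simp add: state_def)

lemmas state_linear = clinear_add[OF state_clinear] clinear_scaleC[OF state_clinear]
  clinear_zero[OF state_clinear] clinear_minus[OF state_clinear] clinear_diff[OF state_clinear]
  clinear_sum[OF state_clinear]

text \<open>\<open>f\<close> is real on \<open>star (x + c) * (x + c)\<close> for every scalar
  \<open>c\<close>; \<open>c = 1\<close> compares the imaginary parts and \<open>c = \<i>\<close>
  the real parts.\<close>

lemma state_star:
  assumes f: "state f"
  shows "f (star x) = cnj (f x)"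
proof -
  have *: "Im (c * f (star x) + cnj c * f x) = 0" for c
  proof -
    have e: "star (x + scaleC c 1) * (x + scaleC c 1)
        = star x * x + (scaleC c (star x) + scaleC (cnj c) x) + scaleC (cnj c * c) 1"
      by (simp add: star_add star_scaleC algebra_simps scaleC_mult_left scaleC_mult_right scaleC_scaleC scaleC_add_right)
    have "f (star (x + scaleC c 1) * (x + scaleC c 1))
        = f (star x * x) + (c * f (star x) + cnj c * f x) + cnj c * c"
      unfolding e by (simp add: state_linear[OF f] state_one[OF f])
    moreover have "Im (f (star (x + scaleC c 1) * (x + scaleC c 1))) = 0" "Im (f (star x * x)) = 0"
      using state_nonneg[OF f] by (auto simp: complex_nonneg_Reals_iff)
    ultimately show ?thesis by simp
  qed
  show ?thesis using *[of 1] *[of "\<i>"] by (auto simp: complex_eq_iff)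
qed

lemma state_star_mult: "state f \<Longrightarrow> f (star x * y) = cnj (f (star y * x))"
  using state_star[of f "star y * x"] by (simp add: star_simps)

text \<open>Positivity of \<open>f\<close> at \<open>y - t q x\<close>. The factor \<open>q\<close>
  absorbs the phase, so a real parameter suffices: \<open>x = 1\<close>, \<open>t = 1\<close> is
  Cauchy-Schwarz against the unit, and large \<open>t\<close> treats null vectors.\<close>

lemma state_quadratic:
  fixes x y :: "'a::cstar_algebra"
  assumes f: "state f"
  defines "q \<equiv> f (star x * y)"
  shows "0 \<le> Re (f (star y * y)) - 2 * t * (cmod q)\<^sup>2 + t\<^sup>2 * (cmod q)\<^sup>2 * Re (f (star x * x))"
proof -
  let ?c = "of_real t * q"
  have qq: "q * cnj q = of_real ((cmod q)\<^sup>2)" by (rule complex_norm_square[symmetric])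
  have e: "star (y - scaleC ?c x) * (y - scaleC ?c x)
      = star y * y - scaleC ?c (star y * x) - scaleC (cnj ?c) (star x * y) + scaleC (cnj ?c * ?c) (star x * x)"
    by (simp add: star_diff star_scaleC algebra_simps scaleC_mult_left scaleC_mult_right scaleC_scaleC scaleC_diff_right)
  have "f (star (y - scaleC ?c x) * (y - scaleC ?c x))
      = f (star y * y) - of_real (2 * t) * (q * cnj q) + of_real (t\<^sup>2) * (q * cnj q) * f (star x * x)"
    unfolding e by (simp add: state_linear[OF f] q_def state_star_mult[OF f, of y x] power2_eq_square)
  then have "Re (f (star (y - scaleC ?c x) * (y - scaleC ?c x)))
      = Re (f (star y * y)) - 2 * t * (cmod q)\<^sup>2 + t\<^sup>2 * (cmod q)\<^sup>2 * Re (f (star x * x))"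
    unfolding qq by (simp flip: of_real_mult of_real_power)
  moreover have "0 \<le> Re (f (star (y - scaleC ?c x) * (y - scaleC ?c x)))"
    using state_nonneg[OF f] by (auto simp: complex_nonneg_Reals_iff)
  ultimately show ?thesis by simp
qed

text \<open>With \<open>f (star x * x) = 0\<close> the quadratic is affine in \<open>t\<close> with
  slope \<open>- 2 (cmod q)\<^sup>2\<close>, which rules out \<open>q \<noteq> 0\<close>. This
  handles a vanishing pivot in the Schur product argument.\<close>

lemma state_null:
  assumes f: "state f" and "f (star x * x) = 0"
  shows "f (star x * y) = 0" "f (star y * x) = 0"
proof -
  show *: "f (star x * y) = 0"
  proof (rule ccontr)
    let ?q = "(cmod (f (star x * y)))\<^sup>2"
    assume "f (star x * y) \<noteq> 0"
    then have q: "?q > 0" by simp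
    have "0 \<le> Re (f (star y * y)) - 2 * ((Re (f (star y * y)) + 1) / ?q) * ?q"
      using state_quadratic[OF f, where x = x and y = y and t = "(Re (f (star y * y)) + 1) / ?q"] assms(2) by simp
    also have "\<dots> = - Re (f (star y * y)) - 2" using q by (simp add: field_simps)
    finally show False using state_nonneg[OF f, of y] by (auto simp: complex_nonneg_Reals_iff)
  qed
  then show "f (star y * x) = 0" using state_star_mult[OF f, of y x] by simp
qed

lemma state_cauchy_schwarz: "state f \<Longrightarrow> (cmod (f x))\<^sup>2 \<le> Re (f (star x * x))"
  using state_quadratic[of f, where x = 1 and y = x and t = 1] by (simp add: state_one)

lemma state_norm_le:
  assumes f: "state f"
  shows "cmod (f x) \<le> norm x"
proof -
  obtain d where d: "star d * d = (norm x)\<^sup>2 *\<^sub>R 1 - star x * x" by (rule star_mult_complement)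
  have "0 \<le> Re (f ((norm x)\<^sup>2 *\<^sub>R 1 - star x * x))"
    using state_nonneg[OF f, of d] unfolding d by (auto simp: complex_nonneg_Reals_iff)
  then have "Re (f (star x * x)) \<le> (norm x)\<^sup>2"
    by (simp add: clinear_diff[OF state_clinear[OF f]] clinear_scaleR[OF state_clinear[OF f]] state_one[OF f]
        flip: of_real_power)
  then have "(cmod (f x))\<^sup>2 \<le> (norm x)\<^sup>2" using state_cauchy_schwarz[OF f, of x] by linarith
  then show ?thesis by (rule power2_le_imp_le) simp
qed

lemma state_dist_le: "state f \<Longrightarrow> cmod (f x - f y) \<le> norm (x - y)"
  using state_norm_le[of f "x - y"] by (simp add: state_linear)

lemma bounded_clinear_continuous:
  assumes f: "clinear f" and "\<And>x. cmod (f x) \<le> C * norm x"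
  shows "bounded_linear f"
proof
  show "f (x + y) = f x + f y" for x y by (rule clinear_add[OF f])
  show "f (r *\<^sub>R x) = r *\<^sub>R f x" for r x
    by (simp add: clinear_scaleR[OF f] scaleR_conv_of_real[where 'a = complex])
  show "\<exists>K. \<forall>x. norm (f x) \<le> norm x * K" using assms(2) by (metis mult.commute)
qed

lemma state_bounded_linear: "state f \<Longrightarrow> bounded_linear f"
  using bounded_clinear_continuous[of f 1] by (simp add: state_norm_le state_clinear)

lemma
  assumes "star_hom h"
  shows star_hom_add: "h (x + y) = h x + h y"
    and star_hom_scaleC: "h (scaleC c x) = scaleC c (h x)"
    and star_hom_mult: "h (x * y) = h x * h y"
    and star_hom_star: "h (star x) = star (h x)"
    and star_hom_one: "h 1 = 1"
    and star_hom_zero: "h 0 = 0"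
    and star_hom_diff: "h (x - y) = h x - h y"
    and star_hom_scaleR: "h (r *\<^sub>R x) = r *\<^sub>R h x"
    and star_hom_sum: "h (\<Sum>i\<in>I. g i) = (\<Sum>i\<in>I. h (g i))"
    and star_hom_prod_list: "h (prod_list xs) = prod_list (map h xs)"
proof -
  show add: "h (x + y) = h x + h y" for x y using assms by (simp add: star_hom_def)
  show sc: "h (scaleC c x) = scaleC c (h x)" for c x using assms by (simp add: star_hom_def)
  show mult: "h (x * y) = h x * h y" for x y using assms by (simp add: star_hom_def)
  show "h (star x) = star (h x)" using assms by (simp add: star_hom_def)
  show one: "h 1 = 1" using assms by (simp add: star_hom_def)
  show zero: "h 0 = 0" using sc[of 0 0] by simp
  have minus: "h (- x) = - h x" for x using sc[of "-1" x] by simp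
  show "h (x - y) = h x - h y" using add[of x "- y"] minus by simp
  show "h (r *\<^sub>R x) = r *\<^sub>R h x" using sc[of "of_real r" x] by (simp add: scaleC_of_real)
  show "h (\<Sum>i\<in>I. g i) = (\<Sum>i\<in>I. h (g i))"
    by (induction I rule: infinite_finite_induct) (simp_all add: zero add)
  show "h (prod_list xs) = prod_list (map h xs)"
    by (induction xs) (simp_all add: one mult)
qed

lemma star_hom_norm_le:
  assumes h: "star_hom h"
  shows "norm (h x) \<le> norm x"
proof -
  obtain d where d: "star d * d = (norm x)\<^sup>2 *\<^sub>R 1 - star x * x" by (rule star_mult_complement)
  have "(norm x)\<^sup>2 *\<^sub>R 1 - star (h x) * h x = h ((norm x)\<^sup>2 *\<^sub>R 1 - star x * x)"
    by (simp add: star_hom_diff[OF h] star_hom_scaleR[OF h] star_hom_one[OF h] star_hom_mult[OF h] star_hom_star[OF h])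
  also have "\<dots> = star (h d) * h d"
    unfolding d[symmetric] by (simp add: star_hom_mult[OF h] star_hom_star[OF h])
  finally have "norm (star (h x) * h x) \<le> (norm x)\<^sup>2"
    by (intro norm_le_of_pos_diff) (simp_all add: pos_star_mult_self)
  then have "(norm (h x))\<^sup>2 \<le> (norm x)\<^sup>2" by (simp only: cstar_identity)
  then show ?thesis by (rule power2_le_imp_le) simp
qed

lemma star_hom_bounded_linear:
  assumes h: "star_hom h"
  shows "bounded_linear h"
proof
  show "h (x + y) = h x + h y" for x y by (rule star_hom_add[OF h])
  show "h (r *\<^sub>R x) = r *\<^sub>R h x" for r x by (rule star_hom_scaleR[OF h])
  show "\<exists>K. \<forall>x. norm (h x) \<le> norm x * K"
    using star_hom_norm_le[OF h] by (intro exI[of _ 1]) simp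
qed

lemma state_comp_star_hom:
  assumes "state f" "star_hom h"
  shows "state (f \<circ> h)"
  unfolding state_def clinear_def comp_def
  using state_nonneg[OF assms(1)]
  by (auto simp: star_hom_add[OF assms(2)] star_hom_scaleC[OF assms(2)] star_hom_mult[OF assms(2)]
      star_hom_star[OF assms(2)] star_hom_one[OF assms(2)] state_linear[OF assms(1)] state_one[OF assms(1)])

section \<open>Product states on the minimal tensor product\<close>

text \<open>The Schur product theorem for Gram matrices; the induction eliminates the last vector \<open>a n\<close>.\<close>

lemma state_schur_product:
  fixes a :: "nat \<Rightarrow> 'a::cstar_algebra" and b :: "nat \<Rightarrow> 'b::cstar_algebra"
  assumes \<alpha>: "state \<alpha>" and \<beta>: "state \<beta>"
  shows "(\<Sum>i<n. \<Sum>j<n. \<alpha> (star (a i) * a j) * \<beta> (star (b i) * b j)) \<in> \<real>\<^sub>\<ge>\<^sub>0"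
proof (induction n arbitrary: a)
  case (Suc n)
  define p where "p = \<alpha> (star (a n) * a n)"
  have p: "p \<in> \<real>\<^sub>\<ge>\<^sub>0" unfolding p_def by (rule state_nonneg[OF \<alpha>])
  show ?case
  proof (cases "p = 0")
    case True
    then show ?thesis
      using Suc[of a] by (simp add: state_null[OF \<alpha> True[unfolded p_def]])
  next
    case False
    \<comment> \<open>\<open>c i\<close> is the coefficient of the projection of \<open>a i\<close>
      onto \<open>a n\<close>, and \<open>a' i\<close> is the orthogonal remainder. The Gram matrix
      splits into that of \<open>a'\<close>, whose last row and column vanish, and a rank one part
      contributing \<open>p * \<beta> (star z * z)\<close>.\<close>
    define c where "c i = \<alpha> (star (a n) * a i) / p" for i
    define a' where "a' i = a i - scaleC (c i) (a n)" for i
    have cn: "c n = 1" using False by (simp add: c_def p_def)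
    then have a'n: "a' n = 0" by (simp add: a'_def)
    have cp: "cnj p = p" using p by (auto simp: complex_nonneg_Reals_iff complex_eq_iff)
    have x1: "\<alpha> (star (a n) * a i) = c i * p" for i using False by (simp add: c_def)
    have x2: "\<alpha> (star (a i) * a n) = cnj (c i) * p" for i
      using state_star_mult[OF \<alpha>, of "a i" "a n"] by (simp add: x1 cp)
    have split: "\<alpha> (star (a i) * a j) = \<alpha> (star (a' i) * a' j) + p * (cnj (c i) * c j)" for i j
    proof -
      have e: "star (a' i) * a' j = star (a i) * a j - scaleC (c j) (star (a i) * a n)
          - scaleC (cnj (c i)) (star (a n) * a j) + scaleC (cnj (c i) * c j) (star (a n) * a n)"
        by (simp add: a'_def star_diff star_scaleC algebra_simps scaleC_mult_left scaleC_mult_right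
            scaleC_scaleC scaleC_diff_right)
      show ?thesis
        unfolding e by (simp add: state_linear[OF \<alpha>] x1 x2 cn)
    qed
    define z where "z = (\<Sum>j<Suc n. scaleC (c j) (b j))"
    have "\<beta> (star z * z) = (\<Sum>i<Suc n. \<Sum>j<Suc n. cnj (c i) * c j * \<beta> (star (b i) * b j))"
      unfolding z_def star_sum sum_product
      by (simp only: state_linear[OF \<beta>] star_scaleC scaleC_mult_left scaleC_mult_right mult.assoc mult.left_commute)
    moreover have "(\<Sum>i<Suc n. \<Sum>j<Suc n. \<alpha> (star (a' i) * a' j) * \<beta> (star (b i) * b j))
       = (\<Sum>i<n. \<Sum>j<n. \<alpha> (star (a' i) * a' j) * \<beta> (star (b i) * b j))"
      by (simp add: a'n state_linear[OF \<alpha>])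
    ultimately have "(\<Sum>i<Suc n. \<Sum>j<Suc n. \<alpha> (star (a i) * a j) * \<beta> (star (b i) * b j))
      = (\<Sum>i<n. \<Sum>j<n. \<alpha> (star (a' i) * a' j) * \<beta> (star (b i) * b j)) + p * \<beta> (star z * z)"
      by (simp only: split distrib_right sum.distrib sum_distrib_left mult.assoc)
    then show ?thesis
      using Suc[of a'] p state_nonneg[OF \<beta>, of z] by (simp del: sum.lessThan_Suc)
  qed
qed simp

text \<open>The inner product of two sums of elementary tensors in the GNS space of
  \<open>\<alpha> \<otimes> \<beta>\<close>, as a double sum that is additive under append in each
  argument.\<close>

definition tensor_form :: "('a::cstar_algebra \<Rightarrow> complex) \<Rightarrow> ('b::cstar_algebra \<Rightarrow> complex) \<Rightarrow>
    ('a \<times> 'b) list \<Rightarrow> ('a \<times> 'b) list \<Rightarrow> complex" where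
  "tensor_form \<alpha> \<beta> v w = (\<Sum>(a, b)\<leftarrow>v. \<Sum>(c, d)\<leftarrow>w. \<alpha> (star a * c) * \<beta> (star b * d))"

lemma ffun_append: "ffun \<alpha> \<beta> (xs @ ys) = ffun \<alpha> \<beta> xs + ffun \<alpha> \<beta> ys"
  by (simp add: ffun_def)

lemma fmult_Cons: "fmult ((a, b) # xs) ys = map (\<lambda>(c, d). (a * c, b * d)) ys @ fmult xs ys"
  by (simp add: fmult_def)

lemma ffun_fmult_fstar: "ffun \<alpha> \<beta> (fmult (fstar v) w) = tensor_form \<alpha> \<beta> v w"
proof (induction v)
  case Nil
  then show ?case by (simp add: ffun_def fmult_def fstar_def tensor_form_def)
next
  case (Cons p v)
  obtain a b where p: "p = (a, b)" by (cases p)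
  have "ffun \<alpha> \<beta> (map (\<lambda>(c, d). (star a * c, star b * d)) w) = (\<Sum>(c, d)\<leftarrow>w. \<alpha> (star a * c) * \<beta> (star b * d))"
    by (simp add: ffun_def comp_def case_prod_unfold)
  then show ?case
    using Cons by (simp add: p fstar_def fmult_Cons ffun_append tensor_form_def)
qed

lemma tensor_form_append_left:
  "tensor_form \<alpha> \<beta> (v @ v') w = tensor_form \<alpha> \<beta> v w + tensor_form \<alpha> \<beta> v' w"
  by (simp add: tensor_form_def)

lemma tensor_form_append_right:
  "tensor_form \<alpha> \<beta> v (w @ w') = tensor_form \<alpha> \<beta> v w + tensor_form \<alpha> \<beta> v w'"
  by (simp add: tensor_form_def sum_list_addf case_prod_unfold)

lemma sum_list_uminus: "(\<Sum>x\<leftarrow>xs. - f x) = - (\<Sum>x\<leftarrow>xs. f x :: 'a::ab_group_add)"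
  by (induction xs) simp_all

text \<open>Changing the sign of all first legs gives a list that represents the negative vector;
  this stands in for subtraction.\<close>

lemma tensor_form_neg:
  assumes "state \<alpha>"
  defines "neg \<equiv> map (\<lambda>(a, b). (- a, b))"
  shows "tensor_form \<alpha> \<beta> (neg v) w = - tensor_form \<alpha> \<beta> v w"
    and "tensor_form \<alpha> \<beta> v (neg w) = - tensor_form \<alpha> \<beta> v w"
  by (simp_all add: tensor_form_def neg_def comp_def case_prod_unfold star_minus state_linear[OF assms(1)]
      sum_list_uminus)

lemma tensor_form_nonneg:
  assumes "state \<alpha>" "state \<beta>"
  shows "tensor_form \<alpha> \<beta> v v \<in> \<real>\<^sub>\<ge>\<^sub>0"
  using state_schur_product[OF assms, of "\<lambda>i. fst (v ! i)" "\<lambda>i. snd (v ! i)" "length v"]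
  by (simp add: tensor_form_def sum_list_sum_nth case_prod_unfold atLeast0LessThan)

text \<open>The parallelogram law with the nonnegative term of \<open>v - w\<close> dropped.\<close>

lemma tensor_form_append_le:
  assumes "state \<alpha>" "state \<beta>"
  shows "Re (tensor_form \<alpha> \<beta> (v @ w) (v @ w))
    \<le> 2 * Re (tensor_form \<alpha> \<beta> v v) + 2 * Re (tensor_form \<alpha> \<beta> w w)"
proof -
  let ?w = "map (\<lambda>(a, b). (- a, b)) w"
  have "0 \<le> Re (tensor_form \<alpha> \<beta> (v @ ?w) (v @ ?w))"
    using tensor_form_nonneg[OF assms] by (auto simp: complex_nonneg_Reals_iff)
  then show ?thesis
    by (simp add: tensor_form_append_left tensor_form_append_right tensor_form_neg[OF assms(1)])
qed

lemma sum_list_sum_list_add_eq: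
  fixes F G H :: "'b \<Rightarrow> 'b \<Rightarrow> 'a::comm_semiring_0"
  assumes "\<And>x y. F x y + G x y = K * H x y"
  shows "(\<Sum>x\<leftarrow>xs. \<Sum>y\<leftarrow>ys. F x y) + (\<Sum>x\<leftarrow>xs. \<Sum>y\<leftarrow>ys. G x y) = K * (\<Sum>x\<leftarrow>xs. \<Sum>y\<leftarrow>ys. H x y)"
  by (simp add: assms flip: sum_list_addf sum_list_const_mult)

text \<open>One leg at a time: since \<open>star a * a + star d * d = (norm a)\<^sup>2\<close>, the
  forms for \<open>a\<close> and \<open>d\<close> add up to \<open>(norm a)\<^sup>2\<close> times
  the form without \<open>a\<close>, and the one for \<open>d\<close> is nonnegative. The second leg
  goes the same way with \<open>e\<close>.\<close>

lemma tensor_form_mult_le: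
  assumes \<alpha>: "state \<alpha>" and \<beta>: "state \<beta>"
  shows "Re (tensor_form \<alpha> \<beta> (map (\<lambda>(c, d). (a * c, b * d)) v) (map (\<lambda>(c, d). (a * c, b * d)) v))
    \<le> (norm a)\<^sup>2 * (norm b)\<^sup>2 * Re (tensor_form \<alpha> \<beta> v v)" (is "?L \<le> _")
proof -
  obtain d where d: "star d * d = (norm a)\<^sup>2 *\<^sub>R 1 - star a * a" by (rule star_mult_complement)
  obtain e where e: "star e * e = (norm b)\<^sup>2 *\<^sub>R 1 - star b * b" by (rule star_mult_complement)
  let ?m = "\<lambda>a b. map (\<lambda>(c, d). (a * c, b * d)) v"
  have d': "\<alpha> (star x * (star a * (a * y))) + \<alpha> (star x * (star d * (d * y))) = of_real ((norm a)\<^sup>2) * \<alpha> (star x * y)"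
    for x y
  proof -
    have "star a * (a * y) + star d * (d * y) = (norm a)\<^sup>2 *\<^sub>R y"
      using arg_cong[OF d, of "\<lambda>z. z * y"] by (simp add: algebra_simps)
    then have "star x * (star a * (a * y)) + star x * (star d * (d * y)) = (norm a)\<^sup>2 *\<^sub>R (star x * y)"
      by (metis distrib_left mult_scaleR_right)
    then show ?thesis by (metis state_clinear[OF \<alpha>] clinear_add clinear_scaleR)
  qed
  have e': "\<beta> (star x * (star b * (b * y))) + \<beta> (star x * (star e * (e * y))) = of_real ((norm b)\<^sup>2) * \<beta> (star x * y)"
    for x y
  proof -
    have "star b * (b * y) + star e * (e * y) = (norm b)\<^sup>2 *\<^sub>R y"
      using arg_cong[OF e, of "\<lambda>z. z * y"] by (simp add: algebra_simps)
    then have "star x * (star b * (b * y)) + star x * (star e * (e * y)) = (norm b)\<^sup>2 *\<^sub>R (star x * y)"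
      by (metis distrib_left mult_scaleR_right)
    then show ?thesis by (metis state_clinear[OF \<beta>] clinear_add clinear_scaleR)
  qed
  have 1: "tensor_form \<alpha> \<beta> (?m a b) (?m a b) + tensor_form \<alpha> \<beta> (?m d b) (?m d b)
      = of_real ((norm a)\<^sup>2) * tensor_form \<alpha> \<beta> (?m 1 b) (?m 1 b)"
    unfolding tensor_form_def map_map comp_def case_prod_unfold fst_conv snd_conv
    by (rule sum_list_sum_list_add_eq)
       (simp add: star_mult mult.assoc[where 'a='a] mult.assoc[where 'a='b] flip: distrib_right, simp add: d' mult.assoc)
  have 2: "tensor_form \<alpha> \<beta> (?m 1 b) (?m 1 b) + tensor_form \<alpha> \<beta> (?m 1 e) (?m 1 e)
      = of_real ((norm b)\<^sup>2) * tensor_form \<alpha> \<beta> v v"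
    unfolding tensor_form_def map_map comp_def case_prod_unfold fst_conv snd_conv
    by (rule sum_list_sum_list_add_eq) (simp add: star_mult mult.assoc e' flip: distrib_left)
  have "?L \<le> (norm a)\<^sup>2 * Re (tensor_form \<alpha> \<beta> (?m 1 b) (?m 1 b))"
    using arg_cong[OF 1, of Re] tensor_form_nonneg[OF \<alpha> \<beta>, of "?m d b"]
    by (auto simp: complex_nonneg_Reals_iff simp flip: of_real_power)
  also have "Re (tensor_form \<alpha> \<beta> (?m 1 b) (?m 1 b)) \<le> (norm b)\<^sup>2 * Re (tensor_form \<alpha> \<beta> v v)"
    using arg_cong[OF 2, of Re] tensor_form_nonneg[OF \<alpha> \<beta>, of "?m 1 e"]
    by (auto simp: complex_nonneg_Reals_iff simp flip: of_real_power)
  finally show ?thesis by (simp add: mult_left_mono mult.assoc)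
qed

text \<open>The constant is crude but independent of the states and of \<open>y\<close>; it bounds
  the set in \<open>spatial_norm\<close>, so that its \<open>Sup\<close> is a genuine
  supremum.\<close>

lemma tensor_form_fmult_bound:
  fixes x :: "('a::cstar_algebra \<times> 'b::cstar_algebra) list"
  obtains C where "0 \<le> C"
    "\<And>\<alpha> \<beta> y. state \<alpha> \<Longrightarrow> state \<beta> \<Longrightarrow>
      Re (tensor_form \<alpha> \<beta> (fmult x y) (fmult x y)) \<le> C * Re (tensor_form \<alpha> \<beta> y y)"
proof -
  have "\<exists>C\<ge>0. \<forall>\<alpha> \<beta> y. state \<alpha> \<longrightarrow> state \<beta> \<longrightarrow>
      Re (tensor_form \<alpha> \<beta> (fmult x y) (fmult x y)) \<le> C * Re (tensor_form \<alpha> \<beta> y y)"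
  proof (induction x)
    case Nil
    show ?case by (rule exI[of _ 0]) (simp add: fmult_def tensor_form_def)
  next
    case (Cons p x)
    obtain a b where p: "p = (a, b)" by (cases p)
    obtain C where C: "C \<ge> 0" "\<And>\<alpha> \<beta> y. state \<alpha> \<Longrightarrow> state \<beta> \<Longrightarrow>
      Re (tensor_form \<alpha> \<beta> (fmult x y) (fmult x y)) \<le> C * Re (tensor_form \<alpha> \<beta> y y)"
      using Cons by blast
    show ?case
    proof (intro exI conjI allI impI)
      show "0 \<le> 2 * ((norm a)\<^sup>2 * (norm b)\<^sup>2) + 2 * C" using C by simp
      fix \<alpha> :: "'a \<Rightarrow> complex" and \<beta> :: "'b \<Rightarrow> complex" and y assume st: "state \<alpha>" "state \<beta>"
      let ?m = "map (\<lambda>(c, d). (a * c, b * d)) y"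
      have "Re (tensor_form \<alpha> \<beta> (fmult (p # x) y) (fmult (p # x) y))
          \<le> 2 * Re (tensor_form \<alpha> \<beta> ?m ?m) + 2 * Re (tensor_form \<alpha> \<beta> (fmult x y) (fmult x y))"
        unfolding p fmult_Cons by (rule tensor_form_append_le[OF st])
      also have "\<dots> \<le> 2 * ((norm a)\<^sup>2 * (norm b)\<^sup>2 * Re (tensor_form \<alpha> \<beta> y y)) + 2 * (C * Re (tensor_form \<alpha> \<beta> y y))"
        by (intro add_mono mult_left_mono tensor_form_mult_le C st) auto
      also have "\<dots> = (2 * ((norm a)\<^sup>2 * (norm b)\<^sup>2) + 2 * C) * Re (tensor_form \<alpha> \<beta> y y)"
        by (simp add: algebra_simps)
      finally show "Re (tensor_form \<alpha> \<beta> (fmult (p # x) y) (fmult (p # x) y))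
        \<le> (2 * ((norm a)\<^sup>2 * (norm b)\<^sup>2) + 2 * C) * Re (tensor_form \<alpha> \<beta> y y)" .
    qed
  qed
  then show ?thesis using that by blast
qed

lemma cnj_sum_list: "cnj (\<Sum>x\<leftarrow>xs. f x) = (\<Sum>x\<leftarrow>xs. cnj (f x))"
  by (induction xs) simp_all

lemma ffun_cauchy_schwarz:
  assumes \<alpha>: "state \<alpha>" and \<beta>: "state \<beta>"
  shows "(cmod (ffun \<alpha> \<beta> x))\<^sup>2 \<le> Re (tensor_form \<alpha> \<beta> x x)"
proof -
  define l where "l = ffun \<alpha> \<beta> x"
  \<comment> \<open>\<open>?o\<close> represents \<open>- l (1 \<otimes> 1)\<close>; positivity of
    the form at \<open>x - l (1 \<otimes> 1)\<close> is Cauchy-Schwarz against the vector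
    \<open>1 \<otimes> 1\<close>.\<close>
  let ?o = "[(scaleC (- l) 1, 1)]"
  have 1: "tensor_form \<alpha> \<beta> ?o x = - cnj l * l"
    by (simp add: tensor_form_def l_def ffun_def star_scaleC scaleC_mult_left state_linear[OF \<alpha>] mult.assoc
       case_prod_unfold sum_list_const_mult sum_list_uminus)
  have 2: "tensor_form \<alpha> \<beta> x ?o = - l * cnj l"
    by (simp add: tensor_form_def scaleC_mult_right state_linear[OF \<alpha>] state_star[OF \<alpha>] state_star[OF \<beta>]
       case_prod_unfold mult.assoc sum_list_const_mult sum_list_uminus)
     (simp add: l_def ffun_def case_prod_unfold cnj_sum_list)
  have 3: "tensor_form \<alpha> \<beta> ?o ?o = l * cnj l"
    by (simp add: tensor_form_def star_scaleC scaleC_mult_right scaleC_mult_left state_linear[OF \<alpha>] state_one[OF \<alpha>] state_one[OF \<beta>])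
  have "0 \<le> Re (tensor_form \<alpha> \<beta> (x @ ?o) (x @ ?o))"
    using tensor_form_nonneg[OF \<alpha> \<beta>] by (auto simp: complex_nonneg_Reals_iff)
  also have "\<dots> = Re (tensor_form \<alpha> \<beta> x x - l * cnj l)"
    by (simp only: tensor_form_append_left tensor_form_append_right 1 2 3) (simp add: algebra_simps)
  finally show ?thesis
    unfolding l_def[symmetric] by (simp only: complex_norm_square[symmetric] diff_ge_0_iff_ge minus_complex.sel Re_complex_of_real)
qed

lemma ffun_le_spatial_norm:
  assumes \<alpha>: "state \<alpha>" and \<beta>: "state \<beta>"
  shows "cmod (ffun \<alpha> \<beta> x) \<le> spatial_norm x"
proof -
  let ?S = "{Re (ffun \<phi> \<psi> (fmult (fstar (fmult x y)) (fmult x y))) | \<phi> \<psi> y.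
                 state \<phi> \<and> state \<psi> \<and> ffun \<phi> \<psi> (fmult (fstar y) y) = 1}"
  obtain C where C: "\<And>\<alpha> \<beta> y. state \<alpha> \<Longrightarrow> state \<beta> \<Longrightarrow>
      Re (tensor_form \<alpha> \<beta> (fmult x y) (fmult x y)) \<le> C * Re (tensor_form \<alpha> \<beta> y y)"
    using tensor_form_fmult_bound by metis
  have "bdd_above ?S"
  proof (rule bdd_aboveI)
    fix r assume "r \<in> ?S"
    then obtain \<phi> \<psi> y where "state \<phi>" "state \<psi>" "tensor_form \<phi> \<psi> y y = 1"
      "r = Re (tensor_form \<phi> \<psi> (fmult x y) (fmult x y))"
      by (auto simp: ffun_fmult_fstar)
    then show "r \<le> C" using C[of \<phi> \<psi> y] by simp
  qed
  \<comment> \<open>This value is attained at \<open>y = 1 \<otimes> 1\<close>, a unit vector for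
    every pair of states.\<close>
  moreover have "Re (tensor_form \<alpha> \<beta> x x) \<in> ?S"
  proof -
    have "fmult x [(1, 1)] = x" by (induction x) (auto simp: fmult_def)
    moreover have "ffun \<alpha> \<beta> (fmult (fstar [(1, 1)]) [(1, 1)]) = 1"
      by (simp add: ffun_fmult_fstar tensor_form_def state_one[OF \<alpha>] state_one[OF \<beta>])
    ultimately show ?thesis
      using \<alpha> \<beta> by (intro CollectI exI[of _ \<alpha>] exI[of _ \<beta>] exI[of _ "[(1, 1)]"]) (simp add: ffun_fmult_fstar)
  qed
  ultimately have "Re (tensor_form \<alpha> \<beta> x x) \<le> Sup ?S" by (rule cSup_upper[rotated])
  then have "(cmod (ffun \<alpha> \<beta> x))\<^sup>2 \<le> Sup ?S" using ffun_cauchy_schwarz[OF \<alpha> \<beta>, of x] by linarith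
  then show ?thesis unfolding spatial_norm_def by (rule real_le_rsqrt)
qed

section \<open>Extension by continuity from dense subsets\<close>

lemmas continuous_on_scaleC [continuous_intros] = bounded_linear.continuous_on[OF bounded_linear_scaleC]
lemmas continuous_on_star [continuous_intros] = bounded_linear.continuous_on[OF bounded_linear_star]

text \<open>Equal images under \<open>e\<close> force equal values of \<open>g\<close>, so the
  choice made by \<open>SOME\<close> is immaterial and \<open>g\<close> descends to
  \<open>range e\<close>; being Lipschitz there, it extends to the closure. Used with
  \<open>e\<close> summing lists of tensors and with \<open>e\<close> evaluating free
  polynomials.\<close>

lemma dense_extension:
  fixes e :: "'f \<Rightarrow> 'a::metric_space" and g :: "'f \<Rightarrow> 'b::complete_space"
  assumes "closure (range e) = UNIV" and le: "\<And>x y. dist (g x) (g y) \<le> dist (e x) (e y)"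
  obtains h where "continuous_on UNIV h" "\<And>x. h (e x) = g x"
proof -
  define h0 where "h0 z = g (SOME x. e x = z)" for z
  have h0: "h0 (e x) = g x" for x
  proof -
    have "e (SOME x'. e x' = e x) = e x" by (rule someI[of _ x]) simp
    then show ?thesis using le[of "SOME x'. e x' = e x" x] by (simp add: h0_def)
  qed
  have "uniformly_continuous_on (range e) h0"
    unfolding uniformly_continuous_on_def using le by (auto simp: h0 intro: le_less_trans)
  then obtain h where h: "uniformly_continuous_on (closure (range e)) h" "\<And>x. x \<in> range e \<Longrightarrow> h0 x = h x"
    by (rule uniformly_continuous_on_extension_on_closure) blast
  show ?thesis
  proof
    show "continuous_on UNIV h" using h(1) assms(1) by (simp add: uniformly_continuous_imp_continuous)
    show "h (e x) = g x" for x using h(2)[of "e x"] h0 by simp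
  qed
qed

lemma dense_induct:
  assumes "closure (range e) = UNIV" "closed {x. P x}" "\<And>y. P (e y)"
  shows "P x"
  using closure_minimal[of "range e" "{x. P x}"] assms by auto

lemma dense_eq:
  fixes f g :: "'a::topological_space \<Rightarrow> 'b::t2_space"
  assumes "closure (range e) = UNIV" "continuous_on UNIV f" "continuous_on UNIV g" "\<And>y. f (e y) = g (e y)"
  shows "f x = g x"
  using assms by (intro dense_induct[of e "\<lambda>x. f x = g x" x] closed_Collect_eq) auto

lemma dense_eq2:
  fixes f g :: "'a::topological_space \<Rightarrow> 'a \<Rightarrow> 'b::t2_space"
  assumes dense: "closure (range e) = UNIV"
    and "\<And>y. continuous_on UNIV (\<lambda>x. f x y)" "\<And>y. continuous_on UNIV (\<lambda>x. g x y)"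
    and "\<And>x. continuous_on UNIV (f x)" "\<And>x. continuous_on UNIV (g x)"
    and "\<And>x y. f (e x) (e y) = g (e x) (e y)"
  shows "f x y = g x y"
proof -
  have "f x (e y') = g x (e y')" for y'
    by (rule dense_eq[OF dense, of "\<lambda>x. f x (e y')"]) (rule assms)+
  then show ?thesis by (rule dense_eq[OF dense assms(4,5)])
qed

lemma
  assumes "min_tensor_product t"
  shows tensor_add_left: "t (a + a') b = t a b + t a' b"
    and tensor_add_right: "t a (b + b') = t a b + t a b'"
    and tensor_scaleC_left: "t (scaleC c a) b = scaleC c (t a b)"
    and tensor_scaleC_right: "t a (scaleC c b) = scaleC c (t a b)"
    and tensor_mult: "t a b * t a' b' = t (a * a') (b * b')"
    and tensor_star: "star (t a b) = t (star a) (star b)"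
    and tensor_one: "t 1 1 = 1"
    and tensor_dense: "closure (range (\<lambda>x. \<Sum>(a, b)\<leftarrow>x. t a b)) = UNIV"
    and tensor_norm: "norm (\<Sum>(a, b)\<leftarrow>x. t a b) = spatial_norm x"
    and tensor_zero_left: "t 0 b = 0"
    and tensor_zero_right: "t a 0 = 0"
    and tensor_sum_left: "t (\<Sum>i\<in>I. f i) b = (\<Sum>i\<in>I. t (f i) b)"
    and tensor_sum_right: "t a (\<Sum>i\<in>J. g i) = (\<Sum>i\<in>J. t a (g i))"
proof -
  note * = assms[unfolded min_tensor_product_def]
  show al: "t (a + a') b = t a b + t a' b" for a a' b using * by blast
  show ar: "t a (b + b') = t a b + t a b'" for a b b' using * by blast
  show sl: "t (scaleC c a) b = scaleC c (t a b)" for a b c using * by blast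
  show sr: "t a (scaleC c b) = scaleC c (t a b)" for a b c using * by blast
  show "t a b * t a' b' = t (a * a') (b * b')" "star (t a b) = t (star a) (star b)" "t 1 1 = 1"
    "closure (range (\<lambda>x. \<Sum>(a, b)\<leftarrow>x. t a b)) = UNIV" "norm (\<Sum>(a, b)\<leftarrow>x. t a b) = spatial_norm x"
    using * by blast+
  show zl: "t 0 b = 0" for b using sl[of 0 0 b] by simp
  show zr: "t a 0 = 0" for a using sr[of a 0 0] by simp
  show "t (\<Sum>i\<in>I. f i) b = (\<Sum>i\<in>I. t (f i) b)"
    by (induction I rule: infinite_finite_induct) (simp_all add: zl al)
  show "t a (\<Sum>i\<in>J. g i) = (\<Sum>i\<in>J. t a (g i))"
    by (induction J rule: infinite_finite_induct) (simp_all add: zr ar)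
qed

text \<open>This gives the definite description \<open>tensor_state\<close> its meaning.
  \<open>ffun\<close> is contractive for the tensor norm, hence extends from lists; the state axioms
  hold on a dense set and are closed conditions. Uniqueness follows because states are
  continuous.\<close>

lemma tensor_state_ex1:
  assumes t: "min_tensor_product t" and \<alpha>: "state \<alpha>" and \<beta>: "state \<beta>"
  shows "\<exists>!\<omega>. state \<omega> \<and> (\<forall>a b. \<omega> (t a b) = \<alpha> a * \<beta> b)"
proof -
  define e where "e = (\<lambda>x. \<Sum>(a, b)\<leftarrow>x. t a b)"
  have dense: "closure (range e) = UNIV" unfolding e_def by (rule tensor_dense[OF t])
  have e_append: "e (x @ y) = e x + e y" for x y by (simp add: e_def)
  have e_scale: "e (map (\<lambda>(a, b). (scaleC c a, b)) x) = scaleC c (e x)" for c x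
    by (induction x) (auto simp: e_def scaleC_add_right tensor_scaleC_left[OF t])
  have e_star: "star (e x) = e (fstar x)" for x
    by (induction x) (auto simp: e_def fstar_def star_add tensor_star[OF t])
  have e_mult: "e x * e y = e (fmult x y)" for x y
  proof (induction x)
    case Nil
    then show ?case by (simp add: e_def fmult_def)
  next
    case (Cons p x)
    obtain a b where p: "p = (a, b)" by (cases p)
    have "t a b * e y = e (map (\<lambda>(c, d). (a * c, b * d)) y)"
      by (simp add: e_def comp_def case_prod_unfold tensor_mult[OF t] flip: sum_list_const_mult)
    moreover have "e (p # x) = t a b + e x" by (simp add: e_def p)
    ultimately show ?case using Cons by (simp add: p fmult_Cons e_append distrib_right)
  qed
  have f_scale: "ffun \<alpha> \<beta> (map (\<lambda>(a, b). (scaleC c a, b)) x) = c * ffun \<alpha> \<beta> x" for c x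
    by (induction x) (auto simp: ffun_def state_linear[OF \<alpha>] algebra_simps)
  have "dist (ffun \<alpha> \<beta> x) (ffun \<alpha> \<beta> y) \<le> dist (e x) (e y)" for x y
  proof -
    \<comment> \<open>A list representing the difference of \<open>x\<close> and \<open>y\<close>,
      which turns the norm bound into a Lipschitz bound.\<close>
    let ?z = "x @ map (\<lambda>(a, b). (scaleC (- 1) a, b)) y"
    have "cmod (ffun \<alpha> \<beta> ?z) \<le> norm (e ?z)"
      unfolding e_def tensor_norm[OF t] by (rule ffun_le_spatial_norm[OF \<alpha> \<beta>])
    then show ?thesis
      unfolding ffun_append e_append f_scale e_scale by (simp add: dist_norm)
  qed
  then obtain \<omega> where \<omega>: "continuous_on UNIV \<omega>" "\<And>x. \<omega> (e x) = ffun \<alpha> \<beta> x"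
    using dense_extension[OF dense] by metis
  have cont: "continuous_on UNIV (\<lambda>x. \<omega> (g x))" if "continuous_on UNIV g" for g
    using continuous_on_compose2[OF \<omega>(1) that] by simp
  have "\<omega> (x + y) = \<omega> x + \<omega> y" for x y
  proof -
    have 1: "\<omega> (e x' + e y') = \<omega> (e x') + \<omega> (e y')" for x' y'
      by (simp add: \<omega> ffun_append flip: e_append)
    show ?thesis
      by (rule dense_eq2[OF dense, where f = "\<lambda>x y. \<omega> (x + y)" and g = "\<lambda>x y. \<omega> x + \<omega> y"])
        (intro continuous_intros cont 1)+
  qed
  moreover have "\<omega> (scaleC c x) = c * \<omega> x" for c x
  proof (rule dense_eq[OF dense])
    show "\<omega> (scaleC c (e y)) = c * \<omega> (e y)" for y
      by (simp add: \<omega> f_scale flip: e_scale)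
  qed (intro continuous_intros cont)+
  moreover have "\<omega> (star x * x) \<in> \<real>\<^sub>\<ge>\<^sub>0" for x
  proof (rule dense_induct[OF dense, where P = "\<lambda>x. \<omega> (star x * x) \<in> \<real>\<^sub>\<ge>\<^sub>0"])
    have "continuous_on UNIV (\<lambda>x. \<omega> (star x * x))"
      by (intro cont continuous_intros)
    then have "closed ((\<lambda>x. \<omega> (star x * x)) -` \<real>\<^sub>\<ge>\<^sub>0)"
      by (intro closed_vimage) auto
    then show "closed {x. \<omega> (star x * x) \<in> \<real>\<^sub>\<ge>\<^sub>0}" by (simp add: vimage_def)
    show "\<omega> (star (e y) * e y) \<in> \<real>\<^sub>\<ge>\<^sub>0" for y
      using tensor_form_nonneg[OF \<alpha> \<beta>, of y] by (simp add: e_star e_mult \<omega> ffun_fmult_fstar)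
  qed
  moreover have \<omega>_t: "\<omega> (t a b) = \<alpha> a * \<beta> b" for a b
    using \<omega>(2)[of "[(a, b)]"] by (simp add: e_def ffun_def)
  moreover have "\<omega> 1 = 1"
    using \<omega>_t[of 1 1] by (simp add: tensor_one[OF t] state_one[OF \<alpha>] state_one[OF \<beta>])
  ultimately have "state \<omega> \<and> (\<forall>a b. \<omega> (t a b) = \<alpha> a * \<beta> b)"
    by (simp add: state_def clinear_def)
  moreover have "\<omega>\<^sub>1 = \<omega>\<^sub>2" if 1: "state \<omega>\<^sub>1" "\<forall>a b. \<omega>\<^sub>1 (t a b) = \<alpha> a * \<beta> b"
      and 2: "state \<omega>\<^sub>2" "\<forall>a b. \<omega>\<^sub>2 (t a b) = \<alpha> a * \<beta> b" for \<omega>\<^sub>1 \<omega>\<^sub>2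
  proof
    have e: "\<omega>' (e x) = ffun \<alpha> \<beta> x" if "state \<omega>'" "\<forall>a b. \<omega>' (t a b) = \<alpha> a * \<beta> b" for \<omega>' x
      using that by (induction x) (auto simp: e_def ffun_def state_linear[OF that(1)])
    show "\<omega>\<^sub>1 x = \<omega>\<^sub>2 x" for x
      by (rule dense_eq[OF dense])
        (auto simp: e[OF 1] e[OF 2] intro!: linear_continuous_on state_bounded_linear 1 2)
  qed
  ultimately show ?thesis by blast
qed

lemma
  assumes "min_tensor_product t" "state \<alpha>" "state \<beta>"
  shows state_tensor_state: "state (tensor_state t \<alpha> \<beta>)"
    and tensor_state_tensor: "tensor_state t \<alpha> \<beta> (t a b) = \<alpha> a * \<beta> b"
  using theI'[OF tensor_state_ex1[OF assms]] unfolding tensor_state_def by auto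

section \<open>Representations of the free *-algebra\<close>

lemma poly_mapping_induct_single [case_names zero add]:
  assumes "P 0" "\<And>f a b. P f \<Longrightarrow> P (Poly_Mapping.single a b + f)"
  shows "P f"
proof (induction f rule: update_induct)
  case (update f a b)
  have "Poly_Mapping.update a b f = Poly_Mapping.single a b + f"
    using update(1) by (intro poly_mapping_eqI) (auto simp: lookup_update lookup_add lookup_single when_def in_keys_iff)
  then show ?case using assms(2) update by simp
qed (rule assms(1))

lemma free_eval_superset:
  assumes "finite S" "Poly_Mapping.keys f \<subseteq> S"
  shows "free_eval v f = (\<Sum>w\<in>S. scaleC (Poly_Mapping.lookup f w) (prod_list (map v (letters w))))"
  unfolding free_eval_def
  by (rule sum.mono_neutral_left) (use assms in \<open>auto simp: in_keys_iff\<close>)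

lemma free_eval_zero [simp]: "free_eval v 0 = 0"
  by (simp add: free_eval_def)

lemma free_eval_add: "free_eval v (f + g) = free_eval v f + free_eval v g"
proof -
  let ?S = "Poly_Mapping.keys f \<union> Poly_Mapping.keys g"
  have "Poly_Mapping.keys (f + g) \<subseteq> ?S" by (rule Poly_Mapping.keys_add)
  then show ?thesis
    by (simp add: free_eval_superset[of ?S] lookup_add scaleC_add_left sum.distrib)
qed

lemma free_eval_single: "free_eval v (Poly_Mapping.single w c) = scaleC c (prod_list (map v (letters w)))"
  by (subst free_eval_superset[of "{w}"]) auto

lemma free_eval_gen: "free_eval v (gen i) = v i"
  by (simp add: gen_def free_eval_single)

lemma free_eval_minus: "free_eval v (- f) = - free_eval v f"
  using free_eval_add[of v f "- f"] by (simp add: add_eq_0_iff)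

lemma free_eval_diff: "free_eval v (f - g) = free_eval v f - free_eval v g"
  using free_eval_add[of v f "- g"] by (simp add: free_eval_minus)

lemma free_eval_sum: "free_eval v (\<Sum>i\<in>I. f i) = (\<Sum>i\<in>I. free_eval v (f i))"
  by (induction I rule: infinite_finite_induct) (simp_all add: free_eval_add)

lemma free_eval_mult: "free_eval v (f * g) = free_eval v f * free_eval v g"
proof (induction f rule: poly_mapping_induct_single)
  case (add f a b)
  have "free_eval v (Poly_Mapping.single a b * g) = free_eval v (Poly_Mapping.single a b) * free_eval v g"
    by (induction g rule: poly_mapping_induct_single)
      (simp_all add: distrib_left free_eval_add mult_single free_eval_single plus_wrd_def
        scaleC_mult_left scaleC_mult_right scaleC_scaleC mult.commute[of _ b])
  with add show ?case by (simp add: distrib_right free_eval_add)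
qed simp

lemma free_eval_one: "free_eval v 1 = 1"
  using free_eval_single[of v 0 1] unfolding single_one by (simp add: zero_wrd_def)

lemma free_eval_scale: "free_eval v (free_scale c f) = scaleC c (free_eval v f)"
  by (simp add: free_scale_def mult_map_scale_conv_mult free_eval_mult free_eval_single zero_wrd_def scaleC_mult_left)

text \<open>Required to unfold \<open>map_key\<close>, which is characterised for injective maps
  only.\<close>

lemma inj_rev_wrd: "inj (\<lambda>w. Word (rev (letters w)))"
  by (rule injI) (metis wrd.collapse wrd.inject rev_rev_ident)

lemma lookup_free_star: "Poly_Mapping.lookup (free_star f) w = cnj (Poly_Mapping.lookup f (Word (rev (letters w))))"
  by (simp add: free_star_def Poly_Mapping.map.rep_eq map_key.rep_eq[OF inj_rev_wrd] when_def)

lemma prod_list_star: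
  assumes "\<And>i. star (v i) = (v i :: 'a::cstar_algebra)"
  shows "star (prod_list (map v xs)) = prod_list (map v (rev xs))"
  by (induction xs) (simp_all add: star_mult assms)

lemma free_eval_star:
  fixes v :: "'i \<Rightarrow> 'a::cstar_algebra"
  assumes "\<And>i. star (v i) = v i"
  shows "free_eval v (free_star f) = star (free_eval v f)"
proof (induction f rule: poly_mapping_induct_single)
  case zero
  have "free_star (0 :: 'i free_alg) = 0" by (intro poly_mapping_eqI) (simp add: lookup_free_star)
  then show ?case by simp
next
  case (add f a b)
  have "free_star (Poly_Mapping.single a b + f) = Poly_Mapping.single (Word (rev (letters a))) (cnj b) + free_star f"
    by (intro poly_mapping_eqI) (auto simp: lookup_free_star lookup_add lookup_single when_def)
  then show ?case using add
    by (simp add: free_eval_add free_eval_single star_add star_scaleC prod_list_star[of v, OF assms])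
qed

section \<open>Magic unitaries\<close>

lemma
  assumes "magic_unitary u"
  shows magic_idem: "u i j * u i j = u i j"
    and magic_star: "star (u i j) = u i j"
    and magic_row: "(\<Sum>j\<in>UNIV. u i j) = 1"
    and magic_col: "(\<Sum>i\<in>UNIV. u i j) = 1"
  using assms by (auto simp: magic_unitary_def)

text \<open>Compressing \<open>\<Sum> p i = 1\<close> by \<open>p k\<close> leaves a vanishing sum
  of the \<open>p k * p i * p k\<close> over \<open>i \<noteq> k\<close>. Each summand is
  \<open>star (p i * p k) * (p i * p k)\<close>, and positive elements with sum zero vanish.\<close>

lemma partition_of_unity_orthogonal:
  fixes p :: "'i \<Rightarrow> 'a::cstar_algebra"
  assumes fin: "finite I" and p: "\<And>i. i \<in> I \<Longrightarrow> p i * p i = p i" "\<And>i. i \<in> I \<Longrightarrow> star (p i) = p i"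
    and one: "(\<Sum>i\<in>I. p i) = 1" and "k \<in> I" "l \<in> I" "l \<noteq> k"
  shows "p l * p k = 0"
proof -
  have "p k * p k = p k * (\<Sum>i\<in>I. p i) * p k" by (simp add: one)
  also have "\<dots> = (\<Sum>i\<in>I. p k * p i * p k)" by (simp add: sum_distrib_left sum_distrib_right)
  also have "\<dots> = p k * p k * p k + (\<Sum>i\<in>I - {k}. p k * p i * p k)"
    by (rule sum.remove) fact+
  finally have "(\<Sum>i\<in>I - {k}. p k * p i * p k) = 0" using p \<open>k \<in> I\<close> by simp
  moreover have "(\<Sum>i\<in>I - {k}. p k * p i * p k) = (\<Sum>i\<in>I - {k}. star (p i * p k) * (p i * p k))"
  proof (rule sum.cong)
    fix i assume "i \<in> I - {k}"
    then show "p k * p i * p k = star (p i * p k) * (p i * p k)"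
      using p[of i] p[of k] \<open>k \<in> I\<close> by (simp add: star_mult) (metis mult.assoc)
  qed simp
  ultimately show ?thesis
    using sum_star_mult_eq_zero[of "I - {k}" "\<lambda>i. p i * p k" l] assms by simp
qed

lemma magic_row_orthogonal:
  assumes "magic_unitary u" "k \<noteq> l"
  shows "u i k * u i l = 0"
  by (rule partition_of_unity_orthogonal[of UNIV])
     (use assms in \<open>auto simp: magic_idem magic_star magic_row\<close>)

lemma magic_col_orthogonal:
  assumes "magic_unitary u" "k \<noteq> l"
  shows "u k j * u l j = 0"
  by (rule partition_of_unity_orthogonal[of UNIV "\<lambda>i. u i j"])
     (use assms in \<open>auto simp: magic_idem magic_star magic_col\<close>)

lemma norm_magic_le:
  assumes "magic_unitary u"
  shows "norm (u i j) \<le> 1"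
proof -
  have "(norm (u i j))\<^sup>2 = norm (u i j)"
    using cstar_identity[of "u i j"] by (simp add: magic_star[OF assms] magic_idem[OF assms])
  then show ?thesis by (auto simp: power2_eq_square)
qed

text \<open>An entry of a tensor power of \<open>u\<close>, with row index \<open>is\<close> and
  column index \<open>js\<close>. Keeping the two lists apart allows matrix products;
  \<open>map2\<close> truncates lists of different length, hence the length hypotheses
  below.\<close>

definition entry_word :: "('n \<Rightarrow> 'n \<Rightarrow> 'a::cstar_algebra) \<Rightarrow> 'n list \<Rightarrow> 'n list \<Rightarrow> 'a"
  where "entry_word u is js = prod_list (map2 u is js)"

lemma entry_word_Nil [simp]: "entry_word u [] [] = 1"
  by (simp add: entry_word_def)

lemma entry_word_Cons [simp]: "entry_word u (i # is) (j # js) = u i j * entry_word u is js"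
  by (simp add: entry_word_def)

lemma free_eval_entry_word:
  "prod_list (map (\<lambda>(i, j). u i j) w) = entry_word u (map fst w) (map snd w)"
  by (induction w) auto

lemma star_hom_entry_word:
  assumes "star_hom h"
  shows "h (entry_word u is js) = entry_word (\<lambda>i j. h (u i j)) is js"
  by (simp add: entry_word_def star_hom_prod_list[OF assms] comp_def case_prod_unfold)

lemma universal_magic_dense: "universal_magic_unitary u \<Longrightarrow> closure (range (free_eval (\<lambda>(i, j). u i j))) = UNIV"
  by (simp add: universal_magic_unitary_def)

lemma universal_magic: "universal_magic_unitary u \<Longrightarrow> magic_unitary u"
  by (simp add: universal_magic_unitary_def)

lemma state_eqI:
  assumes u: "universal_magic_unitary u" and f: "state f" and g: "state g"
    and "\<And>is js. length is = length js \<Longrightarrow> f (entry_word u is js) = g (entry_word u is js)"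
  shows "f = g"
proof
  show "f x = g x" for x
    by (rule dense_eq[OF universal_magic_dense[OF u]])
      (auto simp: free_eval_def state_linear[OF f] state_linear[OF g] free_eval_entry_word assms
       intro!: linear_continuous_on state_bounded_linear)
qed

lemma magic_unitary_seminorm:
  assumes v: "magic_unitary v"
  shows "magic_seminorm (\<lambda>f. norm (free_eval (\<lambda>(i, j). v i j) f))"
proof -
  have "star (case p of (i, j) \<Rightarrow> v i j) = (case p of (i, j) \<Rightarrow> v i j)" for p
    using magic_star[OF v] by (cases p) simp
  then show ?thesis
    unfolding magic_seminorm_def cstar_seminorm_def
    by (simp add: free_eval_add free_eval_scale free_eval_mult free_eval_star free_eval_diff free_eval_gen
      free_eval_sum free_eval_one norm_triangle_ineq norm_scaleC norm_mult_ineq cstar_identity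
      magic_idem[OF v] magic_row[OF v] magic_col[OF v])
qed

text \<open>The universal norm dominates the seminorm that \<open>v\<close> induces on the free
  algebra. So evaluation at \<open>v\<close> is a contractive function of evaluation at
  \<open>u\<close> and extends from a dense set. Both \<open>comult\<close> and
  \<open>abelianisation\<close> are instances.\<close>

lemma universal_star_hom_ex1:
  fixes u :: "'n::finite \<Rightarrow> 'n \<Rightarrow> 'a::cstar_algebra" and v :: "'n \<Rightarrow> 'n \<Rightarrow> 'b::cstar_algebra"
  assumes u: "universal_magic_unitary u" and v: "magic_unitary v"
  shows "\<exists>!h. star_hom h \<and> (\<forall>i j. h (u i j) = v i j)"
proof -
  define eu ev where "eu = free_eval (\<lambda>(i, j). u i j)" and "ev = free_eval (\<lambda>(i, j). v i j)"
  have dense: "closure (range eu) = UNIV" unfolding eu_def by (rule universal_magic_dense[OF u])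
  have "dist (ev f) (ev g) \<le> dist (eu f) (eu g)" for f g
    using u magic_unitary_seminorm[OF v]
    by (auto simp: universal_magic_unitary_def dist_norm eu_def ev_def simp flip: free_eval_diff)
  then obtain h where h: "continuous_on UNIV h" "\<And>f. h (eu f) = ev f"
    using dense_extension[OF dense] by metis
  have cont: "continuous_on UNIV (\<lambda>x. h (g x))" if "continuous_on UNIV g" for g
    using continuous_on_compose2[OF h(1) that] by simp
  have su: "star (case p of (i, j) \<Rightarrow> u i j) = (case p of (i, j) \<Rightarrow> u i j)" for p
    using magic_star[OF universal_magic[OF u]] by (cases p) simp
  have sv: "star (case p of (i, j) \<Rightarrow> v i j) = (case p of (i, j) \<Rightarrow> v i j)" for p
    using magic_star[OF v] by (cases p) simp
  have "h (x + y) = h x + h y" for x y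
  proof -
    have 1: "h (eu x' + eu y') = h (eu x') + h (eu y')" for x' y'
      unfolding h by (simp add: eu_def free_eval_add[symmetric] h[unfolded eu_def]) (simp add: ev_def free_eval_add)
    show ?thesis
      by (rule dense_eq2[OF dense, where f = "\<lambda>x y. h (x + y)" and g = "\<lambda>x y. h x + h y"])
        (intro continuous_intros cont 1)+
  qed
  moreover have "h (x * y) = h x * h y" for x y
  proof -
    have 1: "h (eu x' * eu y') = h (eu x') * h (eu y')" for x' y'
      unfolding h by (simp add: eu_def free_eval_mult[symmetric] h[unfolded eu_def]) (simp add: ev_def free_eval_mult)
    show ?thesis
      by (rule dense_eq2[OF dense, where f = "\<lambda>x y. h (x * y)" and g = "\<lambda>x y. h x * h y"])
        (intro continuous_intros cont 1)+
  qed
  moreover have "h (scaleC c x) = scaleC c (h x)" for c x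
  proof (rule dense_eq[OF dense])
    show "h (scaleC c (eu y)) = scaleC c (h (eu y))" for y
      by (simp add: eu_def free_eval_scale[symmetric] h[unfolded eu_def]) (simp add: ev_def free_eval_scale)
  qed (intro continuous_intros cont)+
  moreover have "h (star x) = star (h x)" for x
  proof (rule dense_eq[OF dense])
    show "h (star (eu y)) = star (h (eu y))" for y
      by (simp add: eu_def free_eval_star[symmetric, OF su] h[unfolded eu_def]) (simp add: ev_def free_eval_star[OF sv])
  qed (intro continuous_intros cont)+
  moreover have "h 1 = 1"
    using h(2)[of 1] by (simp add: eu_def ev_def free_eval_one)
  moreover have "h (u i j) = v i j" for i j
    using h(2)[of "gen (i, j)"] by (simp add: eu_def ev_def free_eval_gen)
  ultimately have "star_hom h \<and> (\<forall>i j. h (u i j) = v i j)"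
    by (simp add: star_hom_def)
  moreover have "h\<^sub>1 = h\<^sub>2" if 1: "star_hom h\<^sub>1" "\<forall>i j. h\<^sub>1 (u i j) = v i j"
      and 2: "star_hom h\<^sub>2" "\<forall>i j. h\<^sub>2 (u i j) = v i j" for h\<^sub>1 h\<^sub>2
  proof
    have e: "h' (eu x) = ev x" if h': "star_hom h'" "\<forall>i j. h' (u i j) = v i j" for h' x
      using h'(2) by (simp add: eu_def ev_def free_eval_def star_hom_sum[OF h'(1)] star_hom_scaleC[OF h'(1)]
          star_hom_prod_list[OF h'(1)] comp_def case_prod_unfold)
    show "h\<^sub>1 x = h\<^sub>2 x" for x
      by (rule dense_eq[OF dense])
        (auto simp: e[OF 1] e[OF 2] intro!: linear_continuous_on star_hom_bounded_linear 1 2)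
  qed
  ultimately show ?thesis by blast
qed

lemma magic_unitary_comult:
  assumes u: "magic_unitary u" and t: "min_tensor_product t"
  shows "magic_unitary (\<lambda>i j. \<Sum>k\<in>UNIV. t (u i k) (u k j))"
  unfolding magic_unitary_def
proof (intro conjI allI)
  fix i j
  \<comment> \<open>Mixed terms vanish already in the first leg, by orthogonality within row
    \<open>i\<close> of \<open>u\<close>.\<close>
  have "t (u i k) (u k j) * t (u i l) (u l j) = (if l = k then t (u i k) (u k j) else 0)" for k l
    by (auto simp: tensor_mult[OF t] magic_idem[OF u] magic_row_orthogonal[OF u] tensor_zero_left[OF t])
  then show "(\<Sum>k\<in>UNIV. t (u i k) (u k j)) * (\<Sum>k\<in>UNIV. t (u i k) (u k j)) = (\<Sum>k\<in>UNIV. t (u i k) (u k j))"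
    by (simp add: sum_product)
  show "star (\<Sum>k\<in>UNIV. t (u i k) (u k j)) = (\<Sum>k\<in>UNIV. t (u i k) (u k j))"
    by (simp add: star_sum tensor_star[OF t] magic_star[OF u])
next
  fix i
  show "(\<Sum>j\<in>UNIV. \<Sum>k\<in>UNIV. t (u i k) (u k j)) = 1"
    by (subst sum.swap)
      (simp add: tensor_sum_right[OF t, symmetric] tensor_sum_left[OF t, symmetric] magic_row[OF u] tensor_one[OF t])
next
  fix j
  show "(\<Sum>i\<in>UNIV. \<Sum>k\<in>UNIV. t (u i k) (u k j)) = 1"
    by (subst sum.swap)
      (simp add: tensor_sum_right[OF t, symmetric] tensor_sum_left[OF t, symmetric] magic_col[OF u] tensor_one[OF t])
qed

lemma
  assumes "universal_magic_unitary u" "min_tensor_product t"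
  shows comult_star_hom: "star_hom (comult u t)"
    and comult_entry: "comult u t (u i j) = (\<Sum>k\<in>UNIV. t (u i k) (u k j))"
  using theI'[OF universal_star_hom_ex1[OF assms(1) magic_unitary_comult[OF universal_magic[OF assms(1)] assms(2)]]]
  unfolding comult_def by auto

section \<open>Finite matrices\<close>

lemma finite_family_convergent_subsequence:
  fixes X :: "nat \<Rightarrow> 'j \<Rightarrow> complex"
  assumes "finite J" "\<And>n j. j \<in> J \<Longrightarrow> cmod (X n j) \<le> C"
  shows "\<exists>r. strict_mono r \<and> (\<forall>j\<in>J. convergent (\<lambda>n. X (r n) j))"
  using assms
proof (induction J rule: finite_induct)
  case empty
  then show ?case by (intro exI[of _ id]) (auto simp: strict_mono_def)
next
  case (insert j J)
  then obtain r where r: "strict_mono r" "\<And>i. i \<in> J \<Longrightarrow> convergent (\<lambda>n. X (r n) i)" by auto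
  have "bounded (range (\<lambda>n. X (r n) j))" using insert.prems by (auto simp: bounded_iff)
  then obtain l s where s: "strict_mono s" "((\<lambda>n. X (r n) j) \<circ> s) \<longlonglongrightarrow> l"
    using bounded_imp_convergent_subsequence by blast
  show ?case
  proof (intro exI[of _ "r \<circ> s"] conjI ballI)
    show "strict_mono (r \<circ> s)" using r(1) s(1) by (rule strict_mono_o)
    fix i assume "i \<in> insert j J"
    then show "convergent (\<lambda>n. X ((r \<circ> s) n) i)"
      using s(2) convergent_subseq_convergent[OF r(2) s(1), of i]
      by (auto simp: convergent_def comp_def)
  qed
qed

text \<open>The mean ergodic theorem for bounded powers of a finite matrix. The product of two means
  is the double mean \<open>T n k\<close>, which is symmetric in \<open>n\<close> and
  \<open>k\<close> and close to \<open>S n\<close> for \<open>n\<close> much larger than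
  \<open>k\<close>. So a subsequential limit \<open>P\<close> satisfies \<open>S n P = P\<close> for
  every \<open>n \<ge> 1\<close>, and this forces the whole sequence to converge to
  \<open>P\<close>.\<close>

lemma cesaro_means_convergent:
  fixes a :: "nat \<Rightarrow> 'i \<Rightarrow> 'i \<Rightarrow> complex"
  assumes fin: "finite I"
    and semigroup: "\<And>k l i j. 1 \<le> k \<Longrightarrow> 1 \<le> l \<Longrightarrow> i \<in> I \<Longrightarrow> j \<in> I \<Longrightarrow> (\<Sum>m\<in>I. a k i m * a l m j) = a (k + l) i j"
    and bound: "\<And>k i j. 1 \<le> k \<Longrightarrow> i \<in> I \<Longrightarrow> j \<in> I \<Longrightarrow> cmod (a k i j) \<le> 1"
    and ij: "i \<in> I" "j \<in> I"
  shows "convergent (\<lambda>n. (1 / of_nat n) * (\<Sum>k=1..n. a k i j))"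
proof -
  define S where "S n i j = (1 / of_nat n) * (\<Sum>k=1..n. a k i j)" for n i j
  define T where "T n k i j = (1 / of_nat n) * ((1 / of_nat k) * (\<Sum>p=1..n. \<Sum>l=1..k. a (p + l) i j))" for n k i j
  have S_bound: "cmod (S n i j) \<le> 1" if "i \<in> I" "j \<in> I" for n i j
  proof -
    have "cmod (\<Sum>k=1..n. a k i j) \<le> (\<Sum>k=1..n. 1)" using that bound by (intro sum_norm_le) auto
    then show ?thesis by (cases "n = 0") (simp_all add: S_def norm_mult norm_divide field_simps)
  qed
  have S_mult: "(\<Sum>m\<in>I. S n i m * S k m j) = T n k i j" if "i \<in> I" "j \<in> I" for n k i j
  proof -
    have "(\<Sum>m\<in>I. S n i m * S k m j) = (1 / of_nat n) * ((1 / of_nat k) *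
        (\<Sum>m\<in>I. (\<Sum>p=1..n. a p i m) * (\<Sum>l=1..k. a l m j)))"
      by (simp add: S_def sum_distrib_left mult_ac)
    also have "(\<Sum>m\<in>I. (\<Sum>p=1..n. a p i m) * (\<Sum>l=1..k. a l m j))
        = (\<Sum>m\<in>I. \<Sum>p=1..n. \<Sum>l=1..k. a p i m * a l m j)"
      by (simp add: sum_product)
    also have "\<dots> = (\<Sum>p=1..n. \<Sum>m\<in>I. \<Sum>l=1..k. a p i m * a l m j)"
      by (rule sum.swap)
    also have "\<dots> = (\<Sum>p=1..n. \<Sum>l=1..k. \<Sum>m\<in>I. a p i m * a l m j)"
      by (intro sum.cong refl sum.swap)
    also have "\<dots> = (\<Sum>p=1..n. \<Sum>l=1..k. a (p + l) i j)"
      using that by (intro sum.cong refl semigroup) auto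
    finally show ?thesis by (simp add: T_def)
  qed
  have T_commute: "T n k i j = T k n i j" for n k i j
    unfolding T_def by (subst sum.swap) (simp add: add.commute)
  have shift: "cmod ((\<Sum>p=1..n. a p i j) - (\<Sum>p=1..n. a (p + l) i j)) \<le> 2 * real l" if "i \<in> I" "j \<in> I" for n l i j
  proof -
    have bd: "cmod (\<Sum>p=c+1..c+l. a p i j) \<le> real l" for c
    proof -
      have "cmod (\<Sum>p=c+1..c+l. a p i j) \<le> (\<Sum>p=c+1..c+l. 1)"
        using that bound by (intro sum_norm_le) auto
      then show ?thesis by simp
    qed
    have "(\<Sum>p=1..n. a p i j) + (\<Sum>p=n+1..n+l. a p i j) = (\<Sum>p=1..n+l. a p i j)"
      using sum.ub_add_nat[of 1 n "\<lambda>p. a p i j" l] by simp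
    also have "\<dots> = (\<Sum>p=1..l. a p i j) + (\<Sum>p=l+1..l+n. a p i j)"
      using sum.ub_add_nat[of 1 l "\<lambda>p. a p i j" n] by (simp add: add.commute)
    also have "(\<Sum>p=l+1..l+n. a p i j) = (\<Sum>p=1..n. a (p + l) i j)"
      using sum.shift_bounds_cl_nat_ivl[of "\<lambda>p. a p i j" 1 l n] by (simp add: add.commute)
    finally have "(\<Sum>p=1..n. a p i j) - (\<Sum>p=1..n. a (p + l) i j) = (\<Sum>p=1..l. a p i j) - (\<Sum>p=n+1..n+l. a p i j)"
      by (simp add: algebra_simps)
    then show ?thesis
      using bd[of 0] bd[of n] norm_triangle_ineq4[of "\<Sum>p=1..l. a p i j" "\<Sum>p=n+1..n+l. a p i j"] by simp
  qed
  have S_T: "cmod (S n i j - T n k i j) \<le> 2 * real k / real n" if "1 \<le> n" "1 \<le> k" "i \<in> I" "j \<in> I" for n k i j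
  proof -
    have "S n i j = (1 / of_nat n) * ((1 / of_nat k) * (\<Sum>l=1..k. \<Sum>p=1..n. a p i j))"
      using that by (simp add: S_def)
    moreover have "T n k i j = (1 / of_nat n) * ((1 / of_nat k) * (\<Sum>l=1..k. \<Sum>p=1..n. a (p + l) i j))"
      unfolding T_def by (subst sum.swap) simp
    ultimately have "S n i j - T n k i j = (1 / of_nat n) * ((1 / of_nat k) *
        (\<Sum>l=1..k. (\<Sum>p=1..n. a p i j) - (\<Sum>p=1..n. a (p + l) i j)))"
      by (simp only: sum_subtractf right_diff_distrib)
    moreover have "cmod (\<Sum>l=1..k. (\<Sum>p=1..n. a p i j) - (\<Sum>p=1..n. a (p + l) i j)) \<le> (\<Sum>l=1..k. 2 * real k)"
      using that by (intro sum_norm_le order_trans[OF shift]) auto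
    ultimately obtain D where D: "S n i j - T n k i j = (1 / of_nat n) * ((1 / of_nat k) * D)"
        "cmod D \<le> (\<Sum>l=1..k. 2 * real k)" by blast
    show ?thesis unfolding D(1) using D(2) that by (simp add: norm_mult norm_divide field_simps)
  qed
  obtain r where r: "strict_mono r" "\<And>i j. i \<in> I \<Longrightarrow> j \<in> I \<Longrightarrow> convergent (\<lambda>n. S (r n) i j)"
    using finite_family_convergent_subsequence[of "I \<times> I" "\<lambda>n (i, j). S n i j" 1] fin S_bound by auto
  define P where "P i j = lim (\<lambda>n. S (r n) i j)" for i j
  have P: "(\<lambda>n. S (r n) i j) \<longlonglongrightarrow> P i j" if "i \<in> I" "j \<in> I" for i j
    using r(2)[OF that] by (simp add: P_def convergent_LIMSEQ_iff)
  have r_ge: "k \<le> r k" for k using r(1) by (rule seq_suble)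
  \<comment> \<open>With \<open>n\<close> fixed, \<open>S n\<close> times \<open>S (r k)\<close> is
    \<open>T n (r k) = T (r k) n\<close>, which approaches \<open>S (r k)\<close> as
    \<open>k\<close> grows; both sides are limits of the same sequence.\<close>
  have SP: "(\<Sum>m\<in>I. S n i m * P m j) = P i j" if "1 \<le> n" "i \<in> I" "j \<in> I" for n i j
  proof -
    have "(\<lambda>k. \<Sum>m\<in>I. S n i m * S (r k) m j) \<longlonglongrightarrow> (\<Sum>m\<in>I. S n i m * P m j)"
      using that by (intro tendsto_intros P) auto
    then have lim: "(\<lambda>k. T (r k) n i j) \<longlonglongrightarrow> (\<Sum>m\<in>I. S n i m * P m j)"
      using that by (simp add: S_mult T_commute)
    have "(\<lambda>k. S (r k) i j - T (r k) n i j) \<longlonglongrightarrow> 0"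
    proof (rule Lim_null_comparison)
      show "\<forall>\<^sub>F k in sequentially. norm (S (r k) i j - T (r k) n i j) \<le> 2 * real n / real k"
      proof (rule eventually_sequentiallyI)
        fix k :: nat assume k: "1 \<le> k"
        then have "norm (S (r k) i j - T (r k) n i j) \<le> 2 * real n / real (r k)"
          using that r_ge[of k] by (intro S_T) auto
        also have "\<dots> \<le> 2 * real n / real k"
          using k r_ge[of k] by (intro divide_left_mono) auto
        finally show "norm (S (r k) i j - T (r k) n i j) \<le> 2 * real n / real k" .
      qed
      show "(\<lambda>k. 2 * real n / real k) \<longlonglongrightarrow> 0"
        by (rule real_tendsto_divide_at_top[OF tendsto_const filterlim_real_sequentially])
    qed
    then have "(\<lambda>k. S (r k) i j) \<longlonglongrightarrow> (\<Sum>m\<in>I. S n i m * P m j)"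
      using tendsto_add[OF _ lim] by force
    then show ?thesis using P[OF that(2,3)] LIMSEQ_unique by blast
  qed
  have "(\<lambda>n. S n i j) \<longlonglongrightarrow> P i j"
  proof (rule LIMSEQ_I)
    fix e :: real assume e: "0 < e"
    have "(\<lambda>k. \<Sum>m\<in>I. cmod (S (r k) m j - P m j)) \<longlonglongrightarrow> (\<Sum>m\<in>I. cmod (P m j - P m j))"
      using ij by (intro tendsto_intros P) auto
    then have "(\<lambda>k. \<Sum>m\<in>I. cmod (S (r k) m j - P m j)) \<longlonglongrightarrow> 0" by simp
    then have "\<forall>\<^sub>F k in sequentially. (\<Sum>m\<in>I. cmod (S (r k) m j - P m j)) < e / 2"
      by (rule order_tendstoD(2)) (use e in simp)
    then have "\<forall>\<^sub>F k in sequentially. 1 \<le> k \<and> (\<Sum>m\<in>I. cmod (S (r k) m j - P m j)) < e / 2"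
      by (intro eventually_conj eventually_ge_at_top)
    then obtain k where k: "1 \<le> k" "(\<Sum>m\<in>I. cmod (S (r k) m j - P m j)) < e / 2"
      using eventually_happens'[OF sequentially_bot] by blast
    have rk: "1 \<le> r k" using r_ge[of k] k by linarith
    obtain N :: nat where N: "real N > 4 * real (r k) / e" using reals_Archimedean2 by blast
    show "\<exists>no. \<forall>n\<ge>no. cmod (S n i j - P i j) < e"
    proof (intro exI allI impI)
      fix n assume n: "N + 1 \<le> n"
      have "4 * real (r k) / e < real n" using N n by linarith
      then have 1: "2 * real (r k) / real n \<le> e / 2" using e n by (simp add: field_simps)
      \<comment> \<open>\<open>S n P = P\<close> turns the difference into
        \<open>S n (S (r k) - P)\<close>, small uniformly in \<open>n\<close> because the entries of
        \<open>S n\<close> are bounded by 1.\<close>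
      have "T n (r k) i j - P i j = (\<Sum>m\<in>I. S n i m * (S (r k) m j - P m j))"
        using n ij by (simp add: S_mult[symmetric] SP[symmetric, of n i j] right_diff_distrib sum_subtractf)
      also have "cmod \<dots> \<le> (\<Sum>m\<in>I. cmod (S (r k) m j - P m j))"
      proof (rule sum_norm_le)
        fix m assume "m \<in> I"
        then show "cmod (S n i m * (S (r k) m j - P m j)) \<le> cmod (S (r k) m j - P m j)"
          using S_bound[OF ij(1), of m n] by (simp add: norm_mult mult_left_le_one_le)
      qed
      finally have 2: "cmod (T n (r k) i j - P i j) < e / 2" using k(2) by linarith
      have "cmod (S n i j - P i j) \<le> cmod (S n i j - T n (r k) i j) + cmod (T n (r k) i j - P i j)"
        using norm_triangle_ineq[of "S n i j - T n (r k) i j" "T n (r k) i j - P i j"] by simp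
      then show "cmod (S n i j - P i j) < e"
        using 1 2 S_T[of n "r k" i j] n rk ij by simp
    qed
  qed
  then show ?thesis by (auto simp: S_def convergent_def)
qed

text \<open>The vector \<open>v = e_b - P e_b\<close> lies in the kernel, so \<open>P\<close> maps
  \<open>P e_a + s v\<close> to \<open>P e_a\<close>. If \<open>v\<close> were not orthogonal to
  \<open>P e_a\<close>, some \<open>s\<close> would make the former shorter than its image. Hence
  the adjoint of \<open>P\<close> equals the adjoint times \<open>P\<close>, which is
  self-adjoint.\<close>

lemma contractive_idempotent_hermitian:
  fixes P :: "'i \<Rightarrow> 'i \<Rightarrow> complex"
  assumes fin: "finite I"
    and idem: "\<And>i j. i \<in> I \<Longrightarrow> j \<in> I \<Longrightarrow> (\<Sum>m\<in>I. P i m * P m j) = P i j"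
    and contr: "\<And>x. (\<Sum>i\<in>I. (cmod (\<Sum>j\<in>I. P i j * x j))\<^sup>2) \<le> (\<Sum>i\<in>I. (cmod (x i))\<^sup>2)"
    and ab: "a \<in> I" "b \<in> I"
  shows "P b a = cnj (P a b)"
proof -
  have orth: "cnj (P b a) = (\<Sum>i\<in>I. cnj (P i a) * P i b)" if ab: "a \<in> I" "b \<in> I" for a b
  proof -
    define v where "v i = (if i = b then 1 else 0) - P i b" for i
    have delta: "(\<Sum>j\<in>I. f j * (if j = b then 1 else 0)) = f b" for f :: "'i \<Rightarrow> complex"
      using ab fin by (simp add: if_distrib[of "(*) _"] cong: if_cong)
    define q where "q = (\<Sum>i\<in>I. cnj (P i a) * v i)"
    define V where "V = (\<Sum>i\<in>I. (cmod (v i))\<^sup>2)"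
    have V: "V \<ge> 0" unfolding V_def by (intro sum_nonneg) auto
    \<comment> \<open>The minimiser is \<open>- cnj q / V\<close>; \<open>V + 1\<close> avoids
      division by zero and still changes the square norm by
      \<open>(cmod q)\<^sup>2 (V / (V + 1) - 2) / (V + 1)\<close>, which is negative if
      \<open>q \<noteq> 0\<close>.\<close>
    define s where "s = - of_real (1 / (V + 1)) * cnj q"
    have Pw: "(\<Sum>j\<in>I. P i j * (P j a + s * v j)) = P i a" if "i \<in> I" for i
    proof -
      have "(\<Sum>j\<in>I. P i j * v j) = 0"
        using that ab idem by (simp only: v_def right_diff_distrib sum_subtractf delta) simp
      then show ?thesis
        using idem[OF that ab(1)]
        by (simp add: distrib_left sum.distrib mult.left_commute[of _ s] flip: sum_distrib_left)
    qed
    have "(\<Sum>i\<in>I. (cmod (P i a))\<^sup>2) \<le> (\<Sum>i\<in>I. (cmod (P i a + s * v i))\<^sup>2)"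
      using contr[of "\<lambda>j. P j a + s * v j"] by (simp add: Pw)
    also have "\<dots> = (\<Sum>i\<in>I. (cmod (P i a))\<^sup>2 + (2 * Re (s * (cnj (P i a) * v i)) + (cmod s)\<^sup>2 * (cmod (v i))\<^sup>2))"
    proof (rule sum.cong)
      fix i
      have "(cmod (x + y))\<^sup>2 = (cmod x)\<^sup>2 + (2 * Re (cnj x * y) + (cmod y)\<^sup>2)" for x y
        unfolding cmod_power2 by (simp add: power2_eq_square algebra_simps)
      from this[of "P i a" "s * v i"]
      show "(cmod (P i a + s * v i))\<^sup>2
          = (cmod (P i a))\<^sup>2 + (2 * Re (s * (cnj (P i a) * v i)) + (cmod s)\<^sup>2 * (cmod (v i))\<^sup>2)"
        by (simp only: norm_mult power_mult_distrib mult.left_commute[of s])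
    qed simp
    also have "\<dots> = (\<Sum>i\<in>I. (cmod (P i a))\<^sup>2) + (2 * Re (s * q) + (cmod s)\<^sup>2 * V)"
      by (simp only: sum.distrib q_def V_def sum_distrib_left Re_sum)
    finally have le: "0 \<le> 2 * Re (s * q) + (cmod s)\<^sup>2 * V" by simp
    have "s * q = of_real (- (1 / (V + 1))) * (q * cnj q)"
      by (simp add: s_def mult_ac)
    then have "s * q = of_real (- (1 / (V + 1)) * (cmod q)\<^sup>2)"
      by (simp only: complex_norm_square[symmetric] of_real_mult)
    moreover have "(cmod s)\<^sup>2 = (1 / (V + 1))\<^sup>2 * (cmod q)\<^sup>2"
      by (simp only: s_def norm_mult norm_minus_cancel norm_of_real complex_mod_cnj power_mult_distrib power2_abs)
    ultimately have "0 \<le> 2 * (- (1 / (V + 1)) * (cmod q)\<^sup>2) + (1 / (V + 1))\<^sup>2 * (cmod q)\<^sup>2 * V"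
      using le by (simp only: Re_complex_of_real)
    also have "\<dots> = (cmod q)\<^sup>2 * ((1 / (V + 1)) * (V / (V + 1) - 2))"
      by (simp add: power2_eq_square algebra_simps)
    finally have "0 \<le> (cmod q)\<^sup>2 * ((1 / (V + 1)) * (V / (V + 1) - 2))" .
    moreover have "(1 / (V + 1)) * (V / (V + 1) - 2) < 0"
      using V by (intro mult_pos_neg) (auto simp: field_simps)
    ultimately have "(cmod q)\<^sup>2 \<le> 0" by (metis mult_pos_neg not_less)
    then have "q = 0" by simp
    moreover have "q = cnj (P b a) - (\<Sum>i\<in>I. cnj (P i a) * P i b)"
      by (simp only: q_def v_def right_diff_distrib sum_subtractf delta)
    ultimately show ?thesis by simp
  qed
  have "P b a = cnj (\<Sum>i\<in>I. cnj (P i a) * P i b)" by (simp flip: orth[OF ab])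
  also have "\<dots> = (\<Sum>i\<in>I. cnj (P i b) * P i a)" by (simp add: mult.commute)
  finally show ?thesis by (simp flip: orth[OF ab(2,1)])
qed

section \<open>Permutation matrices\<close>

lemma
  shows finite_UNIV_perm: "finite (UNIV :: 'n::finite perm set)"
    and card_UNIV_perm: "card (UNIV :: 'n perm set) = fact CARD('n)"
proof -
  have inj: "inj (Perm.apply :: 'n perm \<Rightarrow> _)" by (rule injI) (simp add: perm_eq_iff)
  have "range (Perm.apply :: 'n perm \<Rightarrow> _) = {p. p permutes UNIV}"
  proof (intro equalityI subsetI)
    fix p assume "p \<in> range (Perm.apply :: 'n perm \<Rightarrow> _)"
    then show "p \<in> {p. p permutes UNIV}" by (auto intro!: bij_imp_permutes)
  next
    fix p :: "'n \<Rightarrow> 'n" assume "p \<in> {p. p permutes UNIV}"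
    then have "bij p" by (auto simp: permutes_bij)
    then have "Perm.apply (Perm p) = p" by (simp add: Perm_inverse)
    then show "p \<in> range Perm.apply" by (metis rangeI)
  qed
  then have "bij_betw Perm.apply (UNIV :: 'n perm set) {p. p permutes (UNIV :: 'n set)}"
    using inj by (simp add: bij_betw_def)
  then show "finite (UNIV :: 'n perm set)" "card (UNIV :: 'n perm set) = fact CARD('n)"
    using card_permutations[of "UNIV :: 'n set"] finite_permutations[of "UNIV :: 'n set"]
    by (auto simp: bij_betw_finite bij_betw_same_card)
qed

lemma continuous_on_perm: "continuous_on S (f :: 'n perm \<Rightarrow> 'b::topological_space)"
proof (rule continuous_on_subset)
  have "open (A :: 'n perm set)" for A
    unfolding open_dist by (auto simp: dist_perm_def intro!: exI[of _ "1/2"] split: if_splits)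
  then show "continuous_on UNIV f" by (simp add: continuous_on_open_vimage)
qed simp

lemma apply_Bcontfun_perm: "apply_bcontfun (Bcontfun f) = (f :: 'n::finite perm \<Rightarrow> complex)"
proof (rule Bcontfun_inverse)
  have "bounded (range f)" by (intro finite_imp_bounded finite_imageI finite_UNIV_perm)
  then show "f \<in> bcontfun" by (simp add: bcontfun_def continuous_on_perm)
qed

lemma
  fixes f g :: "'n C_perm"
  shows bcontfun_times: "apply_bcontfun (f * g) \<sigma> = apply_bcontfun f \<sigma> * apply_bcontfun g \<sigma>"
    and bcontfun_one: "apply_bcontfun (1 :: 'n C_perm) \<sigma> = 1"
    and bcontfun_star: "apply_bcontfun (star f) \<sigma> = cnj (apply_bcontfun f \<sigma>)"
    and bcontfun_scaleC: "apply_bcontfun (scaleC c f) \<sigma> = c * apply_bcontfun f \<sigma>"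
    and bcontfun_sum: "apply_bcontfun (\<Sum>i\<in>I. h i :: 'n C_perm) \<sigma> = (\<Sum>i\<in>I. apply_bcontfun (h i) \<sigma>)"
proof -
  show "apply_bcontfun (\<Sum>i\<in>I. h i :: 'n C_perm) \<sigma> = (\<Sum>i\<in>I. apply_bcontfun (h i) \<sigma>)"
    by (induction I rule: infinite_finite_induct) auto
qed (simp_all add: times_bcontfun.rep_eq one_bcontfun.rep_eq star_bcontfun.rep_eq scaleC_bcontfun.rep_eq
      star_complex_def scaleC_complex_def)

definition perm_entry :: "'n::finite \<Rightarrow> 'n \<Rightarrow> 'n C_perm"
  where "perm_entry i j = Bcontfun (\<lambda>\<sigma>. if Perm.apply \<sigma> j = i then 1 else 0)"

lemma apply_perm_entry: "apply_bcontfun (perm_entry i j) \<sigma> = (if Perm.apply \<sigma> j = i then 1 else 0)"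
  by (simp add: perm_entry_def apply_Bcontfun_perm)

lemma magic_unitary_perm_entry: "magic_unitary (perm_entry :: 'n::finite \<Rightarrow> _)"
  unfolding magic_unitary_def
proof (intro conjI allI bcontfun_eqI)
  fix i :: 'n and \<sigma> :: "'n perm"
  have "(Perm.apply \<sigma> j = i) = (j = inv (Perm.apply \<sigma>) i)" for j
    using bij_inv_eq_iff[of "Perm.apply \<sigma>" j i] by auto
  then show "apply_bcontfun (\<Sum>j\<in>UNIV. perm_entry i j) \<sigma> = apply_bcontfun 1 \<sigma>"
    by (simp add: bcontfun_sum bcontfun_one apply_perm_entry)
qed (simp_all add: bcontfun_times bcontfun_star bcontfun_sum bcontfun_one apply_perm_entry)

lemma
  assumes u: "universal_magic_unitary u"
  shows abelianisation_star_hom: "star_hom (abelianisation u)"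
    and abelianisation_entry: "abelianisation u (u i j) = perm_entry i j"
proof -
  have eq: "(\<forall>i j \<sigma>. apply_bcontfun (\<pi> (u i j)) \<sigma> = (if Perm.apply \<sigma> j = i then 1 else 0))
      = (\<forall>i j. \<pi> (u i j) = perm_entry i j)" for \<pi>
    by (auto simp: apply_perm_entry intro!: bcontfun_eqI)
  show "star_hom (abelianisation u)" "abelianisation u (u i j) = perm_entry i j"
    using theI'[OF universal_star_hom_ex1[OF u magic_unitary_perm_entry]]
    unfolding abelianisation_def eq by auto
qed

lemma abelianisation_entry_word:
  assumes "universal_magic_unitary u" "length is = length js"
  shows "apply_bcontfun (abelianisation u (entry_word u is js)) \<sigma> = (if map (Perm.apply \<sigma>) js = is then 1 else 0)"
  unfolding star_hom_entry_word[OF abelianisation_star_hom[OF assms(1)]] abelianisation_entry[OF assms(1)]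
  using assms(2)
  by (induction "is" js rule: list_induct2) (simp_all add: bcontfun_one bcontfun_times apply_perm_entry)

lemma complex_cnj_mult_nonneg: "cnj z * z \<in> \<real>\<^sub>\<ge>\<^sub>0"
  by (simp add: complex_nonneg_Reals_iff)

lemma nonneg_Reals_sum: "(\<And>i. i \<in> I \<Longrightarrow> f i \<in> \<real>\<^sub>\<ge>\<^sub>0) \<Longrightarrow> (\<Sum>i\<in>I. f i) \<in> \<real>\<^sub>\<ge>\<^sub>0"
  by (induction I rule: infinite_finite_induct) auto

lemma state_uniform_state: "state (uniform_state :: 'n::finite C_perm \<Rightarrow> complex)"
proof -
  have "(\<Sum>\<sigma>\<in>UNIV. cnj (apply_bcontfun f \<sigma>) * apply_bcontfun f \<sigma>) / of_nat (fact CARD('n)) \<in> \<real>\<^sub>\<ge>\<^sub>0"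
    for f :: "'n C_perm"
    by (intro nonneg_Reals_divide_I nonneg_Reals_sum complex_cnj_mult_nonneg) (simp add: complex_nonneg_Reals_iff)
  then show ?thesis
    by (simp add: state_def clinear_def uniform_state_def bcontfun_times bcontfun_star bcontfun_one bcontfun_scaleC
      sum.distrib add_divide_distrib sum_distrib_left card_UNIV_perm)
qed

lemma state_haar_classical: "universal_magic_unitary u \<Longrightarrow> state (haar_classical u)"
  unfolding haar_classical_def by (intro state_comp_star_hom state_uniform_state abelianisation_star_hom)

lemma haar_classical_entry_word:
  fixes u :: "'n::finite \<Rightarrow> 'n \<Rightarrow> 'a::cstar_algebra"
  assumes "universal_magic_unitary u" "length is = length js"
  shows "haar_classical u (entry_word u is js)
    = (\<Sum>\<sigma>\<in>UNIV. if map (Perm.apply \<sigma>) js = is then 1 else 0) / of_nat (fact CARD('n))"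
  by (simp add: haar_classical_def uniform_state_def abelianisation_entry_word[OF assms])

lemma state_perm_eval:
  assumes "universal_magic_unitary u"
  shows "state (perm_eval u \<sigma>)"
proof -
  note h = abelianisation_star_hom[OF assms]
  show ?thesis
    by (simp add: state_def clinear_def perm_eval_def star_hom_add[OF h] star_hom_scaleC[OF h] star_hom_mult[OF h]
      star_hom_star[OF h] star_hom_one[OF h] bcontfun_times bcontfun_star bcontfun_one bcontfun_scaleC
      complex_cnj_mult_nonneg)
qed

section \<open>Convolution of states\<close>

definition words :: "nat \<Rightarrow> 'n list set"
  where "words m = {ks. length ks = m}"

lemma in_words_iff [simp]: "ks \<in> words m \<longleftrightarrow> length ks = m"
  by (simp add: words_def)

lemma finite_words [simp]: "finite (words m :: 'n::finite list set)"
  using finite_lists_length_eq[of "UNIV :: 'n set" m] by (simp add: words_def)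

lemma words_0 [simp]: "words 0 = {[]}"
  by (auto simp: words_def)

lemma sum_words_Suc: "(\<Sum>ks\<in>words (Suc m). f ks) = (\<Sum>k\<in>(UNIV :: 'n::finite set). \<Sum>ks\<in>words m. f (k # ks))"
proof -
  have "words (Suc m) = (\<lambda>(k, ks). k # ks) ` ((UNIV :: 'n set) \<times> words m)"
    by (auto simp: words_def length_Suc_conv image_iff)
  moreover have "inj_on (\<lambda>(k, ks). k # ks) ((UNIV :: 'n set) \<times> words m)"
    by (auto simp: inj_on_def)
  ultimately show ?thesis
    by (simp add: sum.reindex case_prod_unfold comp_def sum.cartesian_product)
qed

text \<open>In \<open>star (entry_word u is js) * entry_word u is js'\<close> the two first letters
  meet in the middle; summing over the first row index collapses them to a scalar, and the induction
  continues with the tails. In matrix terms, tensor powers of \<open>u\<close> are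
  isometries.\<close>

lemma magic_unitary_words:
  fixes u :: "'n::finite \<Rightarrow> 'n \<Rightarrow> 'a::cstar_algebra"
  assumes u: "magic_unitary u" and "length js = length js'"
  shows "(\<Sum>is\<in>words (length js). star (entry_word u is js) * entry_word u is js') = (if js = js' then 1 else 0)"
  using assms(2)
proof (induction js js' rule: list_induct2)
  case (Cons j js j' js')
  have col: "(\<Sum>i\<in>UNIV. u i j * u i j') = (if j = j' then 1 else 0)"
    using magic_row_orthogonal[OF u, of j j'] by (simp add: magic_idem[OF u] magic_col[OF u])
  have *: "(\<Sum>i\<in>UNIV. x * (u i j * (u i j' * y))) = (if j = j' then x * y else 0)" for x y
  proof -
    have "(\<Sum>i\<in>UNIV. x * (u i j * (u i j' * y))) = x * (\<Sum>i\<in>UNIV. u i j * u i j') * y"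
      by (simp add: sum_distrib_left sum_distrib_right mult.assoc)
    then show ?thesis unfolding col by simp
  qed
  have "(\<Sum>is\<in>words (length (j # js)). star (entry_word u is (j # js)) * entry_word u is (j' # js'))
      = (\<Sum>is\<in>words (length js). \<Sum>i\<in>UNIV. star (entry_word u is js) * (u i j * (u i j' * entry_word u is js')))"
    by (simp add: sum_words_Suc star_mult magic_star[OF u] mult.assoc) (rule sum.swap)
  also have "\<dots> = (if j = j' then \<Sum>is\<in>words (length js). star (entry_word u is js) * entry_word u is js' else 0)"
    by (simp add: *)
  finally show ?case unfolding Cons.IH by (auto split: if_splits)
qed simp

text \<open>Cauchy-Schwarz for \<open>\<alpha>\<close> at each \<open>z is\<close>, the row
  \<open>is\<close> of the word matrix applied to \<open>x\<close>; the isometry relation makes the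
  sum of the \<open>star (z is) * z is\<close> a scalar. A state thus slices an isometry into a
  contraction.\<close>

lemma state_words_contractive:
  fixes u :: "'n::finite \<Rightarrow> 'n \<Rightarrow> 'a::cstar_algebra"
  assumes u: "magic_unitary u" and \<alpha>: "state \<alpha>"
  shows "(\<Sum>is\<in>words m. (cmod (\<Sum>js\<in>words m. \<alpha> (entry_word u is js) * x js))\<^sup>2) \<le> (\<Sum>js\<in>words m. (cmod (x js))\<^sup>2)"
proof -
  define z where "z is = (\<Sum>js\<in>words m. scaleC (x js) (entry_word u is js))" for "is"
  have "(\<Sum>is\<in>words m. star (z is) * z is)
      = (\<Sum>is\<in>words m. \<Sum>js\<in>words m. \<Sum>js'\<in>words m.
          scaleC (cnj (x js) * x js') (star (entry_word u is js) * entry_word u is js'))"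
    by (simp add: z_def star_sum sum_product star_scaleC scaleC_mult_left scaleC_mult_right scaleC_scaleC mult.commute)
  also have "\<dots> = (\<Sum>js\<in>words m. \<Sum>is\<in>words m. \<Sum>js'\<in>words m.
          scaleC (cnj (x js) * x js') (star (entry_word u is js) * entry_word u is js'))"
    by (rule sum.swap)
  also have "\<dots> = (\<Sum>js\<in>words m. \<Sum>js'\<in>words m. \<Sum>is\<in>words m.
          scaleC (cnj (x js) * x js') (star (entry_word u is js) * entry_word u is js'))"
    by (intro sum.cong refl sum.swap)
  also have "\<dots> = (\<Sum>js\<in>words m. \<Sum>js'\<in>words m. if js = js' then scaleC (cnj (x js) * x js') 1 else 0)"
  proof (intro sum.cong refl)
    fix js js' :: "'n list" assume "js \<in> words m" "js' \<in> words m"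
    then show "(\<Sum>is\<in>words m. scaleC (cnj (x js) * x js') (star (entry_word u is js) * entry_word u is js'))
        = (if js = js' then scaleC (cnj (x js) * x js') 1 else 0)"
      using magic_unitary_words[OF u, of js js'] by (simp flip: scaleC_sum)
  qed
  also have "\<dots> = (\<Sum>js\<in>words m. scaleC (of_real ((cmod (x js))\<^sup>2)) 1)"
    by (simp add: complex_norm_square mult.commute del: of_real_power)
  finally have zz: "(\<Sum>is\<in>words m. star (z is) * z is) = (\<Sum>js\<in>words m. scaleC (of_real ((cmod (x js))\<^sup>2)) 1)" .
  have "(\<Sum>is\<in>words m. (cmod (\<Sum>js\<in>words m. \<alpha> (entry_word u is js) * x js))\<^sup>2)
      = (\<Sum>is\<in>words m. (cmod (\<alpha> (z is)))\<^sup>2)"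
    by (simp add: z_def state_linear[OF \<alpha>] mult.commute)
  also have "\<dots> \<le> (\<Sum>is\<in>words m. Re (\<alpha> (star (z is) * z is)))"
    by (intro sum_mono state_cauchy_schwarz[OF \<alpha>])
  also have "\<dots> = Re (\<alpha> (\<Sum>is\<in>words m. star (z is) * z is))"
    by (simp add: state_linear[OF \<alpha>])
  also have "\<dots> = (\<Sum>js\<in>words m. (cmod (x js))\<^sup>2)"
    unfolding zz by (simp add: state_linear[OF \<alpha>] state_one[OF \<alpha>] del: of_real_power)
  finally show ?thesis .
qed

lemma weak_star_lim_eq:
  assumes "\<And>a. (\<lambda>n. X n a) \<longlonglongrightarrow> \<psi> a"
  shows "weak_star_lim X = \<psi>"
  unfolding weak_star_lim_def
proof (rule the_equality)
  show "\<forall>a. (\<lambda>n. X n a) \<longlonglongrightarrow> \<psi> a" using assms by blast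
  show "\<psi>' = \<psi>" if "\<forall>a. (\<lambda>n. X n a) \<longlonglongrightarrow> \<psi>' a" for \<psi>'
    using that assms LIMSEQ_unique by blast
qed

lemma dense_convergent:
  fixes X :: "nat \<Rightarrow> 'a::metric_space \<Rightarrow> 'b::complete_space"
  assumes dense: "closure (range e) = UNIV"
    and lip: "\<And>n x y. dist (X n x) (X n y) \<le> dist x y"
    and conv: "\<And>y. convergent (\<lambda>n. X n (e y))"
  shows "convergent (\<lambda>n. X n x)"
  unfolding Cauchy_convergent_iff[symmetric]
proof (rule metric_CauchyI)
  fix \<epsilon> :: real assume \<epsilon>: "0 < \<epsilon>"
  obtain y where y: "dist (e y) x < \<epsilon> / 3"
    using dense \<epsilon> closure_approachable[of x "range e"] by (metis UNIV_I divide_pos_pos rangeE zero_less_numeral)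
  obtain M where M: "\<And>m n. m \<ge> M \<Longrightarrow> n \<ge> M \<Longrightarrow> dist (X m (e y)) (X n (e y)) < \<epsilon> / 3"
    using metric_CauchyD[OF convergent_Cauchy[OF conv[of y]], of "\<epsilon> / 3"] \<epsilon> by auto
  have "dist (X m x) (X n x) < \<epsilon>" if "m \<ge> M" "n \<ge> M" for m n
  proof -
    have "dist (X m x) (X n x) \<le> dist (X m x) (X m (e y)) + dist (X m (e y)) (X n x)"
      by (rule dist_triangle)
    also have "dist (X m (e y)) (X n x) \<le> dist (X m (e y)) (X n (e y)) + dist (X n (e y)) (X n x)"
      by (rule dist_triangle)
    finally show ?thesis
      using lip[of m x "e y"] lip[of n "e y" x] M[OF that] y by (simp add: dist_commute)
  qed
  then show "\<exists>M. \<forall>m\<ge>M. \<forall>n\<ge>M. dist (X m x) (X n x) < \<epsilon>" by blast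
qed

text \<open>The hypothesis starts at \<open>n = 1\<close> because a mean over no terms is the zero
  functional and not a state.\<close>

lemma state_limit:
  assumes X: "\<And>n. 1 \<le> n \<Longrightarrow> state (X n)" and lim: "\<And>a. (\<lambda>n. X n a) \<longlonglongrightarrow> f a"
  shows "state f"
proof -
  have ev: "\<forall>\<^sub>F n in sequentially. P n" if "\<And>n. 1 \<le> n \<Longrightarrow> P n" for P
    using that by (rule eventually_sequentiallyI)
  have "f (x + y) = f x + f y" for x y
  proof (rule LIMSEQ_unique[OF lim])
    show "(\<lambda>n. X n (x + y)) \<longlonglongrightarrow> f x + f y"
      by (rule Lim_transform_eventually[OF tendsto_add[OF lim lim]]) (rule ev, simp add: state_linear[OF X])
  qed
  moreover have "f (scaleC c x) = c * f x" for c x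
  proof (rule LIMSEQ_unique[OF lim])
    show "(\<lambda>n. X n (scaleC c x)) \<longlonglongrightarrow> c * f x"
      by (rule Lim_transform_eventually[OF tendsto_mult_left[OF lim]]) (rule ev, simp add: state_linear[OF X])
  qed
  moreover have "f (star x * x) \<in> \<real>\<^sub>\<ge>\<^sub>0" for x
    by (rule Lim_in_closed_set[OF closed_nonneg_Reals_complex _ _ lim]) (rule ev, simp_all add: state_nonneg[OF X])
  moreover have "f 1 = 1"
  proof (rule LIMSEQ_unique[OF lim])
    show "(\<lambda>n. X n 1) \<longlonglongrightarrow> 1"
      by (rule Lim_transform_eventually[OF tendsto_const]) (rule ev, simp add: state_one[OF X])
  qed
  ultimately show ?thesis by (simp add: state_def clinear_def)
qed

lemma state_mean:
  assumes "1 \<le> n" "\<And>k. 1 \<le> k \<Longrightarrow> state (X k)"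
  shows "state (\<lambda>a. (1 / of_nat n) * (\<Sum>k=1..n. X k a))"
proof -
  have lin: "X k (x + y) = X k x + X k y" "X k (scaleC c x) = c * X k x" "X k 1 = 1" "X k (star x * x) \<in> \<real>\<^sub>\<ge>\<^sub>0"
    if "k \<in> {1..n}" for k x y c
    using assms(2)[of k] that by (auto simp: state_linear state_one state_nonneg)
  have "(1 / of_nat n) * (\<Sum>k=1..n. X k (star x * x)) \<in> \<real>\<^sub>\<ge>\<^sub>0" for x
    by (intro nonneg_Reals_mult_I nonneg_Reals_sum lin) (simp_all add: complex_nonneg_Reals_iff)
  moreover have "(1 / of_nat n) * (\<Sum>k=1..n. X k 1) = (1::complex)"
    using assms(1) by (simp add: lin)
  ultimately show ?thesis
    unfolding state_def clinear_def
    by (simp add: lin sum.distrib distrib_left add_divide_distrib flip: sum_distrib_left)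
qed

section \<open>Convolution as multiplication of word matrices\<close>

locale quantum_permutations =
  fixes u :: "'n::finite \<Rightarrow> 'n \<Rightarrow> 'a::cstar_algebra" and t :: "'a \<Rightarrow> 'a \<Rightarrow> 'b::cstar_algebra"
  assumes universal: "universal_magic_unitary u" and tensor: "min_tensor_product t"
begin

abbreviation convolution (infixl "\<star>" 70)
  where "\<alpha> \<star> \<beta> \<equiv> conv u t \<alpha> \<beta>"

abbreviation "U \<equiv> entry_word u"

lemmas state_eq_words = state_eqI[OF universal]

lemma state_conv: "state \<alpha> \<Longrightarrow> state \<beta> \<Longrightarrow> state (\<alpha> \<star> \<beta>)"
  unfolding conv_def
  by (intro state_comp_star_hom state_tensor_state tensor comult_star_hom universal)

lemma comult_word:
  assumes "length is = length js"
  shows "comult u t (U is js) = (\<Sum>ks\<in>words (length is). t (U is ks) (U ks js))"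
  using assms
proof (induction "is" js rule: list_induct2)
  case Nil
  then show ?case by (simp add: star_hom_one[OF comult_star_hom[OF universal tensor]] tensor_one[OF tensor])
next
  case (Cons i "is" j js)
  then show ?case
    by (simp add: star_hom_mult[OF comult_star_hom[OF universal tensor]] comult_entry[OF universal tensor]
        sum_product sum_words_Suc tensor_mult[OF tensor])
qed

lemma conv_word:
  assumes "state \<alpha>" "state \<beta>" "length is = length js"
  shows "(\<alpha> \<star> \<beta>) (U is js) = (\<Sum>ks\<in>words (length is). \<alpha> (U is ks) * \<beta> (U ks js))"
  using assms
  by (simp add: conv_def comult_word state_linear[OF state_tensor_state[OF tensor]] tensor_state_tensor[OF tensor])

lemma conv_assoc:
  assumes "state \<alpha>" "state \<beta>" "state \<gamma>"
  shows "(\<alpha> \<star> \<beta>) \<star> \<gamma> = \<alpha> \<star> (\<beta> \<star> \<gamma>)"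
proof (rule state_eq_words)
  fix "is" js :: "'n list" assume len: "length is = length js"
  have "((\<alpha> \<star> \<beta>) \<star> \<gamma>) (U is js)
      = (\<Sum>ks\<in>words (length is). \<Sum>ls\<in>words (length is). \<alpha> (U is ls) * \<beta> (U ls ks) * \<gamma> (U ks js))"
    using assms len by (simp add: conv_word state_conv sum_distrib_right)
  also have "\<dots> = (\<Sum>ls\<in>words (length is). \<Sum>ks\<in>words (length is). \<alpha> (U is ls) * \<beta> (U ls ks) * \<gamma> (U ks js))"
    by (rule sum.swap)
  also have "\<dots> = (\<alpha> \<star> (\<beta> \<star> \<gamma>)) (U is js)"
    using assms len by (simp add: conv_word state_conv sum_distrib_left mult.assoc)
  finally show "((\<alpha> \<star> \<beta>) \<star> \<gamma>) (U is js) = (\<alpha> \<star> (\<beta> \<star> \<gamma>)) (U is js)" .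
qed (use assms in \<open>simp_all add: state_conv\<close>)

section \<open>Convolution powers and their Cesaro limits\<close>

lemma conv_pow_one: "conv_pow u t \<alpha> 1 = \<alpha>"
  by (simp add: conv_pow_def)

text \<open>Truncated subtraction gives the powers 0 and 1 the same value, so exponents start at 1
  throughout.\<close>

lemma conv_pow_Suc: "1 \<le> k \<Longrightarrow> conv_pow u t \<alpha> (Suc k) = \<alpha> \<star> conv_pow u t \<alpha> k"
  by (cases k) (simp_all add: conv_pow_def)

lemma state_conv_pow:
  assumes "state \<alpha>" "1 \<le> k"
  shows "state (conv_pow u t \<alpha> k)"
  using assms(2)
proof (induction k rule: dec_induct)
  case base
  then show ?case using assms by (simp only: conv_pow_one)
next
  case (step k)
  then show ?case using assms by (simp only: conv_pow_Suc) (intro state_conv)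
qed

lemma conv_pow_add:
  assumes \<alpha>: "state \<alpha>" and "1 \<le> k" and l: "1 \<le> l"
  shows "conv_pow u t \<alpha> k \<star> conv_pow u t \<alpha> l = conv_pow u t \<alpha> (k + l)"
  using assms(2)
proof (induction k rule: dec_induct)
  case base
  then show ?case using l by (simp add: conv_pow_one[simplified] conv_pow_Suc)
next
  case (step k)
  then show ?case using \<alpha> l by (simp add: conv_pow_Suc conv_assoc state_conv_pow)
qed

definition cesaro_mean :: "('a \<Rightarrow> complex) \<Rightarrow> nat \<Rightarrow> 'a \<Rightarrow> complex"
  where "cesaro_mean \<alpha> n a = (1 / of_nat n) * (\<Sum>k=1..n. conv_pow u t \<alpha> k a)"

lemma state_cesaro_mean: "state \<alpha> \<Longrightarrow> 1 \<le> n \<Longrightarrow> state (cesaro_mean \<alpha> n)"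
  unfolding cesaro_mean_def by (rule state_mean) (simp_all add: state_conv_pow)

lemma norm_entry_word_le:
  assumes "length is = length js"
  shows "norm (U is js) \<le> 1"
  using assms
proof (induction "is" js rule: list_induct2)
  case (Cons i "is" j js)
  then show ?case
    using norm_magic_le[OF universal_magic[OF universal], of i j]
    by (auto intro!: order_trans[OF norm_mult_ineq] mult_le_one)
qed simp

text \<open>Values on words converge as entries of matrix means, linear combinations follow, and a
  common Lipschitz bound carries convergence to the closure. At \<open>n = 0\<close> the mean is
  zero, hence the case distinctions.\<close>

lemma cesaro_mean_convergent:
  assumes \<alpha>: "state \<alpha>"
  shows "convergent (\<lambda>n. cesaro_mean \<alpha> n x)"
proof (rule dense_convergent[OF universal_magic_dense[OF universal]])
  show "dist (cesaro_mean \<alpha> n x) (cesaro_mean \<alpha> n y) \<le> dist x y" for n x y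
    using state_dist_le[OF state_cesaro_mean[OF \<alpha>]]
    by (cases "1 \<le> n") (auto simp: dist_norm cesaro_mean_def not_le)
  have word: "convergent (\<lambda>n. cesaro_mean \<alpha> n (U is js))" if len: "length is = length js" for "is" js
    unfolding cesaro_mean_def
  proof (rule cesaro_means_convergent[of "words (length is)" "\<lambda>k is js. conv_pow u t \<alpha> k (U is js)"])
    show "(\<Sum>ms\<in>words (length is). conv_pow u t \<alpha> k (U ks ms) * conv_pow u t \<alpha> l (U ms ls))
        = conv_pow u t \<alpha> (k + l) (U ks ls)"
      if "1 \<le> k" "1 \<le> l" "ks \<in> words (length is)" "ls \<in> words (length is)" for k l ks ls
      using that \<alpha> by (simp add: conv_pow_add[symmetric] conv_word state_conv_pow)
    show "cmod (conv_pow u t \<alpha> k (U ks ls)) \<le> 1"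
      if "1 \<le> k" "ks \<in> words (length is)" "ls \<in> words (length is)" for k ks ls
      using that \<alpha> by (intro order_trans[OF state_norm_le norm_entry_word_le] state_conv_pow) auto
    show "is \<in> words (length is)" "js \<in> words (length is)" using len by (simp_all add: words_def)
  qed simp
  have lin: "cesaro_mean \<alpha> n (free_eval (\<lambda>(i, j). u i j) f) =
      (\<Sum>w\<in>Poly_Mapping.keys f. Poly_Mapping.lookup f w * cesaro_mean \<alpha> n (U (map fst (letters w)) (map snd (letters w))))" for n f
  proof (cases "1 \<le> n")
    case True
    then show ?thesis
      by (simp add: free_eval_def state_linear[OF state_cesaro_mean[OF \<alpha>]] free_eval_entry_word)
  qed (simp add: cesaro_mean_def not_le)
  show "convergent (\<lambda>n. cesaro_mean \<alpha> n (free_eval (\<lambda>(i, j). u i j) f))" for f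
    unfolding lin by (intro convergent_sum convergent_mult convergent_const word) simp
qed

lemma cesaro_limit_tendsto:
  assumes "state \<alpha>"
  shows "(\<lambda>n. cesaro_mean \<alpha> n x) \<longlonglongrightarrow> cesaro_limit u t \<alpha> x"
proof -
  have "cesaro_limit u t \<alpha> = (\<lambda>x. lim (\<lambda>n. cesaro_mean \<alpha> n x))"
    unfolding cesaro_limit_def cesaro_mean_def[symmetric]
    using cesaro_mean_convergent[OF assms] by (intro weak_star_lim_eq) (simp add: convergent_LIMSEQ_iff)
  then show ?thesis
    using cesaro_mean_convergent[OF assms] by (simp add: convergent_LIMSEQ_iff)
qed

lemma state_cesaro_limit: "state \<alpha> \<Longrightarrow> state (cesaro_limit u t \<alpha>)"
  by (rule state_limit[OF state_cesaro_mean cesaro_limit_tendsto])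

text \<open>Shifting exchanges the first term for a new last one, each of size at most
  \<open>norm x\<close>, and division by \<open>n\<close> removes them. Invariance of the limit
  under convolution with \<open>\<alpha>\<close> follows.\<close>

lemma cesaro_mean_shift:
  assumes \<alpha>: "state \<alpha>"
  shows "(\<lambda>n. (1 / of_nat n) * (\<Sum>k=1..n. conv_pow u t \<alpha> (Suc k) x)) \<longlonglongrightarrow> cesaro_limit u t \<alpha> x"
proof -
  let ?a = "\<lambda>k. conv_pow u t \<alpha> k x"
  have "(\<lambda>n. (1 / of_nat n) * (?a (Suc n) - ?a 1)) \<longlonglongrightarrow> 0"
  proof (rule Lim_null_comparison)
    show "\<forall>\<^sub>F n in sequentially. norm ((1 / of_nat n) * (?a (Suc n) - ?a 1)) \<le> (2 * norm x) / real n"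
    proof (rule always_eventually, rule allI)
      fix n
      have "cmod (?a (Suc n) - ?a 1) \<le> norm x + norm x"
        by (intro order_trans[OF norm_triangle_ineq4] add_mono state_norm_le state_conv_pow \<alpha>) auto
      then show "norm ((1 / of_nat n) * (?a (Suc n) - ?a 1)) \<le> (2 * norm x) / real n"
        by (simp add: norm_mult norm_divide divide_right_mono)
    qed
    show "(\<lambda>n. (2 * norm x) / real n) \<longlonglongrightarrow> 0"
      by (rule real_tendsto_divide_at_top[OF tendsto_const filterlim_real_sequentially])
  qed
  from tendsto_add[OF cesaro_limit_tendsto[OF \<alpha>] this]
  have "(\<lambda>n. cesaro_mean \<alpha> n x + (1 / of_nat n) * (?a (Suc n) - ?a 1)) \<longlonglongrightarrow> cesaro_limit u t \<alpha> x"
    by simp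
  moreover have "cesaro_mean \<alpha> n x + (1 / of_nat n) * (?a (Suc n) - ?a 1)
      = (1 / of_nat n) * (\<Sum>k=1..n. ?a (Suc k))" for n
  proof -
    have "(\<Sum>k=1..n. ?a (Suc k)) = (\<Sum>k=1..n. ?a k) + (?a (Suc n) - ?a 1)"
      by (induction n) auto
    then show ?thesis by (simp only: cesaro_mean_def distrib_left)
  qed
  ultimately show ?thesis by simp
qed

lemma
  assumes \<alpha>: "state \<alpha>" and \<beta>: "state \<beta>" and "1 \<le> n" and len: "length is = length js"
  shows conv_cesaro_mean: "(\<beta> \<star> cesaro_mean \<alpha> n) (U is js) = (1 / of_nat n) * (\<Sum>k=1..n. (\<beta> \<star> conv_pow u t \<alpha> k) (U is js))"
    and cesaro_mean_conv: "(cesaro_mean \<alpha> n \<star> \<beta>) (U is js) = (1 / of_nat n) * (\<Sum>k=1..n. (conv_pow u t \<alpha> k \<star> \<beta>) (U is js))"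
proof -
  let ?W = "words (length is)"
  have "(\<beta> \<star> cesaro_mean \<alpha> n) (U is js)
      = (1 / of_nat n) * (\<Sum>ks\<in>?W. \<Sum>k=1..n. \<beta> (U is ks) * conv_pow u t \<alpha> k (U ks js))"
    using assms by (simp add: conv_word state_cesaro_mean) (simp add: cesaro_mean_def sum_distrib_left sum_divide_distrib mult_ac)
  also have "(\<Sum>ks\<in>?W. \<Sum>k=1..n. \<beta> (U is ks) * conv_pow u t \<alpha> k (U ks js))
      = (\<Sum>k=1..n. \<Sum>ks\<in>?W. \<beta> (U is ks) * conv_pow u t \<alpha> k (U ks js))"
    by (rule sum.swap)
  also have "\<dots> = (\<Sum>k=1..n. (\<beta> \<star> conv_pow u t \<alpha> k) (U is js))"
    using assms by (intro sum.cong refl) (simp add: conv_word state_conv_pow)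
  finally show "(\<beta> \<star> cesaro_mean \<alpha> n) (U is js) = (1 / of_nat n) * (\<Sum>k=1..n. (\<beta> \<star> conv_pow u t \<alpha> k) (U is js))" .
  have "(cesaro_mean \<alpha> n \<star> \<beta>) (U is js)
      = (1 / of_nat n) * (\<Sum>ks\<in>?W. \<Sum>k=1..n. conv_pow u t \<alpha> k (U is ks) * \<beta> (U ks js))"
    using assms by (simp add: conv_word state_cesaro_mean) (simp add: cesaro_mean_def sum_distrib_left sum_distrib_right sum_divide_distrib mult_ac)
  also have "(\<Sum>ks\<in>?W. \<Sum>k=1..n. conv_pow u t \<alpha> k (U is ks) * \<beta> (U ks js))
      = (\<Sum>k=1..n. \<Sum>ks\<in>?W. conv_pow u t \<alpha> k (U is ks) * \<beta> (U ks js))"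
    by (rule sum.swap)
  also have "\<dots> = (\<Sum>k=1..n. (conv_pow u t \<alpha> k \<star> \<beta>) (U is js))"
    using assms by (intro sum.cong refl) (simp add: conv_word state_conv_pow)
  finally show "(cesaro_mean \<alpha> n \<star> \<beta>) (U is js) = (1 / of_nat n) * (\<Sum>k=1..n. (conv_pow u t \<alpha> k \<star> \<beta>) (U is js))" .
qed

lemma
  assumes X: "\<And>n. 1 \<le> n \<Longrightarrow> state (X n)" and lim: "\<And>a. (\<lambda>n. X n a) \<longlonglongrightarrow> f a"
    and \<beta>: "state \<beta>" and len: "length is = length js"
  shows conv_tendsto_right: "(\<lambda>n. (\<beta> \<star> X n) (U is js)) \<longlonglongrightarrow> (\<beta> \<star> f) (U is js)"
    and conv_tendsto_left: "(\<lambda>n. (X n \<star> \<beta>) (U is js)) \<longlonglongrightarrow> (f \<star> \<beta>) (U is js)"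
proof -
  have f: "state f" by (rule state_limit[OF X lim])
  let ?W = "words (length is)"
  have "(\<lambda>n. \<Sum>ks\<in>?W. \<beta> (U is ks) * X n (U ks js)) \<longlonglongrightarrow> (\<beta> \<star> f) (U is js)"
    unfolding conv_word[OF \<beta> f len] by (intro tendsto_intros lim)
  then show "(\<lambda>n. (\<beta> \<star> X n) (U is js)) \<longlonglongrightarrow> (\<beta> \<star> f) (U is js)"
    by (rule Lim_transform_eventually) (rule eventually_sequentiallyI[of 1], simp add: conv_word X \<beta> len)
  have "(\<lambda>n. \<Sum>ks\<in>?W. X n (U is ks) * \<beta> (U ks js)) \<longlonglongrightarrow> (f \<star> \<beta>) (U is js)"
    unfolding conv_word[OF f \<beta> len] by (intro tendsto_intros lim)
  then show "(\<lambda>n. (X n \<star> \<beta>) (U is js)) \<longlonglongrightarrow> (f \<star> \<beta>) (U is js)"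
    by (rule Lim_transform_eventually) (rule eventually_sequentiallyI[of 1], simp add: conv_word X \<beta> len)
qed

lemma
  assumes \<alpha>: "state \<alpha>" and \<beta>: "state \<beta>" and len: "length is = length js"
  shows conv_cesaro_mean_tendsto: "(\<lambda>n. (\<beta> \<star> cesaro_mean \<alpha> n) (U is js)) \<longlonglongrightarrow> (\<beta> \<star> cesaro_limit u t \<alpha>) (U is js)"
    and cesaro_mean_conv_tendsto: "(\<lambda>n. (cesaro_mean \<alpha> n \<star> \<beta>) (U is js)) \<longlonglongrightarrow> (cesaro_limit u t \<alpha> \<star> \<beta>) (U is js)"
  by (rule conv_tendsto_right conv_tendsto_left,
      simp_all add: state_cesaro_mean cesaro_limit_tendsto \<alpha> \<beta> len)+

lemma conv_cesaro_limit:
  assumes \<alpha>: "state \<alpha>"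
  shows "\<alpha> \<star> cesaro_limit u t \<alpha> = cesaro_limit u t \<alpha>"
proof (rule state_eq_words)
  fix "is" js :: "'n list" assume len: "length is = length js"
  have "(\<lambda>n. (\<alpha> \<star> cesaro_mean \<alpha> n) (U is js)) \<longlonglongrightarrow> cesaro_limit u t \<alpha> (U is js)"
    by (rule Lim_transform_eventually[OF cesaro_mean_shift[OF \<alpha>]])
      (rule eventually_sequentiallyI[of 1], simp add: conv_cesaro_mean[OF \<alpha> \<alpha> _ len] conv_pow_Suc)
  then show "(\<alpha> \<star> cesaro_limit u t \<alpha>) (U is js) = cesaro_limit u t \<alpha> (U is js)"
    by (rule LIMSEQ_unique[OF conv_cesaro_mean_tendsto[OF \<alpha> \<alpha> len]])
qed (intro state_conv state_cesaro_limit \<alpha>)+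

lemma cesaro_limit_conv:
  assumes \<alpha>: "state \<alpha>"
  shows "cesaro_limit u t \<alpha> \<star> \<alpha> = cesaro_limit u t \<alpha>"
proof (rule state_eq_words)
  fix "is" js :: "'n list" assume len: "length is = length js"
  have "(\<lambda>n. (cesaro_mean \<alpha> n \<star> \<alpha>) (U is js)) \<longlonglongrightarrow> cesaro_limit u t \<alpha> (U is js)"
    by (rule Lim_transform_eventually[OF cesaro_mean_shift[OF \<alpha>]])
      (rule eventually_sequentiallyI[of 1],
        use conv_pow_add[OF \<alpha>, of _ 1] in \<open>simp add: cesaro_mean_conv[OF \<alpha> \<alpha> _ len] conv_pow_one[simplified]\<close>)
  then show "(cesaro_limit u t \<alpha> \<star> \<alpha>) (U is js) = cesaro_limit u t \<alpha> (U is js)"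
    by (rule LIMSEQ_unique[OF cesaro_mean_conv_tendsto[OF \<alpha> \<alpha> len]])
qed (intro state_conv state_cesaro_limit \<alpha>)+

text \<open>The limit absorbs every power of \<open>\<alpha>\<close>, hence every mean, hence the
  limit of the means.\<close>

lemma cesaro_limit_idempotent:
  assumes \<alpha>: "state \<alpha>"
  shows "cesaro_limit u t \<alpha> \<star> cesaro_limit u t \<alpha> = cesaro_limit u t \<alpha>" (is "?c \<star> ?c = ?c")
proof (rule state_eq_words)
  fix "is" js :: "'n list" assume len: "length is = length js"
  have c: "state ?c" by (rule state_cesaro_limit[OF \<alpha>])
  have pow: "conv_pow u t \<alpha> k \<star> ?c = ?c" if "1 \<le> k" for k
    using that
  proof (induction k rule: dec_induct)
    case base
    then show ?case by (simp only: conv_pow_one conv_cesaro_limit[OF \<alpha>])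
  next
    case (step k)
    then show ?case by (simp add: conv_pow_Suc conv_assoc \<alpha> c state_conv_pow conv_cesaro_limit)
  qed
  have "(\<lambda>n. (cesaro_mean \<alpha> n \<star> ?c) (U is js)) \<longlonglongrightarrow> ?c (U is js)"
    by (rule Lim_transform_eventually[OF tendsto_const])
      (rule eventually_sequentiallyI[of 1], simp add: cesaro_mean_conv[OF \<alpha> c _ len] pow)
  then show "(?c \<star> ?c) (U is js) = ?c (U is js)"
    by (rule LIMSEQ_unique[OF cesaro_mean_conv_tendsto[OF \<alpha> c len]])
qed (intro state_conv state_cesaro_limit \<alpha>)+

lemma conv_cesaro_limit_absorb:
  assumes "state \<alpha>" "state \<beta>" "\<beta> \<star> \<alpha> = \<alpha>"
  shows "\<beta> \<star> cesaro_limit u t \<alpha> = cesaro_limit u t \<alpha>"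
  using assms conv_assoc[of \<beta> \<alpha> "cesaro_limit u t \<alpha>"] by (simp add: conv_cesaro_limit state_cesaro_limit)

text \<open>The matrices of an idempotent state are contractive idempotents, hence orthogonal projections.
  This replaces the invariance of idempotent states under the antipode.\<close>

lemma idempotent_state_hermitian:
  assumes \<alpha>: "state \<alpha>" and "\<alpha> \<star> \<alpha> = \<alpha>" and len: "length is = length js"
  shows "\<alpha> (U js is) = cnj (\<alpha> (U is js))"
proof (rule contractive_idempotent_hermitian[of "words (length is)" "\<lambda>is js. \<alpha> (U is js)"])
  show "(\<Sum>ms\<in>words (length is). \<alpha> (U ks ms) * \<alpha> (U ms ls)) = \<alpha> (U ks ls)"
    if "ks \<in> words (length is)" "ls \<in> words (length is)" for ks ls
    using conv_word[OF \<alpha> \<alpha>, of ks ls] assms(2) that by simp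
  show "is \<in> words (length is)" "js \<in> words (length is)" using len by (simp_all add: words_def)
qed (simp_all add: state_words_contractive[OF universal_magic[OF universal] \<alpha>])

text \<open>For self-adjoint matrices \<open>A\<close>, \<open>B\<close> the product
  \<open>B A\<close> is the adjoint of \<open>A B\<close>.\<close>

lemma idempotent_states_conv_adjoint:
  assumes \<alpha>: "state \<alpha>" "\<alpha> \<star> \<alpha> = \<alpha>" and \<beta>: "state \<beta>" "\<beta> \<star> \<beta> = \<beta>" and len: "length is = length js"
  shows "(\<beta> \<star> \<alpha>) (U is js) = cnj ((\<alpha> \<star> \<beta>) (U js is))"
  unfolding conv_word[OF \<beta>(1) \<alpha>(1) len] conv_word[OF \<alpha>(1) \<beta>(1) len[symmetric]] cnj_sum
proof (rule sum.cong)
  show "words (length is) = words (length js)" using len by simp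
  fix ks :: "'n list" assume "ks \<in> words (length js)"
  then show "\<beta> (U is ks) * \<alpha> (U ks js) = cnj (\<alpha> (U js ks) * \<beta> (U ks is))"
    using len idempotent_state_hermitian[OF \<alpha>, of js ks] idempotent_state_hermitian[OF \<beta>, of ks "is"]
    by simp
qed

text \<open>If \<open>A B = B\<close> for self-adjoint matrices, taking adjoints gives
  \<open>B A = B\<close>. This exchanges left and right absorption.\<close>

lemma idempotent_state_absorb:
  assumes \<alpha>: "state \<alpha>" "\<alpha> \<star> \<alpha> = \<alpha>" and \<beta>: "state \<beta>" "\<beta> \<star> \<beta> = \<beta>"
  shows "\<alpha> \<star> \<beta> = \<beta> \<longleftrightarrow> \<beta> \<star> \<alpha> = \<beta>"
proof
  assume *: "\<alpha> \<star> \<beta> = \<beta>"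
  show "\<beta> \<star> \<alpha> = \<beta>"
  proof (rule state_eq_words)
    show "(\<beta> \<star> \<alpha>) (U is js) = \<beta> (U is js)" if "length is = length js" for "is" js
      using that * idempotent_states_conv_adjoint[OF \<alpha> \<beta>, of "is" js] idempotent_state_hermitian[OF \<beta>, of js "is"]
      by simp
  qed (intro state_conv \<alpha> \<beta>)+
next
  assume *: "\<beta> \<star> \<alpha> = \<beta>"
  show "\<alpha> \<star> \<beta> = \<beta>"
  proof (rule state_eq_words)
    show "(\<alpha> \<star> \<beta>) (U is js) = \<beta> (U is js)" if "length is = length js" for "is" js
      using that * idempotent_states_conv_adjoint[OF \<beta> \<alpha>, of "is" js] idempotent_state_hermitian[OF \<beta>, of js "is"]
      by simp
  qed (intro state_conv \<alpha> \<beta>)+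
qed

text \<open>Both identities come from the fact that, on \<open>S\<^sub>N\<close>, averaging the indicator of
  \<open>{\<tau>. \<tau> j = i}\<close> over all translates by permutations gives a constant function.\<close>

lemma random_permutation_conv_haar:
  assumes \<rho>: "state \<rho>\<^sub>0" "\<rho> = \<rho>\<^sub>0 \<circ> abelianisation u"
  shows "\<rho> \<star> haar_classical u = haar_classical u" "haar_classical u \<star> \<rho> = haar_classical u"
proof -
  note ab = abelianisation_star_hom[OF universal]
  let ?h = "haar_classical u" and ?N = "of_nat (fact CARD('n)) :: complex"
  have h: "state ?h" by (rule state_haar_classical[OF universal])
  have \<rho>': "state \<rho>" unfolding \<rho>(2) by (intro state_comp_star_hom \<rho> ab)
  \<comment> \<open>When the functions given by \<open>x \<sigma>\<close> add up to the constant
    \<open>c\<close> on the group, \<open>\<rho>\<^sub>0\<close> returns \<open>c\<close> by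
    linearity and normalisation.\<close>
  have const: "(\<Sum>\<sigma>\<in>UNIV. \<rho> (x \<sigma>)) = c"
    if "\<And>\<tau>. (\<Sum>\<sigma>\<in>(UNIV :: 'n perm set). apply_bcontfun (abelianisation u (x \<sigma>)) \<tau>) = c" for x c
  proof -
    have "(\<Sum>\<sigma>\<in>UNIV. abelianisation u (x \<sigma>)) = scaleC c 1"
      by (rule bcontfun_eqI) (simp add: bcontfun_sum bcontfun_scaleC bcontfun_one that)
    then have "\<rho>\<^sub>0 (\<Sum>\<sigma>\<in>UNIV. abelianisation u (x \<sigma>)) = c"
      by (simp add: state_linear[OF \<rho>(1)] state_one[OF \<rho>(1)])
    then show ?thesis by (simp add: \<rho>(2) state_linear[OF \<rho>(1)])
  qed
  have left: "bij (\<lambda>\<sigma>. \<tau> * \<sigma>)" for \<tau> :: "'n perm"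
    by (rule o_bij[of "\<lambda>\<sigma>. inverse \<tau> * \<sigma>"]) (simp_all add: fun_eq_iff flip: mult.assoc)
  have right: "bij (\<lambda>\<sigma>. \<sigma> * \<tau>)" for \<tau> :: "'n perm"
    by (rule o_bij[of "\<lambda>\<sigma>. \<sigma> * inverse \<tau>"]) (simp_all add: fun_eq_iff mult.assoc)
  have average: "x * (\<Sum>\<sigma>\<in>UNIV. if Q \<sigma> then 1 else 0) = (\<Sum>\<sigma>\<in>UNIV. if Q \<sigma> then x else 0)"
      "(\<Sum>\<sigma>\<in>UNIV. if Q \<sigma> then 1 else 0) * x = (\<Sum>\<sigma>\<in>UNIV. if Q \<sigma> then x else 0)"
    for x :: complex and Q :: "'n perm \<Rightarrow> bool"
    by (simp_all add: sum_distrib_left sum_distrib_right if_distrib[of "(*) x"] if_distrib[of "\<lambda>y. y * x"] cong: if_cong)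
  show "\<rho> \<star> ?h = ?h"
  proof (rule state_eq_words)
    fix "is" js :: "'n list" assume len: "length is = length js"
    let ?c = "\<Sum>\<sigma>\<in>(UNIV :: 'n perm set). if map (Perm.apply \<sigma>) js = is then 1 else 0 :: complex"
    have "(\<rho> \<star> ?h) (U is js)
        = (\<Sum>ks\<in>words (length is). \<Sum>\<sigma>\<in>UNIV. if map (Perm.apply \<sigma>) js = ks then \<rho> (U is ks) else 0) / ?N"
      using len by (simp add: conv_word[OF \<rho>' h] haar_classical_entry_word[OF universal] average
          flip: sum_divide_distrib)
    also have "\<dots> = (\<Sum>\<sigma>\<in>UNIV. \<Sum>ks\<in>words (length is). if map (Perm.apply \<sigma>) js = ks then \<rho> (U is ks) else 0) / ?N"
      by (subst sum.swap) simp
    also have "\<dots> = (\<Sum>\<sigma>\<in>UNIV. \<rho> (U is (map (Perm.apply \<sigma>) js))) / ?N"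
      using len by simp
    also have "(\<Sum>\<sigma>\<in>UNIV. \<rho> (U is (map (Perm.apply \<sigma>) js))) = ?c"
    proof (rule const)
      fix \<tau> :: "'n perm"
      show "(\<Sum>\<sigma>\<in>UNIV. apply_bcontfun (abelianisation u (U is (map (Perm.apply \<sigma>) js))) \<tau>) = ?c"
        using len sum.reindex_bij_betw[OF left[of \<tau>], of "\<lambda>\<sigma>. if map (Perm.apply \<sigma>) js = is then 1 else 0 :: complex"]
        by (simp add: abelianisation_entry_word[OF universal] apply_times comp_def)
    qed
    finally show "(\<rho> \<star> ?h) (U is js) = ?h (U is js)"
      using len by (simp add: haar_classical_entry_word[OF universal])
  qed (intro state_conv \<rho>' h)+
  show "?h \<star> \<rho> = ?h"
  proof (rule state_eq_words)
    fix "is" js :: "'n list" assume len: "length is = length js"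
    let ?c = "\<Sum>\<sigma>\<in>(UNIV :: 'n perm set). if map (Perm.apply \<sigma>) js = is then 1 else 0 :: complex"
    have map_inv: "map (Perm.apply \<sigma>) ks = is \<longleftrightarrow> ks = map (Perm.apply (inverse \<sigma>)) is" for \<sigma> :: "'n perm" and ks
    proof -
      have "Perm.apply \<sigma> \<circ> inv (Perm.apply \<sigma>) = id" "inv (Perm.apply \<sigma>) \<circ> Perm.apply \<sigma> = id"
        by (simp_all add: bij_is_surj bij_is_inj flip: surj_iff)
      then show ?thesis by (auto simp: apply_inverse)
    qed
    have "(?h \<star> \<rho>) (U is js)
        = (\<Sum>ks\<in>words (length is). \<Sum>\<sigma>\<in>UNIV. if map (Perm.apply \<sigma>) ks = is then \<rho> (U ks js) else 0) / ?N"
      using len by (simp add: conv_word[OF h \<rho>'] haar_classical_entry_word[OF universal] average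
          flip: sum_divide_distrib)
    also have "\<dots> = (\<Sum>\<sigma>\<in>UNIV. \<Sum>ks\<in>words (length is). if map (Perm.apply \<sigma>) ks = is then \<rho> (U ks js) else 0) / ?N"
      by (subst sum.swap) simp
    also have "\<dots> = (\<Sum>\<sigma>\<in>UNIV. \<rho> (U (map (Perm.apply (inverse \<sigma>)) is) js)) / ?N"
      using len by (simp add: map_inv)
    also have "(\<Sum>\<sigma>\<in>UNIV. \<rho> (U (map (Perm.apply (inverse \<sigma>)) is) js)) = ?c"
    proof (rule const)
      fix \<tau> :: "'n perm"
      show "(\<Sum>\<sigma>\<in>UNIV. apply_bcontfun (abelianisation u (U (map (Perm.apply (inverse \<sigma>)) is) js)) \<tau>) = ?c"
        using len sum.reindex_bij_betw[OF right[of \<tau>], of "\<lambda>\<sigma>. if map (Perm.apply \<sigma>) js = is then 1 else 0 :: complex"]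
        by (simp add: abelianisation_entry_word[OF universal] map_inv[symmetric] apply_times comp_def)
    qed
    finally show "(?h \<star> \<rho>) (U is js) = ?h (U is js)"
      using len by (simp add: haar_classical_entry_word[OF universal])
  qed (intro state_conv \<rho>' h)+
qed

lemma haar_classical_idempotent: "haar_classical u \<star> haar_classical u = haar_classical u"
  by (rule random_permutation_conv_haar(1)[OF state_uniform_state]) (simp add: haar_classical_def)

text \<open>The order of the absorptions matters: \<open>?\<eta>\<close> begins with
  \<open>?h\<close>, so \<open>?h \<star> \<psi> = \<psi>\<close>; symmetry gives
  \<open>\<psi> \<star> ?h = \<psi>\<close>; only then
  \<open>\<psi> \<star> ?c = \<psi> \<star> ?\<eta> = \<psi>\<close>, and symmetry again turns this
  around. \<open>\<phi>\<close> is absorbed through \<open>?c\<close>, a random permutation through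
  \<open>?h\<close>.\<close>

theorem quasi_subgroup_generated:
  assumes \<phi>: "state \<phi>"
  defines "\<psi> \<equiv> cesaro_limit u t (haar_classical u \<star> cesaro_limit u t \<phi>)"
  shows "\<phi> \<in> quasi_subgroup u t \<psi>" "random_permutations u \<subseteq> quasi_subgroup u t \<psi>"
proof -
  let ?h = "haar_classical u" and ?c = "cesaro_limit u t \<phi>"
  let ?\<eta> = "?h \<star> ?c"
  have h: "state ?h" "?h \<star> ?h = ?h" by (rule state_haar_classical[OF universal], rule haar_classical_idempotent)
  have c: "state ?c" "?c \<star> ?c = ?c" by (rule state_cesaro_limit[OF \<phi>], rule cesaro_limit_idempotent[OF \<phi>])
  have \<eta>: "state ?\<eta>" by (intro state_conv h c)
  have \<psi>: "state \<psi>" "\<psi> \<star> \<psi> = \<psi>"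
    unfolding \<psi>_def by (rule state_cesaro_limit[OF \<eta>], rule cesaro_limit_idempotent[OF \<eta>])
  have "?h \<star> ?\<eta> = ?\<eta>" using conv_assoc[of ?h ?h ?c] h c by simp
  then have h\<psi>: "?h \<star> \<psi> = \<psi>" unfolding \<psi>_def by (rule conv_cesaro_limit_absorb[OF \<eta> h(1)])
  have \<psi>h: "\<psi> \<star> ?h = \<psi>" using idempotent_state_absorb[OF h \<psi>] h\<psi> by blast
  have "\<psi> \<star> ?c = (\<psi> \<star> ?h) \<star> ?c" by (simp add: \<psi>h)
  also have "\<dots> = \<psi> \<star> ?\<eta>" by (rule conv_assoc[OF \<psi>(1) h(1) c(1)])
  also have "\<dots> = \<psi>" unfolding \<psi>_def by (rule cesaro_limit_conv[OF \<eta>])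
  finally have \<psi>c: "\<psi> \<star> ?c = \<psi>" .
  have c\<psi>: "?c \<star> \<psi> = \<psi>" using idempotent_state_absorb[OF c \<psi>] \<psi>c by blast
  have "\<phi> \<star> \<psi> = \<psi>"
    using conv_assoc[OF \<phi> c(1) \<psi>(1)] by (simp add: c\<psi> conv_cesaro_limit[OF \<phi>])
  moreover have "\<psi> \<star> \<phi> = \<psi>"
    using conv_assoc[OF \<psi>(1) c(1) \<phi>] by (simp add: \<psi>c cesaro_limit_conv[OF \<phi>])
  ultimately show "\<phi> \<in> quasi_subgroup u t \<psi>" using \<phi> by (simp add: quasi_subgroup_def)
  show "random_permutations u \<subseteq> quasi_subgroup u t \<psi>"
  proof
    fix \<rho> assume "\<rho> \<in> random_permutations u"
    then obtain \<rho>\<^sub>0 where \<rho>0: "state \<rho>\<^sub>0" "\<rho> = \<rho>\<^sub>0 \<circ> abelianisation u"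
      by (auto simp: random_permutations_def)
    have \<rho>: "state \<rho>" unfolding \<rho>0(2) by (intro state_comp_star_hom \<rho>0 abelianisation_star_hom universal)
    have "\<rho> \<star> \<psi> = \<psi>"
      using conv_assoc[OF \<rho> h(1) \<psi>(1)] by (simp add: h\<psi> random_permutation_conv_haar(1)[OF \<rho>0])
    moreover have "\<psi> \<star> \<rho> = \<psi>"
      using conv_assoc[OF \<psi>(1) h(1) \<rho>] by (simp add: \<psi>h random_permutation_conv_haar(2)[OF \<rho>0])
    ultimately show "\<rho> \<in> quasi_subgroup u t \<psi>" using \<rho> by (simp add: quasi_subgroup_def)
  qed
qed

end

section \<open>Support projections of characters\<close>

text \<open>For a self-adjoint contraction \<open>c\<close> these means approximate, strongly in
  every representation, the projection onto the vectors fixed by \<open>c\<close>. The powers start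
  at \<open>c ^ 0\<close>; at \<open>n = 0\<close> the value is 0.\<close>

definition power_mean :: "'a::cstar_algebra \<Rightarrow> nat \<Rightarrow> 'a"
  where "power_mean c n = (1 / real n) *\<^sub>R (\<Sum>k<n. c ^ k)"

lemma norm_power_mean_le:
  assumes "norm c \<le> 1"
  shows "norm (power_mean c n) \<le> 1"
proof -
  have "norm (\<Sum>k<n. c ^ k) \<le> (\<Sum>k<n. 1)"
    using assms by (intro sum_norm_le order_trans[OF norm_power_ineq] power_le_one) auto
  then show ?thesis by (cases "n = 0") (simp_all add: power_mean_def)
qed

lemma star_power_mean: "star c = c \<Longrightarrow> star (power_mean c n) = power_mean c n"
  by (simp add: power_mean_def star_simps)

text \<open>Telescoping: \<open>1 - c\<close> times the sum of powers is \<open>1 - c ^ n\<close>,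
  of norm at most 2.\<close>

lemma power_mean_residual:
  assumes "norm c \<le> 1"
  shows "(\<lambda>n. (1 - c) * power_mean c n) \<longlonglongrightarrow> 0"
proof (rule Lim_null_comparison)
  show "\<forall>\<^sub>F n in sequentially. norm ((1 - c) * power_mean c n) \<le> 2 / real n"
  proof (rule always_eventually, rule allI)
    fix n
    have "(1 - c) * (\<Sum>k<n. c ^ k) = 1 - c ^ n"
    proof (induction n)
      case (Suc n)
      then show ?case by (simp add: distrib_left) (simp add: left_diff_distrib)
    qed simp
    then have e: "(1 - c) * power_mean c n = (1 / real n) *\<^sub>R (1 - c ^ n)"
      by (simp add: power_mean_def)
    have "norm (c ^ n) \<le> 1"
      using assms by (intro order_trans[OF norm_power_ineq] power_le_one) auto
    then have "norm (1 - c ^ n) \<le> 2"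
      using norm_triangle_ineq4[of 1 "c ^ n"] by simp
    then show "norm ((1 - c) * power_mean c n) \<le> 2 / real n"
      unfolding e by (simp add: divide_right_mono)
  qed
  show "(\<lambda>n. 2 / real n) \<longlonglongrightarrow> 0"
    by (rule real_tendsto_divide_at_top[OF tendsto_const filterlim_real_sequentially])
qed

text \<open>Each power of \<open>c\<close> acts almost as the identity on later means, hence so does
  an average of powers; for \<open>m = 0\<close> that average would be 0.\<close>

lemma power_mean_absorb:
  assumes c: "norm c \<le> 1" and "1 \<le> m"
  shows "(\<lambda>n. (1 - power_mean c m) * power_mean c n) \<longlonglongrightarrow> 0"
proof -
  have pow: "(\<lambda>n. (1 - c ^ k) * power_mean c n) \<longlonglongrightarrow> 0" for k
  proof (induction k)
    case (Suc k)
    have "(\<lambda>n. (1 - c ^ k) * power_mean c n + c ^ k * ((1 - c) * power_mean c n)) \<longlonglongrightarrow> 0 + c ^ k * 0"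
      by (intro tendsto_intros Suc power_mean_residual c)
    then show ?case by (simp add: algebra_simps power_Suc2 del: power_Suc)
  qed simp
  have "1 - power_mean c m = (1 / real m) *\<^sub>R (\<Sum>k<m. 1 - c ^ k)"
    using assms(2) by (simp add: power_mean_def sum_subtractf scaleR_diff_right sum_constant_scaleR del: sum_constant)
  then have e: "(1 - power_mean c m) * power_mean c n = (1 / real m) *\<^sub>R (\<Sum>k<m. (1 - c ^ k) * power_mean c n)" for n
    by (simp add: sum_distrib_right)
  have "(\<lambda>n. (1 / real m) *\<^sub>R (\<Sum>k<m. (1 - c ^ k) * power_mean c n)) \<longlonglongrightarrow> (1 / real m) *\<^sub>R (\<Sum>k<m. 0)"
    by (intro tendsto_intros pow)
  then show ?thesis by (simp add: e)
qed

text \<open>If the functionals \<open>b \<mapsto> f (power_mean c n * b)\<close> were not norm Cauchy, one could choose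
  arbitrarily many differences of means that are almost orthogonal, because
  \<open>power_mean c m * power_mean c n\<close> is close to \<open>power_mean c n\<close> for \<open>n\<close> large; then
  \<open>\<parallel>\<Sum>k<K. s\<^sub>k b\<^sub>k\<parallel>\<close> grows only like \<open>\<surd>K\<close> whereas \<open>f\<close> grows like \<open>K\<close>.\<close>

lemma power_mean_uniformly_Cauchy:
  fixes c :: "'a::cstar_algebra"
  assumes f: "clinear f" and C: "\<And>x. cmod (f x) \<le> C * norm x"
    and c: "star c = c" "norm c \<le> 1" and \<epsilon>: "0 < \<epsilon>"
  obtains M where "\<And>m n b. M \<le> m \<Longrightarrow> M \<le> n \<Longrightarrow> norm b \<le> 1 \<Longrightarrow>
    cmod (f ((power_mean c m - power_mean c n) * b)) \<le> \<epsilon>"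
proof (rule ccontr)
  assume "\<not> thesis"
  then have neg: "\<exists>m n b. M \<le> m \<and> M \<le> n \<and> norm b \<le> 1 \<and> \<epsilon> < cmod (f ((power_mean c m - power_mean c n) * b))" for M
    using that[of M] by (force simp: not_le)
  let ?P = "power_mean c"
  \<comment> \<open>The differences \<open>s k\<close> of means are found one after another. That
    \<open>s k * ?P n\<close> tends to 0 is the invariant which allows a next difference to be
    almost orthogonal to all earlier ones.\<close>
  have blocks: "\<exists>s b. (\<forall>k<K. star (s k) = s k \<and> norm (s k) \<le> 2 \<and> norm (b k) \<le> 1 \<and> \<epsilon> < cmod (f (s k * b k))
        \<and> (\<lambda>n. s k * ?P n) \<longlonglongrightarrow> 0) \<and> (\<forall>k<K. \<forall>l<K. k \<noteq> l \<longrightarrow> norm (s k * s l) \<le> \<delta>)"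
    if \<delta>: "0 < \<delta>" for \<delta> :: real and K :: nat
  proof (induction K)
    case (Suc K)
    then obtain s b where s: "\<And>k. k < K \<Longrightarrow> star (s k) = s k" "\<And>k. k < K \<Longrightarrow> norm (s k) \<le> 2"
        "\<And>k. k < K \<Longrightarrow> norm (b k) \<le> 1" "\<And>k. k < K \<Longrightarrow> \<epsilon> < cmod (f (s k * b k))"
        "\<And>k. k < K \<Longrightarrow> (\<lambda>n. s k * ?P n) \<longlonglongrightarrow> 0"
        "\<And>k l. k < K \<Longrightarrow> l < K \<Longrightarrow> k \<noteq> l \<Longrightarrow> norm (s k * s l) \<le> \<delta>" by blast
    have "\<forall>\<^sub>F n in sequentially. \<forall>k\<in>{..<K}. norm (s k * ?P n) < \<delta> / 2"
    proof (rule eventually_ball_finite[OF finite_lessThan], rule ballI)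
      fix k assume "k \<in> {..<K}"
      then show "\<forall>\<^sub>F n in sequentially. norm (s k * ?P n) < \<delta> / 2"
        using tendstoD[OF s(5), of k "\<delta> / 2"] \<delta> by simp
    qed
    then obtain M where M: "\<And>n k. M \<le> n \<Longrightarrow> k < K \<Longrightarrow> norm (s k * ?P n) < \<delta> / 2"
      by (auto simp: eventually_sequentially)
    obtain m n b' where b': "max 1 M \<le> m" "max 1 M \<le> n" "norm b' \<le> 1" "\<epsilon> < cmod (f ((?P m - ?P n) * b'))"
      using neg by blast
    define d where "d = ?P m - ?P n"
    have d_star: "star d = d" by (simp add: d_def star_diff star_power_mean[OF c(1)])
    have d_norm: "norm d \<le> 2"
      using norm_triangle_ineq4[of "?P m" "?P n"] norm_power_mean_le[OF c(2), of m] norm_power_mean_le[OF c(2), of n]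
      by (simp add: d_def)
    have sd: "norm (s k * d) \<le> \<delta>" if "k < K" for k
      using norm_triangle_ineq4[of "s k * ?P m" "s k * ?P n"] M[of m k] M[of n k] b' that
      by (simp add: d_def right_diff_distrib)
    have ds: "norm (d * s k) \<le> \<delta>" if "k < K" for k
      using norm_star[of "s k * d"] sd[OF that] by (simp add: star_mult d_star s(1) that)
    have "(\<lambda>p. (1 - ?P n) * ?P p - (1 - ?P m) * ?P p) \<longlonglongrightarrow> 0 - 0"
      using b' by (intro tendsto_intros power_mean_absorb c) auto
    then have d_lim: "(\<lambda>p. d * ?P p) \<longlonglongrightarrow> 0" by (simp add: d_def algebra_simps)
    show ?case
    proof (intro exI conjI allI impI)
      fix k l assume "k < Suc K" "l < Suc K" "k \<noteq> l"
      then show "norm ((s(K := d)) k * (s(K := d)) l) \<le> \<delta>"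
        using s(6) sd ds by (auto simp: less_Suc_eq)
    next
      fix k assume k: "k < Suc K"
      show "star ((s(K := d)) k) = (s(K := d)) k" using k s d_star by (auto simp: less_Suc_eq)
      show "norm ((s(K := d)) k) \<le> 2" using k s d_norm by (auto simp: less_Suc_eq)
      show "norm ((b(K := b')) k) \<le> 1" using k s b' by (auto simp: less_Suc_eq)
      show "\<epsilon> < cmod (f ((s(K := d)) k * (b(K := b')) k))" using k s b' by (auto simp: less_Suc_eq d_def)
      show "(\<lambda>n. (s(K := d)) k * ?P n) \<longlonglongrightarrow> 0" using k s d_lim by (auto simp: less_Suc_eq)
    qed
  qed simp
  \<comment> \<open>Comparing \<open>(K \<epsilon>)\<^sup>2\<close> with \<open>C\<^sup>2\<close>
    times the bound \<open>5 K\<close> on \<open>(norm z)\<^sup>2\<close> shows from which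
    \<open>K\<close> on there is a contradiction.\<close>
  obtain K :: nat where K: "5 * C\<^sup>2 / \<epsilon>\<^sup>2 < real K" using reals_Archimedean2 by blast
  have K0: "0 < real K" using K by (rule le_less_trans[rotated]) simp
  obtain s b where s: "\<And>k. k < K \<Longrightarrow> star (s k) = s k" "\<And>k. k < K \<Longrightarrow> norm (s k) \<le> 2"
      "\<And>k. k < K \<Longrightarrow> norm (b k) \<le> 1" "\<And>k. k < K \<Longrightarrow> \<epsilon> < cmod (f (s k * b k))"
      "\<And>k l. k < K \<Longrightarrow> l < K \<Longrightarrow> k \<noteq> l \<Longrightarrow> norm (s k * s l) \<le> 1 / real K"
    using blocks[OF divide_pos_pos[OF zero_less_one K0], of K] by blast
  \<comment> \<open>Phases that make all \<open>\<theta> k * f (s k * b k)\<close> nonnegative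
    reals, so that they add up without cancellation.\<close>
  define \<theta> where "\<theta> k = cnj (sgn (f (s k * b k)))" for k
  have \<theta>: "\<theta> k * f (s k * b k) = of_real (cmod (f (s k * b k)))" "cmod (\<theta> k) \<le> 1" for k
    by (auto simp: \<theta>_def sgn_eq norm_divide complex_norm_square[symmetric] power2_eq_square mult.commute[of "cnj _"])
  define z where "z = (\<Sum>k<K. scaleC (\<theta> k) (s k * b k))"
  have fz: "f z = of_real (\<Sum>k<K. cmod (f (s k * b k)))"
    by (simp add: z_def clinear_sum[OF f] clinear_scaleC[OF f] \<theta>)
  have "(\<Sum>k<K. \<epsilon>) \<le> (\<Sum>k<K. cmod (f (s k * b k)))"
    using s(4) by (intro sum_mono less_imp_le) auto
  also have "\<dots> \<le> cmod (f z)" unfolding fz norm_of_real by simp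
  also have "\<dots> \<le> C * norm z" by (rule C)
  finally have lower: "real K * \<epsilon> \<le> C * norm z" by simp
  have "(norm z)\<^sup>2 = norm (\<Sum>k<K. \<Sum>l<K. scaleC (cnj (\<theta> k) * \<theta> l) (star (b k) * (s k * s l) * b l))"
  proof -
    have "star z * z = (\<Sum>k<K. \<Sum>l<K. star (scaleC (\<theta> k) (s k * b k)) * scaleC (\<theta> l) (s l * b l))"
      by (simp add: z_def star_sum sum_product)
    also have "\<dots> = (\<Sum>k<K. \<Sum>l<K. scaleC (cnj (\<theta> k) * \<theta> l) (star (b k) * (s k * s l) * b l))"
      using s(1) by (intro sum.cong refl) (simp add: star_scaleC star_mult scaleC_mult_left scaleC_mult_right scaleC_scaleC mult.assoc mult.commute[of "cnj _"])
    finally show ?thesis by (simp flip: cstar_identity)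
  qed
  \<comment> \<open>The diagonal contributes at most \<open>4 K\<close>, and the
    \<open>K\<^sup>2\<close> error terms of size \<open>1 / K\<close> another
    \<open>K\<close>.\<close>
  also have "\<dots> \<le> (\<Sum>k<K. \<Sum>l<K. (if k = l then 4 else 0) + 1 / real K)"
  proof (intro order_trans[OF norm_sum] sum_mono)
    fix k l assume kl: "k \<in> {..<K}" "l \<in> {..<K}"
    have "norm (s k * s l) \<le> (if k = l then 4 else 0) + 1 / real K"
    proof (cases "k = l")
      case True
      have "norm (s k * s k) \<le> 2 * 2"
        using kl s(2) by (intro order_trans[OF norm_mult_ineq] mult_mono) auto
      then show ?thesis using True K0 by (simp add: add_increasing2)
    qed (use kl s(5) in simp)
    moreover have "norm (scaleC (cnj (\<theta> k) * \<theta> l) (star (b k) * (s k * s l) * b l)) \<le> norm (s k * s l)"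
    proof -
      have "norm (scaleC (cnj (\<theta> k) * \<theta> l) (star (b k) * (s k * s l) * b l))
          \<le> (1 * 1) * ((norm (star (b k)) * norm (s k * s l)) * norm (b l))"
        unfolding norm_scaleC norm_mult complex_mod_cnj
        by (intro mult_mono \<theta> order_trans[OF norm_mult_ineq] mult_right_mono norm_mult_ineq) auto
      also have "\<dots> \<le> (1 * 1) * ((1 * norm (s k * s l)) * 1)"
        unfolding norm_star using kl s(3) by (intro mult_mono) auto
      finally show ?thesis by simp
    qed
    ultimately show "norm (scaleC (cnj (\<theta> k) * \<theta> l) (star (b k) * (s k * s l) * b l))
      \<le> (if k = l then 4 else 0) + 1 / real K" by linarith
  qed
  also have "\<dots> = 5 * real K" using K0 by (simp add: sum.distrib)
  finally have upper: "(norm z)\<^sup>2 \<le> 5 * real K" .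
  have "(real K * \<epsilon>)\<^sup>2 \<le> (C * norm z)\<^sup>2" using lower \<epsilon> by (intro power_mono) auto
  also have "\<dots> \<le> C\<^sup>2 * (5 * real K)" unfolding power_mult_distrib by (intro mult_left_mono upper) simp
  finally have "real K * (real K * \<epsilon>\<^sup>2) \<le> real K * (5 * C\<^sup>2)" by (simp add: power2_eq_square algebra_simps)
  then have "real K * \<epsilon>\<^sup>2 \<le> 5 * C\<^sup>2" using K0 by (rule mult_left_le_imp_le)
  then show False using K \<epsilon> by (simp add: field_simps)
qed

section \<open>The dual space and bounded functionals on it\<close>

lemma dualE:
  assumes "f \<in> dual"
  obtains C where "clinear f" "0 \<le> C" "\<And>a. cmod (f a) \<le> C * norm a"
proof -
  obtain C where C: "clinear f" "\<And>a. cmod (f a) \<le> C * norm a" using assms by (auto simp: dual_def)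
  have "cmod (f a) \<le> \<bar>C\<bar> * norm a" for a
    by (rule order_trans[OF C(2) mult_right_mono[OF abs_ge_self norm_ge_zero]])
  then show ?thesis using that[of "\<bar>C\<bar>"] C(1) by simp
qed

lemma dualI: "clinear f \<Longrightarrow> (\<And>a. cmod (f a) \<le> C * norm a) \<Longrightarrow> f \<in> dual"
  by (auto simp: dual_def)

lemma dual_clinear: "f \<in> dual \<Longrightarrow> clinear f"
  by (simp add: dual_def)

lemma dual_bounded_linear: "f \<in> dual \<Longrightarrow> bounded_linear f"
  by (auto simp: dual_def intro: bounded_clinear_continuous)

lemma dual_norm_le: "f \<in> dual \<Longrightarrow> cmod (f a) \<le> onorm f * norm a"
  by (rule onorm[OF dual_bounded_linear])

lemma state_dual: "state f \<Longrightarrow> f \<in> dual"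
  using state_norm_le by (intro dualI[of f 1]) (simp_all add: state_clinear)

lemma dual_zero: "(\<lambda>a. 0) \<in> dual"
  by (rule dualI[of _ 0]) (simp_all add: clinear_def)

lemma dual_add:
  assumes "f \<in> dual" "g \<in> dual"
  shows "(\<lambda>a. f a + g a) \<in> dual"
proof (rule dualI)
  show "clinear (\<lambda>a. f a + g a)"
    using dual_clinear[OF assms(1)] dual_clinear[OF assms(2)] by (simp add: clinear_def distrib_left)
  show "cmod (f a + g a) \<le> (onorm f + onorm g) * norm a" for a
    unfolding distrib_right by (intro norm_triangle_le add_mono dual_norm_le assms)
qed

lemma dual_scale:
  assumes "f \<in> dual"
  shows "(\<lambda>a. c * f a) \<in> dual"
proof (rule dualI)
  show "clinear (\<lambda>a. c * f a)" using dual_clinear[OF assms] by (simp add: clinear_def distrib_left)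
  show "cmod (c * f a) \<le> (cmod c * onorm f) * norm a" for a
    using dual_norm_le[OF assms, of a] by (simp add: norm_mult mult.assoc mult_left_mono)
qed

lemma dual_left_mult:
  assumes "f \<in> dual"
  shows "(\<lambda>b. f (a * b)) \<in> dual"
proof -
  obtain C where C: "clinear f" "0 \<le> C" "\<And>a. cmod (f a) \<le> C * norm a" using dualE[OF assms] by blast
  show ?thesis
  proof (rule dualI)
    show "clinear (\<lambda>b. f (a * b))" using C(1) by (simp add: clinear_def distrib_left scaleC_mult_right)
    show "cmod (f (a * b)) \<le> (C * norm a) * norm b" for b
      using order_trans[OF C(3) mult_left_mono[OF norm_mult_ineq C(2)]] by (simp add: mult.assoc)
  qed
qed

lemma onorm_left_mult_le:
  assumes "f \<in> dual"
  shows "onorm (\<lambda>b. f (a * b)) \<le> onorm f * norm a"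
proof (rule onorm_le)
  show "norm (f (a * b)) \<le> onorm f * norm a * norm b" for b
    using order_trans[OF dual_norm_le[OF assms] mult_left_mono[OF norm_mult_ineq onorm_pos_le[OF dual_bounded_linear[OF assms]]]]
    by (simp add: mult.assoc)
qed

lemma dual_star:
  assumes "f \<in> dual"
  shows "(\<lambda>a. cnj (f (star a))) \<in> dual"
proof (rule dualI)
  show "clinear (\<lambda>a. cnj (f (star a)))"
    using dual_clinear[OF assms] by (simp add: clinear_def star_add star_scaleC)
  show "cmod (cnj (f (star a))) \<le> onorm f * norm a" for a
    using dual_norm_le[OF assms, of "star a"] by (simp add: norm_star)
qed

lemma
  assumes "F \<in> bidual"
  shows bidual_add: "f \<in> dual \<Longrightarrow> g \<in> dual \<Longrightarrow> F (\<lambda>a. f a + g a) = F f + F g"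
    and bidual_scale: "f \<in> dual \<Longrightarrow> F (\<lambda>a. c * f a) = c * F f"
    and bidual_zero: "F (\<lambda>a. 0) = 0"
proof -
  show sc: "F (\<lambda>a. c * f a) = c * F f" if "f \<in> dual" for f c using assms that by (simp add: bidual_def)
  show "F (\<lambda>a. 0) = 0" using sc[OF dual_zero, of 0] by simp
qed (use assms in \<open>auto simp: bidual_def\<close>)

lemma bidual_boundE:
  assumes "F \<in> bidual"
  obtains D where "0 \<le> D" "\<And>f. f \<in> dual \<Longrightarrow> cmod (F f) \<le> D * onorm f"
proof -
  obtain D where D: "\<And>f. f \<in> dual \<Longrightarrow> cmod (F f) \<le> D * onorm f" using assms unfolding bidual_def by blast
  have "cmod (F f) \<le> \<bar>D\<bar> * onorm f" if "f \<in> dual" for f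
    by (rule order_trans[OF D[OF that] mult_right_mono[OF abs_ge_self onorm_pos_le[OF dual_bounded_linear[OF that]]]])
  then show ?thesis using that[of "\<bar>D\<bar>"] by simp
qed

lemma bidual_diff:
  assumes F: "F \<in> bidual" and f: "f \<in> dual" and g: "g \<in> dual"
  shows "F (\<lambda>a. f a - g a) = F f - F g"
  using bidual_add[OF F f dual_scale[OF g, of "-1"]] bidual_scale[OF F g, of "-1"] by simp

lemma bidual_sum:
  assumes F: "F \<in> bidual" and f: "\<And>i. i \<in> I \<Longrightarrow> f i \<in> dual" and "finite I"
  shows "(\<lambda>a. \<Sum>i\<in>I. w i * f i a) \<in> dual \<and> F (\<lambda>a. \<Sum>i\<in>I. w i * f i a) = (\<Sum>i\<in>I. w i * F (f i))"
  using assms(3,2)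
proof (induction I rule: finite_induct)
  case empty
  then show ?case by (simp add: dual_zero bidual_zero[OF F])
next
  case (insert i I)
  then have "(\<lambda>a. w i * f i a) \<in> dual" by (intro dual_scale) simp
  with insert show ?case
    by (simp add: dual_add bidual_add[OF F] bidual_scale[OF F])
qed

text \<open>\<open>p f = lim f (A n)\<close> for an approximate eigenprojection \<open>A\<close> of the character \<open>\<eta>\<close>. The uniform
  convergence makes both orders of the iterated limits in the Arens product agree.\<close>

locale character_support =
  fixes \<eta> :: "'a::cstar_algebra \<Rightarrow> complex" and A :: "nat \<Rightarrow> 'a"
  assumes \<eta>: "state \<eta>" and \<eta>_mult: "\<eta> (a * b) = \<eta> a * \<eta> b"
    and A_star: "star (A n) = A n" and A_norm: "norm (A n) \<le> 1"
    and A_\<eta>: "(\<lambda>n. \<eta> (A n)) \<longlonglongrightarrow> 1"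
    and A_eigen: "(\<lambda>n. a * A n - scaleC (\<eta> a) (A n)) \<longlonglongrightarrow> 0"
    and A_Cauchy: "\<lbrakk>f \<in> dual; 0 < \<epsilon>\<rbrakk> \<Longrightarrow>
      \<exists>M. \<forall>m\<ge>M. \<forall>n\<ge>M. \<forall>b. norm b \<le> 1 \<longrightarrow> cmod (f ((A m - A n) * b)) \<le> \<epsilon>"
begin

definition p :: "('a \<Rightarrow> complex) \<Rightarrow> complex"
  where "p f = (if f \<in> dual then lim (\<lambda>n. f (A n)) else 0)"

lemma p_tendsto:
  assumes f: "f \<in> dual"
  shows "(\<lambda>n. f (A n)) \<longlonglongrightarrow> p f"
proof -
  have "Cauchy (\<lambda>n. f (A n))"
  proof (rule CauchyI)
    fix e :: real assume "0 < e"
    then obtain M where M: "\<forall>m\<ge>M. \<forall>n\<ge>M. \<forall>b. norm b \<le> 1 \<longrightarrow> cmod (f ((A m - A n) * b)) \<le> e / 2"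
      using A_Cauchy[OF f, of "e / 2"] by auto
    have "cmod (f (A m) - f (A n)) < e" if "M \<le> m" "M \<le> n" for m n
    proof -
      have "cmod (f ((A m - A n) * 1)) \<le> e / 2" using M that by (metis norm_one order_refl)
      then show ?thesis using \<open>0 < e\<close> by (simp add: clinear_diff[OF dual_clinear[OF f]])
    qed
    then show "\<exists>M. \<forall>m\<ge>M. \<forall>n\<ge>M. norm (f (A m) - f (A n)) < e" by blast
  qed
  then show ?thesis using f by (simp add: p_def Cauchy_convergent_iff convergent_LIMSEQ_iff)
qed

lemma p_eqI: "f \<in> dual \<Longrightarrow> (\<lambda>n. f (A n)) \<longlonglongrightarrow> l \<Longrightarrow> p f = l"
  using p_tendsto LIMSEQ_unique by blast

lemma A_eigen_right: "(\<lambda>n. A n * b - scaleC (\<eta> b) (A n)) \<longlonglongrightarrow> 0"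
  using tendsto_star[OF A_eigen[of "star b"]] by (simp add: star_simps A_star state_star[OF \<eta>])

lemma
  assumes f: "f \<in> dual"
  shows tendsto_left_mult: "(\<lambda>n. f (a * A n)) \<longlonglongrightarrow> \<eta> a * p f"
    and tendsto_right_mult: "(\<lambda>n. f (A n * a)) \<longlonglongrightarrow> \<eta> a * p f"
proof -
  note lin = clinear_diff[OF dual_clinear[OF f]] clinear_scaleC[OF dual_clinear[OF f]] clinear_zero[OF dual_clinear[OF f]]
  have "(\<lambda>n. f (a * A n - scaleC (\<eta> a) (A n)) + \<eta> a * f (A n)) \<longlonglongrightarrow> f 0 + \<eta> a * p f"
    by (intro tendsto_intros bounded_linear.tendsto[OF dual_bounded_linear[OF f]] A_eigen p_tendsto f)
  then show "(\<lambda>n. f (a * A n)) \<longlonglongrightarrow> \<eta> a * p f" by (simp add: lin)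
  have "(\<lambda>n. f (A n * a - scaleC (\<eta> a) (A n)) + \<eta> a * f (A n)) \<longlonglongrightarrow> f 0 + \<eta> a * p f"
    by (intro tendsto_intros bounded_linear.tendsto[OF dual_bounded_linear[OF f]] A_eigen_right p_tendsto f)
  then show "(\<lambda>n. f (A n * a)) \<longlonglongrightarrow> \<eta> a * p f" by (simp add: lin)
qed

text \<open>Letting the other index go to infinity in \<open>A_Cauchy\<close>: the functionals
  \<open>f (A n * b)\<close> of \<open>b\<close> converge to \<open>p f * \<eta> b\<close> in the
  norm of the dual, not just pointwise. A general bidual element is guaranteed to respect norm
  limits only.\<close>

lemma uniform_right_mult:
  assumes f: "f \<in> dual" and \<epsilon>: "0 < \<epsilon>"
  obtains M where "\<And>n b. M \<le> n \<Longrightarrow> cmod (f (A n * b) - \<eta> b * p f) \<le> \<epsilon> * norm b"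
proof -
  note lin = clinear_diff[OF dual_clinear[OF f]] clinear_scaleR[OF dual_clinear[OF f]]
  obtain M where M: "\<forall>m\<ge>M. \<forall>n\<ge>M. \<forall>b. norm b \<le> 1 \<longrightarrow> cmod (f ((A m - A n) * b)) \<le> \<epsilon>"
    using A_Cauchy[OF f \<epsilon>] by blast
  have "cmod (f (A n * b) - \<eta> b * p f) \<le> \<epsilon> * norm b" if n: "M \<le> n" for n b
  proof (rule tendsto_upperbound[where F = sequentially])
    show "(\<lambda>m. cmod (f (A n * b) - f (A m * b))) \<longlonglongrightarrow> cmod (f (A n * b) - \<eta> b * p f)"
      by (intro tendsto_intros tendsto_right_mult f)
    show "\<forall>\<^sub>F m in sequentially. cmod (f (A n * b) - f (A m * b)) \<le> \<epsilon> * norm b"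
    proof (rule eventually_sequentiallyI)
      fix m assume m: "M \<le> m"
      show "cmod (f (A n * b) - f (A m * b)) \<le> \<epsilon> * norm b"
      proof (cases "b = 0")
        case False
        have "f ((A n - A m) * ((1 / norm b) *\<^sub>R b)) = of_real (1 / norm b) * (f (A n * b) - f (A m * b))"
          by (simp only: mult_scaleR_right lin left_diff_distrib)
        moreover have "cmod (f ((A n - A m) * ((1 / norm b) *\<^sub>R b))) \<le> \<epsilon>"
          by (rule M[rule_format, OF n m]) (use False in simp)
        ultimately have "cmod (of_real (1 / norm b) * (f (A n * b) - f (A m * b))) \<le> \<epsilon>" by (simp only:)
        then show ?thesis using False by (simp add: norm_mult norm_divide field_simps)
      qed simp
    qed
  qed simp
  then show ?thesis using that by blast
qed

lemma p_bidual: "p \<in> bidual"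
  unfolding bidual_def
proof (intro CollectI conjI ballI allI impI)
  fix f g :: "'a \<Rightarrow> complex" assume "f \<in> dual" "g \<in> dual"
  then show "p (\<lambda>a. f a + g a) = p f + p g"
    by (intro p_eqI dual_add tendsto_add p_tendsto)
next
  fix c and f :: "'a \<Rightarrow> complex" assume "f \<in> dual"
  then show "p (\<lambda>a. c * f a) = c * p f"
    by (intro p_eqI dual_scale tendsto_mult_left p_tendsto)
next
  have "cmod (p f) \<le> 1 * onorm f" if f: "f \<in> dual" for f
  proof (rule tendsto_upperbound[where F = sequentially])
    show "(\<lambda>n. cmod (f (A n))) \<longlonglongrightarrow> cmod (p f)" by (intro tendsto_norm p_tendsto f)
    show "\<forall>\<^sub>F n in sequentially. cmod (f (A n)) \<le> 1 * onorm f"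
    proof (rule always_eventually, rule allI)
      show "cmod (f (A n)) \<le> 1 * onorm f" for n
        using order_trans[OF dual_norm_le[OF f] mult_left_mono[OF A_norm onorm_pos_le[OF dual_bounded_linear[OF f]]]]
        by simp
    qed
  qed simp
  then show "\<exists>C. \<forall>f\<in>dual. cmod (p f) \<le> C * onorm f" by blast
next
  show "p f = 0" if "f \<notin> dual" for f using that by (simp add: p_def)
qed

lemma p_\<eta>: "p \<eta> = 1"
  by (rule p_eqI[OF state_dual[OF \<eta>] A_\<eta>])

lemma p_left_mult: "f \<in> dual \<Longrightarrow> p (\<lambda>b. f (a * b)) = \<eta> a * p f"
  by (rule p_eqI[OF dual_left_mult tendsto_left_mult])

text \<open>The inner factor \<open>p\<close> already turns \<open>f (a * b)\<close> into
  \<open>\<eta> a * p f\<close>, and \<open>q \<eta> = 1\<close> finishes.\<close>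

lemma bidual_mult_p_right:
  assumes q: "q \<in> bidual" "q \<eta> = 1"
  shows "bidual_mult q p = p"
proof
  show "bidual_mult q p f = p f" for f
  proof (cases "f \<in> dual")
    case True
    then show ?thesis
      using bidual_scale[OF q(1) state_dual[OF \<eta>], of "p f"] q(2)
      by (simp add: bidual_mult_def p_left_mult mult.commute[of "\<eta> _"])
  qed (simp add: bidual_mult_def p_def)
qed

text \<open>Here \<open>q\<close> is the inner factor and has to be exchanged with the limit in
  \<open>n\<close>; the norm convergence of \<open>uniform_right_mult\<close> permits this. Together
  with the preceding identity it places \<open>p\<close> below every projection \<open>q\<close>
  with \<open>q \<eta> = 1\<close>.\<close>

lemma bidual_mult_p_left:
  assumes q: "q \<in> bidual" "q \<eta> = 1"
  shows "bidual_mult p q = p"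
proof
  show "bidual_mult p q f = p f" for f
  proof (cases "f \<in> dual")
    case f: True
    obtain D where D: "0 \<le> D" "\<And>f. f \<in> dual \<Longrightarrow> cmod (q f) \<le> D * onorm f"
      using bidual_boundE[OF q(1)] by blast
    let ?g = "\<lambda>a. q (\<lambda>b. f (a * b))"
    note lin = clinear_add[OF dual_clinear[OF f]] clinear_scaleC[OF dual_clinear[OF f]]
    have g: "?g \<in> dual"
    proof (rule dualI)
      show "clinear ?g"
        by (simp add: clinear_def distrib_right scaleC_mult_left lin bidual_add[OF q(1)] bidual_scale[OF q(1)]
            dual_left_mult[OF f])
      show "cmod (?g a) \<le> (D * onorm f) * norm a" for a
        using order_trans[OF D(2)[OF dual_left_mult[OF f]] mult_left_mono[OF onorm_left_mult_le[OF f] D(1)]]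
        by (simp add: mult.assoc)
    qed
    have "p ?g = p f"
    proof (rule p_eqI[OF g], rule LIMSEQ_I)
      fix e :: real assume e: "0 < e"
      \<comment> \<open>\<open>D + 1\<close> in place of \<open>D\<close> avoids division by
        zero.\<close>
      define \<epsilon> where "\<epsilon> = e / (2 * (D + 1))"
      have \<epsilon>: "0 < \<epsilon>" using e D(1) by (simp add: \<epsilon>_def)
      obtain M where M: "\<And>n b. M \<le> n \<Longrightarrow> cmod (f (A n * b) - \<eta> b * p f) \<le> \<epsilon> * norm b"
        using uniform_right_mult[OF f \<epsilon>] by blast
      have "cmod (?g (A n) - p f) < e" if "M \<le> n" for n
      proof -
        have \<eta>p: "(\<lambda>b. p f * \<eta> b) \<in> dual" by (intro dual_scale state_dual \<eta>)
        have "?g (A n) - p f = q (\<lambda>b. f (A n * b)) - q (\<lambda>b. p f * \<eta> b)"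
          using bidual_scale[OF q(1) state_dual[OF \<eta>], of "p f"] q(2) by simp
        also have "\<dots> = q (\<lambda>b. f (A n * b) - p f * \<eta> b)"
          by (rule bidual_diff[OF q(1) dual_left_mult[OF f] \<eta>p, symmetric])
        finally have eq: "?g (A n) - p f = q (\<lambda>b. f (A n * b) - p f * \<eta> b)" .
        have d: "(\<lambda>b. f (A n * b) - p f * \<eta> b) \<in> dual"
          using dual_add[OF dual_left_mult[OF f] dual_scale[OF \<eta>p, of "-1"]] by simp
        have "cmod (?g (A n) - p f) \<le> D * onorm (\<lambda>b. f (A n * b) - p f * \<eta> b)"
          unfolding eq by (rule D(2)[OF d])
        also have "\<dots> \<le> D * \<epsilon>"
          by (intro mult_left_mono D(1) onorm_le) (use M[OF that] in \<open>simp add: mult.commute\<close>)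
        also have "\<dots> < e" using e D(1) by (simp add: \<epsilon>_def field_simps add_nonneg_pos)
        finally show ?thesis .
      qed
      then show "\<exists>no. \<forall>n\<ge>no. norm (?g (A n) - p f) < e" by blast
    qed
    then show ?thesis using f by (simp add: bidual_mult_def)
  qed (simp add: bidual_mult_def p_def)
qed

lemma p_projection: "bidual_projection p"
  unfolding bidual_projection_def
proof (intro conjI)
  show "bidual_mult p p = p" by (rule bidual_mult_p_right[OF p_bidual p_\<eta>])
  show "bidual_star p = p"
  proof
    show "bidual_star p f = p f" for f
    proof (cases "f \<in> dual")
      case f: True
      have "p (\<lambda>a. cnj (f (star a))) = cnj (p f)"
        by (rule p_eqI[OF dual_star[OF f]]) (simp add: A_star tendsto_cnj p_tendsto[OF f])
      then show ?thesis using f by (simp add: bidual_star_def)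
    qed (simp add: bidual_star_def p_def)
  qed
qed (rule p_bidual)

lemma support_projection_eq: "support_projection \<eta> = p"
  unfolding support_projection_def
proof (rule the_equality)
  show p: "bidual_projection p \<and> normal_extension \<eta> p = 1 \<and>
    (\<forall>q. bidual_projection q \<and> normal_extension \<eta> q = 1 \<longrightarrow> projection_le p q)"
    using p_projection p_\<eta> bidual_mult_p_left bidual_mult_p_right
    by (auto simp: normal_extension_def projection_le_def bidual_projection_def)
  fix p' assume p': "bidual_projection p' \<and> normal_extension \<eta> p' = 1 \<and>
    (\<forall>q. bidual_projection q \<and> normal_extension \<eta> q = 1 \<longrightarrow> projection_le p' q)"
  have "projection_le p p'" "projection_le p' p" using p p' by blast+
  then show "p' = p" by (simp add: projection_le_def)
qed

end

text \<open>Multiplicativity of \<open>\<eta>\<close> makes \<open>bidual_mult q q \<eta>\<close>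
  the square of \<open>q \<eta>\<close>. This settles the sign of the mixed terms when
  \<open>p_C\<close> is evaluated on a mixture of characters.\<close>

lemma bidual_projection_character:
  assumes q: "bidual_projection q" and \<eta>: "state \<eta>" "\<And>a b. \<eta> (a * b) = \<eta> a * \<eta> b"
  shows "q \<eta> = 0 \<or> q \<eta> = 1"
proof -
  have qb: "q \<in> bidual" and qq: "bidual_mult q q = q" using q by (simp_all add: bidual_projection_def)
  note d = state_dual[OF \<eta>(1)]
  have "q \<eta> = bidual_mult q q \<eta>" by (simp add: qq)
  also have "\<dots> = q (\<lambda>a. q \<eta> * \<eta> a)"
    by (simp add: bidual_mult_def d \<eta>(2) bidual_scale[OF qb d] mult.commute)
  also have "\<dots> = q \<eta> * q \<eta>" by (rule bidual_scale[OF qb d])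
  finally show ?thesis by simp
qed

lemma dense_tendsto_zero:
  fixes X :: "nat \<Rightarrow> 'a::real_normed_vector \<Rightarrow> 'b::real_normed_vector"
  assumes dense: "closure (range e) = UNIV"
    and lip: "\<And>n x y. norm (X n x - X n y) \<le> 2 * norm (x - y)"
    and lim: "\<And>y. (\<lambda>n. X n (e y)) \<longlonglongrightarrow> 0"
  shows "(\<lambda>n. X n x) \<longlonglongrightarrow> 0"
proof (rule LIMSEQ_I)
  fix \<epsilon> :: real assume \<epsilon>: "0 < \<epsilon>"
  obtain y where y: "dist (e y) x < \<epsilon> / 4"
    using dense \<epsilon> closure_approachable[of x "range e"] by (metis UNIV_I divide_pos_pos rangeE zero_less_numeral)
  obtain M where M: "\<And>n. n \<ge> M \<Longrightarrow> norm (X n (e y)) < \<epsilon> / 2"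
    using LIMSEQ_D[OF lim[of y], of "\<epsilon> / 2"] \<epsilon> by auto
  have "norm (X n x - 0) < \<epsilon>" if "n \<ge> M" for n
    using lip[of n x "e y"] M[OF that] y norm_triangle_ineq[of "X n x - X n (e y)" "X n (e y)"]
    by (simp add: dist_norm norm_minus_commute)
  then show "\<exists>M. \<forall>n\<ge>M. norm (X n x - 0) < \<epsilon>" by blast
qed

section \<open>Support projections of the characters \<open>ev_sigma\<close>\<close>

context
  fixes u :: "'n::finite \<Rightarrow> 'n \<Rightarrow> 'a::cstar_algebra"
  assumes universal: "universal_magic_unitary u"
begin

lemma perm_eval_mult: "perm_eval u \<sigma> (a * b) = perm_eval u \<sigma> a * perm_eval u \<sigma> b"
  by (simp add: perm_eval_def star_hom_mult[OF abelianisation_star_hom[OF universal]] bcontfun_times)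

lemma perm_eval_entry: "perm_eval u \<sigma> (u i j) = (if Perm.apply \<sigma> j = i then 1 else 0)"
  by (simp add: perm_eval_def abelianisation_entry[OF universal] apply_perm_entry)

text \<open>An average of projections fixes a vector only if each of them does. The eigenspace for 1
  is thus the intersection of the ranges of the \<open>u (\<sigma> j) j\<close>, on which the
  algebra acts through the character of \<open>\<sigma>\<close>.\<close>

definition perm_average :: "'n perm \<Rightarrow> 'a"
  where "perm_average \<sigma> = (1 / real CARD('n)) *\<^sub>R (\<Sum>j\<in>UNIV. u (Perm.apply \<sigma> j) j)"

lemma perm_average_star: "star (perm_average \<sigma>) = perm_average \<sigma>"
  by (simp add: perm_average_def star_simps magic_star[OF universal_magic[OF universal]])

lemma perm_average_norm: "norm (perm_average \<sigma>) \<le> 1"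
proof -
  have "norm (\<Sum>j\<in>UNIV. u (Perm.apply \<sigma> j) j) \<le> (\<Sum>j\<in>(UNIV::'n set). 1)"
    by (intro sum_norm_le norm_magic_le universal_magic universal)
  then show ?thesis by (simp add: perm_average_def)
qed

text \<open>For \<open>x n j = (1 - u (\<sigma> j) j) * A n\<close> and the average
  \<open>c\<close>, the sum over \<open>j\<close> of \<open>star (x n j) * x n j\<close> is
  \<open>CARD('n)\<close> times \<open>A n * (1 - c) * A n\<close> and tends to 0; by positivity so
  does each \<open>x n j\<close>. An entry with \<open>i \<noteq> \<sigma> j\<close> is orthogonal
  to \<open>u (\<sigma> j) j\<close>, so \<open>u i j * A n = u i j * x n j\<close>.\<close>

lemma perm_average_eigen_entry:
  defines "A \<equiv> \<lambda>\<sigma>. power_mean (perm_average \<sigma>)"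
  shows "(\<lambda>n. u i j * A \<sigma> n - scaleC (perm_eval u \<sigma> (u i j)) (A \<sigma> n)) \<longlonglongrightarrow> 0"
proof -
  note m = universal_magic[OF universal]
  define x where "x n j = (1 - u (Perm.apply \<sigma> j) j) * A \<sigma> n" for n j
  have A: "star (A \<sigma> n) = A \<sigma> n" "norm (A \<sigma> n) \<le> 1" for n
    unfolding A_def by (rule star_power_mean[OF perm_average_star], rule norm_power_mean_le[OF perm_average_norm])
  have xx: "star (x n j) * x n j = A \<sigma> n * ((1 - u (Perm.apply \<sigma> j) j) * A \<sigma> n)" for n j
  proof -
    have "(1 - u (Perm.apply \<sigma> j) j) * ((1 - u (Perm.apply \<sigma> j) j) * A \<sigma> n) = (1 - u (Perm.apply \<sigma> j) j) * A \<sigma> n"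
      by (simp add: algebra_simps magic_idem[OF m] flip: mult.assoc)
    then show ?thesis by (simp add: x_def star_mult star_diff A magic_star[OF m] mult.assoc)
  qed
  have "(\<Sum>j\<in>UNIV. 1 - u (Perm.apply \<sigma> j) j) = real CARD('n) *\<^sub>R (1 - perm_average \<sigma>)"
    by (simp add: perm_average_def sum_subtractf scaleR_diff_right sum_constant_scaleR del: sum_constant)
  then have sum: "(\<Sum>j\<in>UNIV. star (x n j) * x n j) = real CARD('n) *\<^sub>R (A \<sigma> n * ((1 - perm_average \<sigma>) * A \<sigma> n))" for n
    unfolding xx sum_distrib_left[symmetric] sum_distrib_right[symmetric] by simp
  have x_lim: "(\<lambda>n. x n j) \<longlonglongrightarrow> 0" for j
  proof (rule tendsto_norm_zero_cancel)
    have lim: "(\<lambda>n. real CARD('n) * norm ((1 - perm_average \<sigma>) * A \<sigma> n)) \<longlonglongrightarrow> real CARD('n) * norm (0 :: 'a)"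
      unfolding A_def by (intro tendsto_intros power_mean_residual perm_average_norm)
    have bound: "(norm (x n j))\<^sup>2 \<le> real CARD('n) * norm ((1 - perm_average \<sigma>) * A \<sigma> n)" for n
    proof -
      have "(norm (x n j))\<^sup>2 \<le> norm (\<Sum>j\<in>UNIV. star (x n j) * x n j)"
        by (rule norm_star_mult_le_sum) auto
      also have "\<dots> = real CARD('n) * norm (A \<sigma> n * ((1 - perm_average \<sigma>) * A \<sigma> n))"
        unfolding sum by simp
      also have "\<dots> \<le> real CARD('n) * (1 * norm ((1 - perm_average \<sigma>) * A \<sigma> n))"
        by (intro mult_left_mono order_trans[OF norm_mult_ineq] mult_right_mono A) auto
      finally show ?thesis by simp
    qed
    have "(\<lambda>n. (norm (x n j))\<^sup>2) \<longlonglongrightarrow> 0"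
    proof (rule Lim_null_comparison[OF always_eventually])
      show "\<forall>n. norm ((norm (x n j))\<^sup>2) \<le> real CARD('n) * norm ((1 - perm_average \<sigma>) * A \<sigma> n)"
        using bound by simp
      show "(\<lambda>n. real CARD('n) * norm ((1 - perm_average \<sigma>) * A \<sigma> n)) \<longlonglongrightarrow> 0"
        using lim by simp
    qed
    then have "(\<lambda>n. sqrt ((norm (x n j))\<^sup>2)) \<longlonglongrightarrow> sqrt 0" by (rule tendsto_real_sqrt)
    then show "(\<lambda>n. norm (x n j)) \<longlonglongrightarrow> 0" by simp
  qed
  show ?thesis
  proof (cases "Perm.apply \<sigma> j = i")
    case True
    then show ?thesis
      using tendsto_minus[OF x_lim[of j]] by (simp add: perm_eval_entry x_def left_diff_distrib)
  next
    case False
    have "(\<lambda>n. u i j * x n j) \<longlonglongrightarrow> u i j * 0" by (intro tendsto_intros x_lim)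
    moreover have "u i j * x n j = u i j * A \<sigma> n" for n
    proof -
      have "u i j * (1 - u (Perm.apply \<sigma> j) j) = u i j"
        using magic_col_orthogonal[OF m, of i "Perm.apply \<sigma> j" j] False by (simp add: right_diff_distrib)
      then show ?thesis by (simp add: x_def flip: mult.assoc)
    qed
    ultimately show ?thesis using False by (simp add: perm_eval_entry)
  qed
qed

text \<open>The residual of \<open>x * y\<close> is \<open>x\<close> times the residual of
  \<open>y\<close> plus \<open>?\<eta> y\<close> times that of \<open>x\<close>. So the relation
  passes from entries to words, by linearity to polynomials, and by a uniform Lipschitz bound to the
  closure.\<close>

lemma perm_average_eigen:
  defines "A \<equiv> \<lambda>\<sigma>. power_mean (perm_average \<sigma>)"
  shows "(\<lambda>n. a * A \<sigma> n - scaleC (perm_eval u \<sigma> a) (A \<sigma> n)) \<longlonglongrightarrow> 0"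
proof (rule dense_tendsto_zero[OF universal_magic_dense[OF universal]])
  let ?\<eta> = "perm_eval u \<sigma>"
  note st = state_perm_eval[OF universal, of \<sigma>]
  have A: "norm (A \<sigma> n) \<le> 1" for n
    unfolding A_def by (rule norm_power_mean_le[OF perm_average_norm])
  show "norm ((x * A \<sigma> n - scaleC (?\<eta> x) (A \<sigma> n)) - (y * A \<sigma> n - scaleC (?\<eta> y) (A \<sigma> n))) \<le> 2 * norm (x - y)" for n x y
  proof -
    have "(x * A \<sigma> n - scaleC (?\<eta> x) (A \<sigma> n)) - (y * A \<sigma> n - scaleC (?\<eta> y) (A \<sigma> n))
        = (x - y) * A \<sigma> n - scaleC (?\<eta> x - ?\<eta> y) (A \<sigma> n)"
      using scaleC_add_left[of "?\<eta> x - ?\<eta> y" "?\<eta> y" "A \<sigma> n"] by (simp add: algebra_simps)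
    also have "norm \<dots> \<le> norm (x - y) * 1 + norm (x - y) * 1"
    proof (rule order_trans[OF norm_triangle_ineq4 add_mono])
      show "norm ((x - y) * A \<sigma> n) \<le> norm (x - y) * 1"
        by (intro order_trans[OF norm_mult_ineq] mult_left_mono A) simp
      show "norm (scaleC (?\<eta> x - ?\<eta> y) (A \<sigma> n)) \<le> norm (x - y) * 1"
        unfolding norm_scaleC by (intro mult_mono A state_dist_le st) simp_all
    qed
    finally show ?thesis by simp
  qed
  have word: "(\<lambda>n. prod_list xs * A \<sigma> n - scaleC (?\<eta> (prod_list xs)) (A \<sigma> n)) \<longlonglongrightarrow> 0"
    if "\<And>x. x \<in> set xs \<Longrightarrow> (\<lambda>n. x * A \<sigma> n - scaleC (?\<eta> x) (A \<sigma> n)) \<longlonglongrightarrow> 0" for xs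
    using that
  proof (induction xs)
    case (Cons x xs)
    have "(\<lambda>n. x * (prod_list xs * A \<sigma> n - scaleC (?\<eta> (prod_list xs)) (A \<sigma> n))
          + scaleC (?\<eta> (prod_list xs)) (x * A \<sigma> n - scaleC (?\<eta> x) (A \<sigma> n))) \<longlonglongrightarrow> x * 0 + scaleC (?\<eta> (prod_list xs)) 0"
      using Cons by (intro tendsto_intros) auto
    then show ?case
      by (simp add: perm_eval_mult right_diff_distrib scaleC_diff_right scaleC_scaleC scaleC_mult_right mult.assoc mult.commute[of "?\<eta> x"])
  qed (simp add: state_one[OF st])
  show "(\<lambda>n. free_eval (\<lambda>(i, j). u i j) f * A \<sigma> n - scaleC (?\<eta> (free_eval (\<lambda>(i, j). u i j) f)) (A \<sigma> n)) \<longlonglongrightarrow> 0" for f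
  proof -
    let ?w = "\<lambda>w. prod_list (map (\<lambda>(i, j). u i j) (letters w))" and ?c = "Poly_Mapping.lookup f"
    have "(\<lambda>n. \<Sum>w\<in>Poly_Mapping.keys f. scaleC (?c w) (?w w * A \<sigma> n - scaleC (?\<eta> (?w w)) (A \<sigma> n)))
        \<longlonglongrightarrow> (\<Sum>w\<in>Poly_Mapping.keys f. scaleC (?c w) 0)"
      unfolding A_def by (intro tendsto_intros word[unfolded A_def]) (auto intro: perm_average_eigen_entry)
    then show ?thesis
      by (simp add: free_eval_def sum_distrib_right state_linear[OF st] scaleC_diff_right sum_subtractf
          scaleC_mult_left scaleC_sum_left scaleC_scaleC)
  qed
qed

lemma character_support_perm_eval: "character_support (perm_eval u \<sigma>) (power_mean (perm_average \<sigma>))"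
proof
  note st = state_perm_eval[OF universal, of \<sigma>]
  show "state (perm_eval u \<sigma>)" by (rule st)
  show "perm_eval u \<sigma> (a * b) = perm_eval u \<sigma> a * perm_eval u \<sigma> b" for a b by (rule perm_eval_mult)
  show "star (power_mean (perm_average \<sigma>) n) = power_mean (perm_average \<sigma>) n" for n
    by (rule star_power_mean[OF perm_average_star])
  show "norm (power_mean (perm_average \<sigma>) n) \<le> 1" for n
    by (rule norm_power_mean_le[OF perm_average_norm])
  show "(\<lambda>n. perm_eval u \<sigma> (power_mean (perm_average \<sigma>) n)) \<longlonglongrightarrow> 1"
  proof (rule Lim_transform_eventually[OF tendsto_const eventually_sequentiallyI])
    fix n :: nat assume n: "1 \<le> n"
    have c: "perm_eval u \<sigma> (perm_average \<sigma>) = 1"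
      by (simp add: perm_average_def clinear_scaleR[OF state_clinear[OF st]] state_linear[OF st] perm_eval_entry)
    have "perm_eval u \<sigma> (perm_average \<sigma> ^ k) = 1" for k
      by (induction k) (simp_all add: perm_eval_mult c state_one[OF st])
    then show "1 = perm_eval u \<sigma> (power_mean (perm_average \<sigma>) n)"
      using n by (simp add: power_mean_def clinear_scaleR[OF state_clinear[OF st]] state_linear[OF st])
  qed
  show "(\<lambda>n. a * power_mean (perm_average \<sigma>) n - scaleC (perm_eval u \<sigma> a) (power_mean (perm_average \<sigma>) n)) \<longlonglongrightarrow> 0" for a
    by (rule perm_average_eigen)
  show "\<exists>M. \<forall>m\<ge>M. \<forall>n\<ge>M. \<forall>b. norm b \<le> 1 \<longrightarrow>
      cmod (f ((power_mean (perm_average \<sigma>) m - power_mean (perm_average \<sigma>) n) * b)) \<le> \<epsilon>"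
    if f: "f \<in> dual" and \<epsilon>: "0 < \<epsilon>" for f \<epsilon>
  proof -
    obtain C where C: "clinear f" "\<And>a. cmod (f a) \<le> C * norm a" using dualE[OF f] by blast
    obtain M where "\<And>m n b. M \<le> m \<Longrightarrow> M \<le> n \<Longrightarrow> norm b \<le> 1 \<Longrightarrow>
        cmod (f ((power_mean (perm_average \<sigma>) m - power_mean (perm_average \<sigma>) n) * b)) \<le> \<epsilon>"
      using power_mean_uniformly_Cauchy[OF C perm_average_star perm_average_norm \<epsilon>] by blast
    then show ?thesis by blast
  qed
qed

lemma
  shows support_projection_perm_eval: "bidual_projection (support_projection (perm_eval u \<sigma>))"
    and support_projection_perm_eval_self: "support_projection (perm_eval u \<sigma>) (perm_eval u \<sigma>) = 1"
  using character_support.p_projection[OF character_support_perm_eval]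
    character_support.p_\<eta>[OF character_support_perm_eval]
  by (simp_all add: character_support.support_projection_eq[OF character_support_perm_eval])

text \<open>It suffices that \<open>p_C\<close> has mass at least 1. The diagonal terms
  \<open>w \<tau> * ?q \<tau> (perm_eval u \<tau>)\<close> alone add up to 1, and the mixed terms
  are nonnegative because a character takes only the values 0 and 1 on projections.\<close>

lemma random_permutation_not_genuinely_quantum:
  assumes "\<phi> \<in> random_permutations u"
  shows "\<not> genuinely_quantum u \<phi>"
proof -
  obtain \<rho> where \<rho>: "state \<rho>" "\<phi> = \<rho> \<circ> abelianisation u"
    using assms by (auto simp: random_permutations_def)
  define \<delta> :: "'n perm \<Rightarrow> 'n C_perm" where "\<delta> \<tau> = Bcontfun (\<lambda>\<sigma>. if \<sigma> = \<tau> then 1 else 0)" for \<tau>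
  have \<delta>: "apply_bcontfun (\<delta> \<tau>) \<sigma> = (if \<sigma> = \<tau> then 1 else 0)" for \<sigma> \<tau>
    by (simp add: \<delta>_def apply_Bcontfun_perm)
  define w where "w \<tau> = \<rho> (\<delta> \<tau>)" for \<tau>
  have w: "w \<tau> \<in> \<real>\<^sub>\<ge>\<^sub>0" for \<tau>
  proof -
    have "star (\<delta> \<tau>) * \<delta> \<tau> = \<delta> \<tau>"
      by (rule bcontfun_eqI) (simp add: bcontfun_times bcontfun_star \<delta>)
    then show ?thesis using state_nonneg[OF \<rho>(1), of "\<delta> \<tau>"] by (simp add: w_def)
  qed
  have \<rho>_eq: "\<rho> f = (\<Sum>\<tau>\<in>UNIV. w \<tau> * apply_bcontfun f \<tau>)" for f
  proof -
    have "f = (\<Sum>\<tau>\<in>UNIV. scaleC (apply_bcontfun f \<tau>) (\<delta> \<tau>))"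
      by (rule bcontfun_eqI) (simp add: bcontfun_sum bcontfun_scaleC \<delta> finite_UNIV_perm if_distrib cong: if_cong)
    then have "\<rho> f = \<rho> (\<Sum>\<tau>\<in>UNIV. scaleC (apply_bcontfun f \<tau>) (\<delta> \<tau>))" by simp
    then show ?thesis by (simp add: state_linear[OF \<rho>(1)] w_def mult.commute)
  qed
  have \<phi>_eq: "\<phi> = (\<lambda>a. \<Sum>\<tau>\<in>UNIV. w \<tau> * perm_eval u \<tau> a)"
    by (simp add: \<rho>(2) comp_def \<rho>_eq perm_eval_def)
  have \<phi>: "state \<phi>" unfolding \<rho>(2) by (intro state_comp_star_hom \<rho> abelianisation_star_hom universal)
  let ?q = "\<lambda>\<sigma>. support_projection (perm_eval u \<sigma>)"
  have q\<phi>: "?q \<sigma> \<phi> = (\<Sum>\<tau>\<in>UNIV. w \<tau> * ?q \<sigma> (perm_eval u \<tau>))" for \<sigma>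
    unfolding \<phi>_eq
    using support_projection_perm_eval[of \<sigma>]
    by (intro bidual_sum[THEN conjunct2] state_dual state_perm_eval universal finite_UNIV_perm)
      (simp add: bidual_projection_def)
  have nonneg: "0 \<le> Re (w \<tau> * ?q \<sigma> (perm_eval u \<tau>))" for \<sigma> \<tau>
    using bidual_projection_character[OF support_projection_perm_eval state_perm_eval[OF universal] perm_eval_mult, of \<sigma> \<tau>]
      w[of \<tau>] by (auto simp: complex_nonneg_Reals_iff)
  have "1 = (\<Sum>\<tau>\<in>UNIV. Re (w \<tau>))"
    using \<rho>_eq[of 1] by (simp add: state_one[OF \<rho>(1)] bcontfun_one flip: Re_sum)
  also have "\<dots> = (\<Sum>\<tau>\<in>UNIV. Re (w \<tau> * ?q \<tau> (perm_eval u \<tau>)))"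
    by (simp add: support_projection_perm_eval_self)
  also have "\<dots> \<le> (\<Sum>\<sigma>\<in>UNIV. \<Sum>\<tau>\<in>UNIV. Re (w \<tau> * ?q \<sigma> (perm_eval u \<tau>)))"
  proof (rule sum_mono)
    fix \<sigma> :: "'n perm"
    show "Re (w \<sigma> * ?q \<sigma> (perm_eval u \<sigma>)) \<le> (\<Sum>\<tau>\<in>UNIV. Re (w \<tau> * ?q \<sigma> (perm_eval u \<tau>)))"
      by (rule member_le_sum[OF UNIV_I nonneg finite_UNIV_perm])
  qed
  also have "\<dots> = Re (classical_projection u \<phi>)"
    by (simp add: classical_projection_def q\<phi>)
  finally show ?thesis
    using state_dual[OF \<phi>]
    by (simp add: genuinely_quantum_def normal_extension_def quantum_projection_def bidual_one_def state_one[OF \<phi>])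
qed

end

theorem theorem4p7:
  fixes u :: "'n::finite \<Rightarrow> 'n \<Rightarrow> 'a::cstar_algebra"
    and t :: "'a \<Rightarrow> 'a \<Rightarrow> 'b::cstar_algebra"
    and \<phi> :: "'a \<Rightarrow> complex"
  assumes "universal_magic_unitary u"
    and "min_tensor_product t"
    and "state \<phi>"
    and "genuinely_quantum u \<phi>"
  shows "let \<phi>\<^sub>\<phi> = cesaro_limit u t \<phi>;
             \<phi>' = cesaro_limit u t (conv u t (haar_classical u) \<phi>\<^sub>\<phi>)
         in random_permutations u \<subset> quasi_subgroup u t \<phi>' \<and>
            quasi_subgroup u t \<phi>' \<subseteq> {\<rho>. state \<rho>}"
proof -
  interpret quantum_permutations u t by standard (rule assms)+
  have "\<phi> \<notin> random_permutations u"
    using random_permutation_not_genuinely_quantum[OF assms(1)] assms(4) by blast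
  then show ?thesis
    using quasi_subgroup_generated[OF assms(3)] by (auto simp: Let_def quasi_subgroup_def)
qed

end
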